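(* Let $1\le p\le 2$, and let $G$ be a closed subgroup of $\mathcal{U}_p(\ell^2)$ with property (FH). Then $G$ is a compact Lie group.
   Context: $\ell^2$ is the separable infinite-dimensional complex Hilbert space. $\mathcal{U}_p(\ell^2)$ is the Schatten $p$-unitary group: the group of all unitaries $u$ on $\ell^2$ such that $u-1$ belongs to the Schatten $p$-class, with the topology of the metric $d(u,v)=\|u-v\|_p$, where $\|x\|_p=\mathrm{Tr}(|x|^p)^{1/p}$. A topological group has property (FH) if every continuous affine isometric action of it on a real Hilbert space has a fixed point. *)

theory Defs
  imports "HOL-Analysis.Analysis" "HOL-Algebra.Module" "HOL-Algebra.Group_Action"
    "HOL-Computational_Algebra.Polynomial"
begin

section \<open>The Hilbert space of square-summable complex sequences\<close>

typedef ell2 = "{x :: nat \<Rightarrow> complex. summable (\<lambda>n. (cmod (x n))\<^sup>2)}"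
  morphisms coord Abs_ell2
  by (rule exI[of _ "\<lambda>_. 0"]) simp

setup_lifting type_definition_ell2

lemma coord_summable: "summable (\<lambda>n. (cmod (coord x n))\<^sup>2)"
  using coord by auto

lemma ell2_eqI: "(\<And>n. coord x n = coord y n) \<Longrightarrow> x = y"
  by (simp add: coord_inject[symmetric] fun_eq_iff)

lemma ell2_summable_add:
  fixes x y :: "nat \<Rightarrow> complex"
  assumes "summable (\<lambda>n. (cmod (x n))\<^sup>2)" and "summable (\<lambda>n. (cmod (y n))\<^sup>2)"
  shows "summable (\<lambda>n. (cmod (x n + y n))\<^sup>2)"
proof (rule summable_comparison_test')
  show "summable (\<lambda>n. 2 * (cmod (x n))\<^sup>2 + 2 * (cmod (y n))\<^sup>2)"
    using assms by (intro summable_add summable_mult)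
  fix n
  have "(cmod (x n + y n))\<^sup>2 \<le> (cmod (x n) + cmod (y n))\<^sup>2"
    by (intro power_mono norm_triangle_ineq) auto
  also have "\<dots> \<le> 2 * (cmod (x n))\<^sup>2 + 2 * (cmod (y n))\<^sup>2"
    using sum_squares_bound[of "cmod (x n)" "cmod (y n)"] by (simp add: power2_sum)
  finally show "norm ((cmod (x n + y n))\<^sup>2) \<le> 2 * (cmod (x n))\<^sup>2 + 2 * (cmod (y n))\<^sup>2"
    by simp
qed

lemma ell2_summable_scale:
  fixes x :: "nat \<Rightarrow> complex"
  assumes "summable (\<lambda>n. (cmod (x n))\<^sup>2)"
  shows "summable (\<lambda>n. (cmod (c * x n))\<^sup>2)"
  using assms by (simp add: norm_mult power_mult_distrib summable_mult)

lift_definition scaleC :: "complex \<Rightarrow> ell2 \<Rightarrow> ell2"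
  is "\<lambda>c x n. c * x n" by (rule ell2_summable_scale)

text \<open>The complex inner product, conjugate-linear in the first argument.\<close>

definition cinner :: "ell2 \<Rightarrow> ell2 \<Rightarrow> complex"
  where "cinner x y = (\<Sum>n. cnj (coord x n) * coord y n)"

lemma cinner_abs_summable: "summable (\<lambda>n. cmod (cnj (coord x n) * coord y n))"
proof (rule summable_comparison_test')
  show "summable (\<lambda>n. (cmod (coord x n))\<^sup>2 + (cmod (coord y n))\<^sup>2)"
    by (intro summable_add coord_summable)
  fix n
  have "0 \<le> cmod (coord x n) * cmod (coord y n)" by simp
  moreover have "2 * (cmod (coord x n) * cmod (coord y n))
      \<le> (cmod (coord x n))\<^sup>2 + (cmod (coord y n))\<^sup>2"
    using sum_squares_bound[of "cmod (coord x n)" "cmod (coord y n)"] by (simp add: mult.assoc)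
  ultimately have "cmod (coord x n) * cmod (coord y n)
      \<le> (cmod (coord x n))\<^sup>2 + (cmod (coord y n))\<^sup>2" by linarith
  then show "norm (cmod (cnj (coord x n) * coord y n)) \<le> (cmod (coord x n))\<^sup>2 + (cmod (coord y n))\<^sup>2"
    by (simp add: norm_mult)
qed

lemma cinner_summable: "summable (\<lambda>n. cnj (coord x n) * coord y n)"
  by (rule summable_norm_cancel[OF cinner_abs_summable])

instantiation ell2 :: real_inner
begin

lift_definition zero_ell2 :: ell2 is "\<lambda>_. 0" by simp

lift_definition plus_ell2 :: "ell2 \<Rightarrow> ell2 \<Rightarrow> ell2" is "\<lambda>x y n. x n + y n"
  by (rule ell2_summable_add)

lift_definition uminus_ell2 :: "ell2 \<Rightarrow> ell2" is "\<lambda>x n. - x n" by simp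

lift_definition minus_ell2 :: "ell2 \<Rightarrow> ell2 \<Rightarrow> ell2" is "\<lambda>x y n. x n - y n"
  subgoal for x y using ell2_summable_add[of x "\<lambda>n. - y n"] by simp
  done

lift_definition scaleR_ell2 :: "real \<Rightarrow> ell2 \<Rightarrow> ell2" is "\<lambda>r x n. complex_of_real r * x n"
  by (rule ell2_summable_scale)

definition inner_ell2 :: "ell2 \<Rightarrow> ell2 \<Rightarrow> real" where "inner_ell2 x y = Re (cinner x y)"
definition norm_ell2 :: "ell2 \<Rightarrow> real" where "norm_ell2 x = sqrt (inner x x)"
definition sgn_ell2 :: "ell2 \<Rightarrow> ell2" where "sgn_ell2 x = inverse (norm x) *\<^sub>R x"
definition dist_ell2 :: "ell2 \<Rightarrow> ell2 \<Rightarrow> real" where "dist_ell2 x y = norm (x - y)"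
definition uniformity_ell2 :: "(ell2 \<times> ell2) filter"
  where "uniformity_ell2 = (INF e\<in>{0 <..}. principal {(x, y). dist x y < e})"
definition open_ell2 :: "ell2 set \<Rightarrow> bool"
  where "open_ell2 U \<longleftrightarrow> (\<forall>x\<in>U. eventually (\<lambda>(x', y). x' = x \<longrightarrow> y \<in> U) uniformity)"

lemma inner_ell2_sum: "inner x y = (\<Sum>n. Re (cnj (coord x n) * coord y n))"
  by (simp add: inner_ell2_def cinner_def Re_suminf[OF cinner_summable])

lemma inner_ell2_summable: "summable (\<lambda>n. Re (cnj (coord x n) * coord y n))"
  by (rule summable_Re[OF cinner_summable])

lemma inner_ell2_self: "inner x x = (\<Sum>n. (cmod (coord x n))\<^sup>2)"
  by (simp add: inner_ell2_sum cmod_power2) (simp add: power2_eq_square)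

instance
proof
  fix x y z :: ell2 and a b r :: real
  show "x + y + z = x + (y + z)" by transfer (simp add: add.assoc)
  show "x + y = y + x" by transfer (simp add: add.commute)
  show "0 + x = x" by transfer simp
  show "- x + x = 0" by transfer simp
  show "x - y = x + - y" by transfer simp
  show "a *\<^sub>R (x + y) = a *\<^sub>R x + a *\<^sub>R y" by transfer (simp add: algebra_simps)
  show "(a + b) *\<^sub>R x = a *\<^sub>R x + b *\<^sub>R x" by transfer (simp add: algebra_simps)
  show "a *\<^sub>R b *\<^sub>R x = (a * b) *\<^sub>R x" by transfer (simp add: algebra_simps)
  show "1 *\<^sub>R x = x" by transfer simp
  show "inner x y = inner y x"
    by (simp add: inner_ell2_sum) (simp add: mult.commute)
  have "inner (x + y) z
      = (\<Sum>n. Re (cnj (coord x n) * coord z n) + Re (cnj (coord y n) * coord z n))"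
    unfolding inner_ell2_sum by (rule suminf_cong) (simp add: plus_ell2.rep_eq algebra_simps)
  then show "inner (x + y) z = inner x z + inner y z"
    by (simp only: inner_ell2_sum suminf_add[OF inner_ell2_summable inner_ell2_summable])
  have "inner (r *\<^sub>R x) y = (\<Sum>n. r * Re (cnj (coord x n) * coord y n))"
    unfolding inner_ell2_sum by (rule suminf_cong) (simp add: scaleR_ell2.rep_eq algebra_simps)
  then show "inner (r *\<^sub>R x) y = r * inner x y"
    by (simp only: inner_ell2_sum suminf_mult[OF inner_ell2_summable])
  show "0 \<le> inner x x"
    unfolding inner_ell2_self by (rule suminf_nonneg[OF coord_summable]) simp
  show "inner x x = 0 \<longleftrightarrow> x = 0"
    unfolding inner_ell2_self suminf_eq_zero_iff[OF coord_summable zero_le_power2]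
    by (auto intro!: ell2_eqI simp: zero_ell2.rep_eq)
qed (simp_all add: norm_ell2_def sgn_ell2_def dist_ell2_def uniformity_ell2_def open_ell2_def)

end

lemma norm_ell2_sum: "(norm x)\<^sup>2 = (\<Sum>n. (cmod (coord x n))\<^sup>2)" for x :: ell2
  by (simp add: power2_norm_eq_inner inner_ell2_self)

lemma norm_coord_le: "cmod (coord x n) \<le> norm x"
proof (rule power2_le_imp_le)
  have "(\<Sum>i\<in>{n}. (cmod (coord x i))\<^sup>2) \<le> (\<Sum>i. (cmod (coord x i))\<^sup>2)"
    by (rule sum_le_suminf[OF coord_summable]) auto
  then show "(cmod (coord x n))\<^sup>2 \<le> (norm x)\<^sup>2" by (simp add: norm_ell2_sum)
qed simp

instance ell2 :: complete_space
proof
  fix X :: "nat \<Rightarrow> ell2"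
  assume X: "Cauchy X"
  have "Cauchy (\<lambda>k. coord (X k) n)" for n
    unfolding Cauchy_def
  proof safe
    fix e :: real assume "e > 0"
    then obtain M where M: "\<And>k l. k \<ge> M \<Longrightarrow> l \<ge> M \<Longrightarrow> dist (X k) (X l) < e"
      using X unfolding Cauchy_def by metis
    have "dist (coord (X k) n) (coord (X l) n) \<le> dist (X k) (X l)" for k l
      using norm_coord_le[of "X k - X l" n] by (simp add: dist_norm minus_ell2.rep_eq)
    then show "\<exists>M. \<forall>k\<ge>M. \<forall>l\<ge>M. dist (coord (X k) n) (coord (X l) n) < e"
      using M by (meson le_less_trans)
  qed
  then have "\<exists>z. (\<lambda>k. coord (X k) n) \<longlonglongrightarrow> z" for n
    by (simp add: Cauchy_convergent_iff convergent_def)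
  then obtain y where y: "\<And>n. (\<lambda>k. coord (X k) n) \<longlonglongrightarrow> y n" by metis
  have tail: "\<exists>K. \<forall>k\<ge>K. \<forall>N. (\<Sum>n<N. (cmod (coord (X k) n - y n))\<^sup>2) \<le> e\<^sup>2"
    if "e > 0" for e :: real
  proof -
    obtain K where K: "\<And>k l. k \<ge> K \<Longrightarrow> l \<ge> K \<Longrightarrow> norm (X k - X l) < e"
      using X \<open>e > 0\<close> unfolding Cauchy_def dist_norm by metis
    have "(\<Sum>n<N. (cmod (coord (X k) n - y n))\<^sup>2) \<le> e\<^sup>2" if "k \<ge> K" for k N
    proof (rule tendsto_upperbound)
      show "(\<lambda>l. \<Sum>n<N. (cmod (coord (X k) n - coord (X l) n))\<^sup>2)
          \<longlonglongrightarrow> (\<Sum>n<N. (cmod (coord (X k) n - y n))\<^sup>2)"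
        by (intro tendsto_intros y)
      have "(\<Sum>n<N. (cmod (coord (X k) n - coord (X l) n))\<^sup>2) \<le> e\<^sup>2" if "l \<ge> K" for l
      proof -
        have "(\<Sum>n<N. (cmod (coord (X k) n - coord (X l) n))\<^sup>2)
            = (\<Sum>n<N. (cmod (coord (X k - X l) n))\<^sup>2)"
          by (simp add: minus_ell2.rep_eq)
        also have "\<dots> \<le> (norm (X k - X l))\<^sup>2"
          unfolding norm_ell2_sum by (rule sum_le_suminf[OF coord_summable]) auto
        also have "\<dots> \<le> e\<^sup>2"
          using K[OF \<open>k \<ge> K\<close> \<open>l \<ge> K\<close>] by (intro power_mono) auto
        finally show ?thesis .
      qed
      then show "\<forall>\<^sub>F l in sequentially.
          (\<Sum>n<N. (cmod (coord (X k) n - coord (X l) n))\<^sup>2) \<le> e\<^sup>2"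
        by (auto simp: eventually_sequentially)
    qed simp
    then show ?thesis by blast
  qed
  have y_diff: "summable (\<lambda>n. (cmod (coord (X k) n - y n))\<^sup>2)"
    if "\<And>N. (\<Sum>n<N. (cmod (coord (X k) n - y n))\<^sup>2) \<le> C" for k C
    using that[of "Suc _"] unfolding lessThan_Suc_atMost
    by (intro bounded_imp_summable[where B = C]) auto
  obtain K where "\<And>N. (\<Sum>n<N. (cmod (coord (X K) n - y n))\<^sup>2) \<le> 1\<^sup>2"
    using tail[of 1] by auto
  then have "summable (\<lambda>n. (cmod (coord (X K) n - y n))\<^sup>2)" by (rule y_diff)
  from ell2_summable_add[OF coord_summable[of "- X K"] this]
  have "summable (\<lambda>n. (cmod (y n))\<^sup>2)" by (simp add: uminus_ell2.rep_eq)
  then have cy: "coord (Abs_ell2 y) = y" by (simp add: Abs_ell2_inverse)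
  have "X \<longlonglongrightarrow> Abs_ell2 y"
  proof (rule metric_LIMSEQ_I)
    fix e :: real assume "e > 0"
    then obtain K where K: "\<And>k N. k \<ge> K \<Longrightarrow> (\<Sum>n<N. (cmod (coord (X k) n - y n))\<^sup>2) \<le> (e/2)\<^sup>2"
      using tail[of "e/2"] by auto
    have "dist (X k) (Abs_ell2 y) < e" if "k \<ge> K" for k
    proof -
      have "(norm (X k - Abs_ell2 y))\<^sup>2 \<le> (e/2)\<^sup>2"
        unfolding norm_ell2_sum minus_ell2.rep_eq cy
        by (rule suminf_le_const[OF y_diff[OF K[OF that]] K[OF that]])
      then have "norm (X k - Abs_ell2 y) \<le> e/2"
        using \<open>e > 0\<close> power2_le_imp_le[of "norm (X k - Abs_ell2 y)" "e/2"] by simp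
      then show ?thesis using \<open>e > 0\<close> by (simp add: dist_norm)
    qed
    then show "\<exists>no. \<forall>n\<ge>no. dist (X n) (Abs_ell2 y) < e" by blast
  qed
  then show "convergent X" by (auto simp: convergent_def)
qed

definition unit_vec :: "nat \<Rightarrow> ell2"
  where "unit_vec n = Abs_ell2 (\<lambda>m. if m = n then 1 else 0)"


section \<open>Bounded operators and Schatten classes\<close>

text \<open>The library type \<^typ>\<open>ell2 \<Rightarrow>\<^sub>L ell2\<close> consists of the bounded real-linear maps; the bounded
  operators of the complex Hilbert space are the complex-linear ones among them, and
  the operator norm is the same.\<close>

definition complex_linear :: "(ell2 \<Rightarrow>\<^sub>L ell2) \<Rightarrow> bool"
  where "complex_linear A \<longleftrightarrow> (\<forall>c x. A (scaleC c x) = scaleC c (A x))"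

definition adjoint_op :: "(ell2 \<Rightarrow>\<^sub>L ell2) \<Rightarrow> (ell2 \<Rightarrow>\<^sub>L ell2)"
  where "adjoint_op A = (THE B :: ell2 \<Rightarrow>\<^sub>L ell2. \<forall>x y. cinner (B x) y = cinner x (A y))"

definition unitary_op :: "(ell2 \<Rightarrow>\<^sub>L ell2) \<Rightarrow> bool"
  where "unitary_op u \<longleftrightarrow> complex_linear u \<and>
    adjoint_op u o\<^sub>L u = id_blinfun \<and> u o\<^sub>L adjoint_op u = id_blinfun"

definition poly_op :: "real poly \<Rightarrow> (ell2 \<Rightarrow>\<^sub>L ell2) \<Rightarrow> (ell2 \<Rightarrow>\<^sub>L ell2)"
  where "poly_op q A = (\<Sum>i\<le>degree q. coeff q i *\<^sub>R (((o\<^sub>L) A) ^^ i) id_blinfun)"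

text \<open>Continuous functional calculus for a positive operator \<open>A\<close>, whose spectrum is contained in
  the interval from \<open>0\<close> to the norm of \<open>A\<close>: \<open>f(A)\<close> is the norm limit of \<open>q\<^sub>k(A)\<close> for every
  sequence of polynomials \<open>q\<^sub>k\<close> converging to \<open>f\<close> uniformly on this interval. Such sequences exist
  for continuous \<open>f\<close> by the Weierstrass theorem.\<close>

definition fun_calc :: "(real \<Rightarrow> real) \<Rightarrow> (ell2 \<Rightarrow>\<^sub>L ell2) \<Rightarrow> (ell2 \<Rightarrow>\<^sub>L ell2)"
  where "fun_calc f A = (THE B. \<forall>q :: nat \<Rightarrow> real poly.
    uniform_limit {0..norm A} (\<lambda>k. poly (q k)) f sequentially \<longrightarrow>
    (\<lambda>k. poly_op (q k) A) \<longlonglongrightarrow> B)"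

definition abs_op :: "(ell2 \<Rightarrow>\<^sub>L ell2) \<Rightarrow> (ell2 \<Rightarrow>\<^sub>L ell2)"
  where "abs_op x = fun_calc sqrt (adjoint_op x o\<^sub>L x)"

text \<open>The trace of a positive operator, with values in \<open>[0,\<infinity>]\<close>.\<close>

definition pos_trace :: "(ell2 \<Rightarrow>\<^sub>L ell2) \<Rightarrow> ennreal"
  where "pos_trace A = (\<Sum>n. ennreal (Re (cinner (unit_vec n) (A (unit_vec n)))))"

definition schatten_trace :: "real \<Rightarrow> (ell2 \<Rightarrow>\<^sub>L ell2) \<Rightarrow> ennreal"
  where "schatten_trace p x = pos_trace (fun_calc (\<lambda>t. t powr p) (abs_op x))"

definition schatten_class :: "real \<Rightarrow> (ell2 \<Rightarrow>\<^sub>L ell2) set"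
  where "schatten_class p = {x. complex_linear x \<and> schatten_trace p x < \<infinity>}"

definition schatten_norm :: "real \<Rightarrow> (ell2 \<Rightarrow>\<^sub>L ell2) \<Rightarrow> real"
  where "schatten_norm p x = enn2real (schatten_trace p x) powr (1 / p)"

definition schatten_unitary_group :: "real \<Rightarrow> (ell2 \<Rightarrow>\<^sub>L ell2) monoid"
  where "schatten_unitary_group p =
    \<lparr>carrier = {u. unitary_op u \<and> u - id_blinfun \<in> schatten_class p},
     mult = (o\<^sub>L), one = id_blinfun\<rparr>"

text \<open>The library constant \<open>Metric_space.mtopology\<close> can only be unfolded once the metric axioms have
  been verified, so the topology of a metric is written out here.\<close>

definition metric_topology :: "'a set \<Rightarrow> ('a \<Rightarrow> 'a \<Rightarrow> real) \<Rightarrow> 'a topology"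
  where "metric_topology M d =
    topology (\<lambda>U. U \<subseteq> M \<and> (\<forall>x\<in>U. \<exists>r>0. {y \<in> M. d x y < r} \<subseteq> U))"

lemma metric_topology_eq_mtopology:
  assumes "Metric_space M d"
  shows "metric_topology M d = Metric_space.mtopology M d"
proof -
  interpret Metric_space M d by (rule assms)
  have "(\<lambda>U. U \<subseteq> M \<and> (\<forall>x\<in>U. \<exists>r>0. {y \<in> M. d x y < r} \<subseteq> U)) = mopen"
    unfolding mopen_def mball_def fun_eq_iff by blast
  then show ?thesis by (simp add: metric_topology_def mtopology_def)
qed

lemma openin_metric_topology:
  "openin (metric_topology M d) U \<longleftrightarrow> U \<subseteq> M \<and> (\<forall>x\<in>U. \<exists>r>0. {y \<in> M. d x y < r} \<subseteq> U)"
proof -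
  have "istopology (\<lambda>U. U \<subseteq> M \<and> (\<forall>x\<in>U. \<exists>r>0. {y \<in> M. d x y < r} \<subseteq> U))"
    (is "istopology ?P")
    unfolding istopology_def
  proof (rule conjI; intro allI impI)
    fix S T
    assume S: "?P S" and T: "?P T"
    show "?P (S \<inter> T)"
    proof (intro conjI ballI)
      fix x assume "x \<in> S \<inter> T"
      then obtain r s where "r > 0" "{y \<in> M. d x y < r} \<subseteq> S" "s > 0" "{y \<in> M. d x y < s} \<subseteq> T"
        using S T by blast
      then show "\<exists>r>0. {y \<in> M. d x y < r} \<subseteq> S \<inter> T"
        by (intro exI[of _ "min r s"]) auto
    qed (use S in blast)
  next
    fix K assume K: "\<forall>S\<in>K. ?P S"
    show "?P (\<Union>K)"
    proof (intro conjI ballI)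
      fix x assume "x \<in> \<Union>K"
      then obtain S where "S \<in> K" "x \<in> S" by blast
      then obtain r where "r > 0" "{y \<in> M. d x y < r} \<subseteq> S" using K by blast
      then show "\<exists>r>0. {y \<in> M. d x y < r} \<subseteq> \<Union>K" using \<open>S \<in> K\<close> by blast
    qed (use K in blast)
  qed
  then show ?thesis by (simp add: metric_topology_def)
qed

definition schatten_unitary_topology :: "real \<Rightarrow> (ell2 \<Rightarrow>\<^sub>L ell2) topology"
  where "schatten_unitary_topology p =
    metric_topology (carrier (schatten_unitary_group p)) (\<lambda>u v. schatten_norm p (u - v))"


section \<open>Real Hilbert spaces and property (FH)\<close>

definition real_ring :: "real ring"
  where "real_ring = \<lparr>carrier = UNIV, mult = (*), one = 1, zero = 0, add = (+)\<rparr>"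

text \<open>The multiplicative fields of the record inherited from \<^typ>\<open>('a, 'b) module\<close> play no role.\<close>

record 'v inner_space = "(real, 'v) module" +
  ip :: "'v \<Rightarrow> 'v \<Rightarrow> real"

text \<open>The value outside the carrier is fixed because the locale \<^locale>\<open>Metric_space\<close> has
  assumptions on all elements of the type.\<close>

definition ip_dist :: "('v, 'm) inner_space_scheme \<Rightarrow> 'v \<Rightarrow> 'v \<Rightarrow> real"
  where "ip_dist V x y = (if x \<in> carrier V \<and> y \<in> carrier V
    then sqrt (ip V (x \<ominus>\<^bsub>V\<^esub> y) (x \<ominus>\<^bsub>V\<^esub> y)) else 0)"

definition ip_topology :: "('v, 'm) inner_space_scheme \<Rightarrow> 'v topology"
  where "ip_topology V = Metric_space.mtopology (carrier V) (ip_dist V)"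

locale real_inner_space = module real_ring V
  for V :: "('v, 'm) inner_space_scheme" (structure) +
  assumes ip_commute: "\<lbrakk>x \<in> carrier V; y \<in> carrier V\<rbrakk> \<Longrightarrow> ip V x y = ip V y x"
    and ip_add_left: "\<lbrakk>x \<in> carrier V; y \<in> carrier V; z \<in> carrier V\<rbrakk>
      \<Longrightarrow> ip V (x \<oplus>\<^bsub>V\<^esub> y) z = ip V x z + ip V y z"
    and ip_smult_left: "\<lbrakk>x \<in> carrier V; y \<in> carrier V\<rbrakk>
      \<Longrightarrow> ip V (r \<odot>\<^bsub>V\<^esub> x) y = r * ip V x y"
    and ip_ge_zero: "x \<in> carrier V \<Longrightarrow> 0 \<le> ip V x x"
    and ip_eq_zero: "\<lbrakk>x \<in> carrier V; ip V x x = 0\<rbrakk> \<Longrightarrow> x = \<zero>\<^bsub>V\<^esub>"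

locale real_hilbert_space = real_inner_space +
  assumes complete: "Metric_space.mcomplete (carrier V) (ip_dist V)"

definition affine_isometric_action ::
    "('a, 'k) monoid_scheme \<Rightarrow> 'a topology \<Rightarrow> ('v, 'm) inner_space_scheme \<Rightarrow> ('a \<Rightarrow> 'v \<Rightarrow> 'v) \<Rightarrow> bool"
  where "affine_isometric_action G T V \<alpha> \<longleftrightarrow>
    group_action G (carrier V) \<alpha> \<and>
    (\<forall>g\<in>carrier G. \<forall>x\<in>carrier V. \<forall>y\<in>carrier V. \<forall>t.
      \<alpha> g (((1 - t) \<odot>\<^bsub>V\<^esub> x) \<oplus>\<^bsub>V\<^esub> (t \<odot>\<^bsub>V\<^esub> y)) = ((1 - t) \<odot>\<^bsub>V\<^esub> \<alpha> g x) \<oplus>\<^bsub>V\<^esub> (t \<odot>\<^bsub>V\<^esub> \<alpha> g y)) \<and>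
    (\<forall>g\<in>carrier G. \<forall>x\<in>carrier V. \<forall>y\<in>carrier V. ip_dist V (\<alpha> g x) (\<alpha> g y) = ip_dist V x y) \<and>
    continuous_map (prod_topology T (ip_topology V)) (ip_topology V) (\<lambda>(g, x). \<alpha> g x)"

text \<open>HOL cannot quantify over all real Hilbert spaces of all types inside a formula. For a group with
  elements in \<open>'a\<close> it suffices to consider the spaces whose underlying set lies in \<open>'a \<Rightarrow> real\<close>:
  the lemma \<open>property_FH_fixed_point\<close> below shows that the fixed point property for these implies it
  for all real Hilbert spaces, over any type.\<close>

definition property_FH :: "('a, 'k) monoid_scheme \<Rightarrow> 'a topology \<Rightarrow> bool"
  where "property_FH G T \<longleftrightarrow>
    (\<forall>(V :: ('a \<Rightarrow> real) inner_space) \<alpha>.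
      real_hilbert_space V \<and> affine_isometric_action G T V \<alpha> \<longrightarrow>
      (\<exists>x\<in>carrier V. \<forall>g\<in>carrier G. \<alpha> g x = x))"

lemma real_ring_simps [simp]:
  "carrier real_ring = UNIV" "mult real_ring = (*)" "one real_ring = 1"
  "zero real_ring = 0" "add real_ring = (+)"
  by (simp_all add: real_ring_def)

lemma cring_real_ring: "cring real_ring"
proof -
  have "\<exists>y. y + x = 0" for x :: real
    by (rule exI[of _ "- x"]) simp
  then show ?thesis
    by unfold_locales (auto simp: Units_def algebra_simps)
qed

context real_inner_space
begin

lemma ip_zero_left [simp]: "y \<in> carrier V \<Longrightarrow> ip V \<zero>\<^bsub>V\<^esub> y = 0"
  using ip_add_left[of "\<zero>\<^bsub>V\<^esub>" "\<zero>\<^bsub>V\<^esub>" y] by simp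

lemma ip_add_right: "\<lbrakk>x \<in> carrier V; y \<in> carrier V; z \<in> carrier V\<rbrakk>
    \<Longrightarrow> ip V z (x \<oplus>\<^bsub>V\<^esub> y) = ip V z x + ip V z y"
  by (simp add: ip_commute[of z] ip_add_left)

lemma ip_smult_right: "\<lbrakk>x \<in> carrier V; y \<in> carrier V\<rbrakk> \<Longrightarrow> ip V y (r \<odot>\<^bsub>V\<^esub> x) = r * ip V y x"
  by (simp add: ip_commute[of y] ip_smult_left)

lemma smult_carrier: "x \<in> carrier V \<Longrightarrow> r \<odot>\<^bsub>V\<^esub> x \<in> carrier V"
  by simp

lemma ip_minus_left: "\<lbrakk>x \<in> carrier V; y \<in> carrier V\<rbrakk> \<Longrightarrow> ip V (\<ominus>\<^bsub>V\<^esub> x) y = - ip V x y"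
  using ip_add_left[of "\<ominus>\<^bsub>V\<^esub> x" x y] M.l_neg[of x] by simp

lemma ip_diff_left: "\<lbrakk>x \<in> carrier V; y \<in> carrier V; z \<in> carrier V\<rbrakk>
    \<Longrightarrow> ip V (x \<ominus>\<^bsub>V\<^esub> y) z = ip V x z - ip V y z"
  by (simp add: a_minus_def ip_add_left ip_minus_left)

lemma ip_diff_right: "\<lbrakk>x \<in> carrier V; y \<in> carrier V; z \<in> carrier V\<rbrakk>
    \<Longrightarrow> ip V z (x \<ominus>\<^bsub>V\<^esub> y) = ip V z x - ip V z y"
  by (simp add: ip_commute[of z] ip_diff_left)

lemma ip_Cauchy_Schwarz:
  assumes "x \<in> carrier V" and "y \<in> carrier V"
  shows "\<bar>ip V x y\<bar> \<le> sqrt (ip V x x) * sqrt (ip V y y)"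
proof (cases "ip V y y = 0")
  case True
  then have "y = \<zero>\<^bsub>V\<^esub>" using ip_eq_zero assms by blast
  then have "ip V x y = 0" using assms by (simp add: ip_commute[of x])
  then show ?thesis using True by simp
next
  case False
  define t where "t = - ip V x y / ip V y y"
  have pos: "ip V y y > 0" using False ip_ge_zero[of y] assms by auto
  have "0 \<le> ip V (x \<oplus>\<^bsub>V\<^esub> (t \<odot>\<^bsub>V\<^esub> y)) (x \<oplus>\<^bsub>V\<^esub> (t \<odot>\<^bsub>V\<^esub> y))"
    using assms by (intro ip_ge_zero) simp
  also have "\<dots> = ip V x x + 2 * t * ip V x y + t * t * ip V y y"
    using assms by (simp add: ip_add_left ip_add_right ip_smult_left ip_smult_right
        ip_commute[of y x] algebra_simps)
  also have "\<dots> = ip V x x - (ip V x y)\<^sup>2 / ip V y y"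
    using False by (simp add: t_def field_simps power2_eq_square)
  finally have "(ip V x y)\<^sup>2 \<le> ip V x x * ip V y y"
    using pos by (simp add: field_simps)
  then show ?thesis
    by (metis real_sqrt_abs real_sqrt_le_iff real_sqrt_mult)
qed

lemma ip_metric: "Metric_space (carrier V) (ip_dist V)"
proof
  show "0 \<le> ip_dist V x y" for x y
    by (auto simp: ip_dist_def intro!: ip_ge_zero)
  show "ip_dist V x y = ip_dist V y x" for x y
    by (auto simp: ip_dist_def ip_diff_left ip_diff_right)
  show "ip_dist V x y = 0 \<longleftrightarrow> x = y" if "x \<in> carrier V" "y \<in> carrier V" for x y
  proof
    assume "ip_dist V x y = 0"
    then have "x \<ominus>\<^bsub>V\<^esub> y = \<zero>\<^bsub>V\<^esub>"
      using that ip_eq_zero[of "x \<ominus>\<^bsub>V\<^esub> y"] by (simp add: ip_dist_def)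
    then show "x = y" using that M.minus_equality[of x "\<ominus>\<^bsub>V\<^esub> y"] by (simp add: a_minus_def)
  qed (use that in \<open>simp add: ip_dist_def ip_diff_left ip_diff_right\<close>)
  fix x y z
  assume xyz: "x \<in> carrier V" "y \<in> carrier V" "z \<in> carrier V"
  define u w where "u = x \<ominus>\<^bsub>V\<^esub> y" and "w = y \<ominus>\<^bsub>V\<^esub> z"
  have uw: "u \<in> carrier V" "w \<in> carrier V" using xyz by (auto simp: u_def w_def)
  have "ip V (x \<ominus>\<^bsub>V\<^esub> z) (x \<ominus>\<^bsub>V\<^esub> z) = ip V u u + 2 * ip V u w + ip V w w"
    using xyz by (simp add: u_def w_def ip_diff_left ip_diff_right ip_commute[of z x]
        ip_commute[of y x] ip_commute[of z y])
  also have "\<dots> \<le> (sqrt (ip V u u) + sqrt (ip V w w))\<^sup>2"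
    using ip_Cauchy_Schwarz[OF uw] ip_ge_zero[OF uw(1)] ip_ge_zero[OF uw(2)]
    by (simp add: power2_sum)
  finally have "sqrt (ip V (x \<ominus>\<^bsub>V\<^esub> z) (x \<ominus>\<^bsub>V\<^esub> z)) \<le> sqrt (ip V u u) + sqrt (ip V w w)"
    using ip_ge_zero[OF uw(1)] ip_ge_zero[OF uw(2)] by (intro real_le_lsqrt) auto
  then show "ip_dist V x z \<le> ip_dist V x y + ip_dist V y z"
    using xyz by (simp add: ip_dist_def u_def w_def)
qed

end

text \<open>Closed linear subspaces, described through affine combinations so that preimages under the
  maps of an affine action are easily treated.\<close>

definition affine_closed :: "('v, 'm) inner_space_scheme \<Rightarrow> 'v set \<Rightarrow> bool" where
  "affine_closed V S \<longleftrightarrow> \<zero>\<^bsub>V\<^esub> \<in> S \<and> closedin (ip_topology V) S \<and>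
    (\<forall>x\<in>S. \<forall>y\<in>S. \<forall>t. ((1 - t) \<odot>\<^bsub>V\<^esub> x) \<oplus>\<^bsub>V\<^esub> (t \<odot>\<^bsub>V\<^esub> y) \<in> S)"

text \<open>The structure of the subspace \<open>W\<close> carried over to its image under the injection \<open>f\<close>.\<close>

definition transport_space :: "('v, 'm) inner_space_scheme \<Rightarrow> 'v set \<Rightarrow> ('v \<Rightarrow> 'w) \<Rightarrow> 'w inner_space" where
  "transport_space V W f = \<lparr>carrier = f ` W, mult = undefined, one = undefined, zero = f \<zero>\<^bsub>V\<^esub>,
    add = (\<lambda>x y. f (inv_into W f x \<oplus>\<^bsub>V\<^esub> inv_into W f y)),
    smult = (\<lambda>r x. f (r \<odot>\<^bsub>V\<^esub> inv_into W f x)),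
    ip = (\<lambda>x y. ip V (inv_into W f x) (inv_into W f y))\<rparr>"

context real_inner_space
begin

sublocale Met: Metric_space "carrier V" "ip_dist V"
  by (rule ip_metric)

lemma ip_topology_mtopology: "ip_topology V = Met.mtopology"
  by (simp add: ip_topology_def)

lemma topspace_ip_topology [simp]: "topspace (ip_topology V) = carrier V"
  by (simp add: ip_topology_mtopology)

lemma affine_closedD:
  assumes "affine_closed V S"
  shows "S \<subseteq> carrier V" and "\<zero>\<^bsub>V\<^esub> \<in> S"
    and "x \<in> S \<Longrightarrow> r \<odot>\<^bsub>V\<^esub> x \<in> S"
    and "\<lbrakk>x \<in> S; y \<in> S\<rbrakk> \<Longrightarrow> x \<oplus>\<^bsub>V\<^esub> y \<in> S"
proof -
  note A = assms[unfolded affine_closed_def]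
  show sub: "S \<subseteq> carrier V" using A closedin_subset[of "ip_topology V" S] by simp
  show Z: "\<zero>\<^bsub>V\<^esub> \<in> S" using A by blast
  have sm: "r \<odot>\<^bsub>V\<^esub> x \<in> S" if "x \<in> S" for r x
  proof -
    have "((1 - r) \<odot>\<^bsub>V\<^esub> \<zero>\<^bsub>V\<^esub>) \<oplus>\<^bsub>V\<^esub> (r \<odot>\<^bsub>V\<^esub> x) \<in> S" using A Z that by blast
    then show ?thesis using that sub by (auto simp: subset_iff)
  qed
  then show "x \<in> S \<Longrightarrow> r \<odot>\<^bsub>V\<^esub> x \<in> S" .
  assume xy: "x \<in> S" "y \<in> S"
  then have c: "x \<in> carrier V" "y \<in> carrier V" using sub by auto
  have "((1 - 1/2) \<odot>\<^bsub>V\<^esub> (2 \<odot>\<^bsub>V\<^esub> x)) \<oplus>\<^bsub>V\<^esub> ((1/2) \<odot>\<^bsub>V\<^esub> (2 \<odot>\<^bsub>V\<^esub> y)) \<in> S"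
    using A sm[OF xy(1)] sm[OF xy(2)] by blast
  moreover have "(1/2) \<odot>\<^bsub>V\<^esub> (2 \<odot>\<^bsub>V\<^esub> z) = z" if "z \<in> carrier V" for z
    using smult_assoc1[of "1/2" 2 z] smult_one[of z] that by simp
  ultimately show "x \<oplus>\<^bsub>V\<^esub> y \<in> S" using c by simp
qed

lemma smult_minus_one: "x \<in> carrier V \<Longrightarrow> (- 1) \<odot>\<^bsub>V\<^esub> x = \<ominus>\<^bsub>V\<^esub> x"
  using smult_l_distr[of "- 1" 1 x] smult_one[of x] smult_l_null[of x]
  by (intro M.minus_equality[symmetric]) auto

lemma affine_closed_minus:
  assumes "affine_closed V S" "x \<in> S" "y \<in> S"
  shows "x \<ominus>\<^bsub>V\<^esub> y \<in> S"
  using assms affine_closedD(1)[OF assms(1)] affine_closedD(4)[OF assms(1,2), of "\<ominus>\<^bsub>V\<^esub> y"]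
    affine_closedD(3)[OF assms(1,3), of "- 1"] smult_minus_one[of y]
  by (auto simp: a_minus_def)

lemma affine_closed_orth:
  assumes "u \<in> carrier V"
  shows "affine_closed V {v \<in> carrier V. ip V u v = 0}"
proof -
  have "closedin Met.mtopology {v \<in> carrier V. ip V u v = 0}"
    unfolding Met.closedin_metric
  proof (intro conjI allI impI)
    fix x assume x: "x \<in> carrier V - {v \<in> carrier V. ip V u v = 0}"
    define r where "r = \<bar>ip V u x\<bar> / (sqrt (ip V u u) + 1)"
    have pos: "sqrt (ip V u u) + 1 > 0" using ip_ge_zero[OF assms] by (simp add: add_nonneg_pos)
    have "r > 0" using x pos by (auto simp: r_def)
    moreover have "disjnt {v \<in> carrier V. ip V u v = 0} (Met.mball x r)"
      unfolding disjnt_iff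
    proof safe
      fix v assume v: "v \<in> carrier V" "ip V u v = 0" "v \<in> Met.mball x r"
      have "\<bar>ip V u x\<bar> = \<bar>ip V u (x \<ominus>\<^bsub>V\<^esub> v)\<bar>" using v x assms by (simp add: ip_diff_right)
      also have "\<dots> \<le> sqrt (ip V u u) * ip_dist V x v"
        using ip_Cauchy_Schwarz[OF assms, of "x \<ominus>\<^bsub>V\<^esub> v"] v x by (simp add: ip_dist_def)
      also have "\<dots> \<le> (sqrt (ip V u u) + 1) * ip_dist V x v"
        by (intro mult_right_mono) auto
      also have "\<dots> < (sqrt (ip V u u) + 1) * r"
        using v pos by (intro mult_strict_left_mono) auto
      also have "\<dots> = \<bar>ip V u x\<bar>" using pos by (simp add: r_def)
      finally show False by simp
    qed
    ultimately show "\<exists>r>0. disjnt {v \<in> carrier V. ip V u v = 0} (Met.mball x r)" by blast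
  qed auto
  then show ?thesis
    unfolding affine_closed_def ip_topology_mtopology
    using assms by (auto simp: ip_add_right ip_smult_right ip_commute[of u "\<zero>\<^bsub>V\<^esub>"])
qed

lemma affine_closed_Inter:
  assumes "\<S> \<noteq> {}" "\<And>S. S \<in> \<S> \<Longrightarrow> affine_closed V S"
  shows "affine_closed V (\<Inter>\<S>)"
  using assms unfolding affine_closed_def by (auto intro: closedin_Inter)

end

lemma (in real_hilbert_space) transport_space_hilbert:
  assumes W: "affine_closed V W" and f: "inj_on f W"
  shows "real_hilbert_space (transport_space V W f)"
    and "\<lbrakk>x \<in> W; y \<in> W\<rbrakk> \<Longrightarrow> ip_dist (transport_space V W f) (f x) (f y) = ip_dist V x y"
proof -
  let ?V = "transport_space V W f"
  note WD = affine_closedD[OF W]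
  have inW: "x \<in> W \<Longrightarrow> x \<in> carrier V" for x using WD(1) by blast
  note [simp] = inW inv_into_f_f[OF f]
  have sel [simp]: "carrier ?V = f ` W" "zero ?V = f \<zero>\<^bsub>V\<^esub>"
    by (simp_all add: transport_space_def)
  have add [simp]: "f x \<oplus>\<^bsub>?V\<^esub> f y = f (x \<oplus>\<^bsub>V\<^esub> y)" if "x \<in> W" "y \<in> W" for x y
    using that by (simp add: transport_space_def)
  have smult [simp]: "r \<odot>\<^bsub>?V\<^esub> f x = f (r \<odot>\<^bsub>V\<^esub> x)" if "x \<in> W" for r x
    using that by (simp add: transport_space_def)
  have ip [simp]: "ip ?V (f x) (f y) = ip V x y" if "x \<in> W" "y \<in> W" for x y
    using that by (simp add: transport_space_def)
  have neg: "\<ominus>\<^bsub>V\<^esub> x \<in> W" if "x \<in> W" for x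
    using WD(3)[OF that, of "- 1"] that by (simp add: smult_minus_one)
  have ag: "abelian_group ?V"
  proof (rule abelian_groupI)
    fix x assume "x \<in> carrier ?V"
    then obtain w where w: "w \<in> W" "x = f w" by auto
    show "\<exists>y\<in>carrier ?V. y \<oplus>\<^bsub>?V\<^esub> x = \<zero>\<^bsub>?V\<^esub>"
      using w neg[OF w(1)] by (intro bexI[of _ "f (\<ominus>\<^bsub>V\<^esub> w)"]) (auto simp: M.l_neg)
  qed (auto simp: WD M.a_ac)
  interpret A: abelian_group ?V by (rule ag)
  have mod: "module real_ring ?V"
    by (rule moduleI[OF cring_real_ring ag])
      (auto simp: WD smult_l_distr[simplified] smult_r_distr[simplified] smult_assoc1[simplified]
        smult_one[simplified])
  have inner: "real_inner_space ?V"
  proof (intro real_inner_space.intro real_inner_space_axioms.intro mod)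
    fix x assume "x \<in> carrier ?V" "ip ?V x x = 0"
    then obtain w where w: "w \<in> W" "x = f w" "ip V w w = 0" by auto
    then have "w = \<zero>\<^bsub>V\<^esub>" using ip_eq_zero by simp
    then show "x = \<zero>\<^bsub>?V\<^esub>" using w by simp
  qed (auto simp: WD ip_add_left ip_smult_left ip_ge_zero intro: ip_commute[OF inW inW])
  have minus: "f x \<ominus>\<^bsub>?V\<^esub> f y = f (x \<ominus>\<^bsub>V\<^esub> y)" if "x \<in> W" "y \<in> W" for x y
  proof -
    have "\<ominus>\<^bsub>?V\<^esub> f y = f (\<ominus>\<^bsub>V\<^esub> y)"
      using that neg by (intro A.minus_equality) (auto simp: M.l_neg)
    then show ?thesis using that neg by (simp add: a_minus_def)
  qed
  show dist: "ip_dist ?V (f x) (f y) = ip_dist V x y" if "x \<in> W" "y \<in> W" for x y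
    using that affine_closed_minus[OF W that] by (simp add: ip_dist_def minus)
  interpret I: real_inner_space ?V by (rule inner)
  have "I.Met.mcomplete"
    unfolding I.Met.mcomplete_def
  proof (intro allI impI)
    fix \<sigma> assume \<sigma>: "I.Met.MCauchy \<sigma>"
    define \<tau> where "\<tau> = inv_into W f \<circ> \<sigma>"
    have range: "\<sigma> n \<in> f ` W" for n using \<sigma> unfolding I.Met.MCauchy_def by auto
    then have \<tau>W: "\<tau> n \<in> W" and \<sigma>\<tau>: "\<sigma> n = f (\<tau> n)" for n
      by (simp_all add: \<tau>_def inv_into_into f_inv_into_f)
    have "Met.MCauchy \<tau>"
      using \<sigma> \<tau>W unfolding I.Met.MCauchy_def Met.MCauchy_def \<sigma>\<tau> dist[OF \<tau>W \<tau>W] by auto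
    then obtain l where l: "limitin Met.mtopology \<tau> l sequentially"
      using complete unfolding Met.mcomplete_def by blast
    have "closedin Met.mtopology W" using W by (simp add: affine_closed_def ip_topology_mtopology)
    then have lW: "l \<in> W"
      using limitin_closedin[OF l] \<tau>W by simp
    have "limitin I.Met.mtopology \<sigma> (f l) sequentially"
      using l lW unfolding I.Met.limitin_metric Met.limitin_metric
      by (auto simp: \<sigma>\<tau> \<tau>W dist)
    then show "\<exists>x. limitin I.Met.mtopology \<sigma> x sequentially" by blast
  qed
  then show "real_hilbert_space ?V"
    by (intro real_hilbert_space.intro inner real_hilbert_space_axioms.intro)
qed

text \<open>The closed linear span \<open>W\<close> of the orbit of \<open>0\<close> is invariant, and a vector of \<open>W\<close> is determined by
  its inner products with that orbit, so that \<open>W\<close> embeds into \<open>'a \<Rightarrow> real\<close>.\<close>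

theorem property_FH_fixed_point:
  fixes G :: "('a, 'k) monoid_scheme" and V :: "('v, 'm) inner_space_scheme"
  assumes FH: "property_FH G T" and T: "topspace T = carrier G"
    and V: "real_hilbert_space V" and action: "affine_isometric_action G T V \<alpha>"
  shows "\<exists>x\<in>carrier V. \<forall>g\<in>carrier G. \<alpha> g x = x"
proof -
  interpret V: real_hilbert_space V by (rule V)
  note act = action[unfolded affine_isometric_action_def]
  interpret act: group_action G "carrier V" \<alpha> using act by blast
  interpret G: group G using act.group_hom by (simp add: group_hom_def)
  have \<alpha>V: "\<alpha> g x \<in> carrier V" if "g \<in> carrier G" "x \<in> carrier V" for g x
    using act.element_image that by blast
  have \<alpha>mult: "\<alpha> (g \<otimes>\<^bsub>G\<^esub> h) x = \<alpha> g (\<alpha> h x)"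
    if "g \<in> carrier G" "h \<in> carrier G" "x \<in> carrier V" for g h x
    using act.composition_rule that by blast
  have \<alpha>one: "\<alpha> \<one>\<^bsub>G\<^esub> x = x" if "x \<in> carrier V" for x
    using act.id_eq_one that by (metis restrict_apply')
  have \<alpha>dist: "ip_dist V (\<alpha> g x) (\<alpha> g y) = ip_dist V x y"
    if "g \<in> carrier G" "x \<in> carrier V" "y \<in> carrier V" for g x y
    using act that by blast
  have \<alpha>aff: "\<alpha> g (((1 - t) \<odot>\<^bsub>V\<^esub> x) \<oplus>\<^bsub>V\<^esub> (t \<odot>\<^bsub>V\<^esub> y))
      = ((1 - t) \<odot>\<^bsub>V\<^esub> \<alpha> g x) \<oplus>\<^bsub>V\<^esub> (t \<odot>\<^bsub>V\<^esub> \<alpha> g y)"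
    if "g \<in> carrier G" "x \<in> carrier V" "y \<in> carrier V" for g x y t
    using act that by blast

  define b where "b g = \<alpha> g \<zero>\<^bsub>V\<^esub>" for g
  have bV: "b g \<in> carrier V" if "g \<in> carrier G" for g
    using that by (simp add: b_def \<alpha>V)
  define \<S> where "\<S> = {S. affine_closed V S \<and> b ` carrier G \<subseteq> S}"
  define W where "W = \<Inter>\<S>"
  have "affine_closed V (carrier V)"
    using closedin_topspace[of "ip_topology V"] by (auto simp: affine_closed_def)
  then have "carrier V \<in> \<S>" using bV by (auto simp: \<S>_def)
  then have W: "affine_closed V W"
    unfolding W_def by (intro V.affine_closed_Inter) (auto simp: \<S>_def)
  note WD = V.affine_closedD[OF W]
  have WV: "w \<in> carrier V" if "w \<in> W" for w using that WD(1) by blast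
  have bW: "b g \<in> W" if "g \<in> carrier G" for g
    using that by (auto simp: W_def \<S>_def)
  have W_sub: "W \<subseteq> S" if "affine_closed V S" "b ` carrier G \<subseteq> S" for S
    using that by (auto simp: W_def \<S>_def)
  have \<alpha>W: "\<alpha> g w \<in> W" if g: "g \<in> carrier G" and w: "w \<in> W" for g w
  proof -
    let ?S = "{v \<in> carrier V. \<alpha> g v \<in> W}"
    have "continuous_map (ip_topology V) (ip_topology V) (\<alpha> g)"
      unfolding V.ip_topology_mtopology V.Met.metric_continuous_map[OF V.ip_metric]
      using g by (auto simp: \<alpha>V \<alpha>dist)
    moreover have "closedin (ip_topology V) W" using W by (simp add: affine_closed_def)
    ultimately have "closedin (ip_topology V) ?S"
      using closedin_continuous_map_preimage by fastforce
    moreover have "\<zero>\<^bsub>V\<^esub> \<in> ?S" using bW[OF g] by (simp add: b_def)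
    ultimately have "affine_closed V ?S"
      using W unfolding affine_closed_def by (auto simp: \<alpha>aff[OF g])
    moreover have "b ` carrier G \<subseteq> ?S"
      using bV bW g by (auto simp: b_def simp flip: \<alpha>mult)
    ultimately show ?thesis using W_sub w by blast
  qed

  define f where "f w = (\<lambda>g. if g \<in> carrier G then ip V w (b g) else 0)" for w
  have f: "inj_on f W"
  proof (rule inj_onI)
    fix v w assume vw: "v \<in> W" "w \<in> W" "f v = f w"
    define u where "u = v \<ominus>\<^bsub>V\<^esub> w"
    have u: "u \<in> W" unfolding u_def by (rule V.affine_closed_minus[OF W vw(1,2)])
    have "ip V u (b g) = 0" if "g \<in> carrier G" for g
      using fun_cong[OF vw(3), of g] that vw WV bV by (simp add: f_def u_def V.ip_diff_left)
    then have "W \<subseteq> {v \<in> carrier V. ip V u v = 0}"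
      using WV[OF u] bV by (intro W_sub V.affine_closed_orth) auto
    then have "u = \<zero>\<^bsub>V\<^esub>" using u WV V.ip_eq_zero by blast
    then show "v = w"
      using vw WV V.minus_equality[of v "\<ominus>\<^bsub>V\<^esub> w"] by (simp add: u_def a_minus_def)
  qed

  let ?V = "transport_space V W f"
  let ?h = "inv_into W f"
  have hilb: "real_hilbert_space ?V" by (rule V.transport_space_hilbert(1)[OF W f])
  interpret I: real_hilbert_space ?V by (rule hilb)
  have dist: "ip_dist ?V (f x) (f y) = ip_dist V x y" if "x \<in> W" "y \<in> W" for x y
    by (rule V.transport_space_hilbert(2)[OF W f that])
  note [simp] = inv_into_f_f[OF f]
  have car [simp]: "carrier ?V = f ` W" by (simp add: transport_space_def)
  define \<beta> where "\<beta> g = (\<lambda>y\<in>f ` W. f (\<alpha> g (?h y)))" for g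
  have \<beta>f [simp]: "\<beta> g (f w) = f (\<alpha> g w)" if "w \<in> W" for g w
    using that by (simp add: \<beta>_def)
  have \<beta>bij: "\<beta> g \<in> Bij (f ` W)" if g: "g \<in> carrier G" for g
  proof -
    have "bij_betw (\<beta> g) (f ` W) (f ` W)"
    proof (rule bij_betwI[where g = "\<beta> (inv\<^bsub>G\<^esub> g)"])
      have "\<alpha> (inv\<^bsub>G\<^esub> g) (\<alpha> g w) = w" "\<alpha> g (\<alpha> (inv\<^bsub>G\<^esub> g) w) = w" if "w \<in> W" for w
        using \<alpha>mult[of "inv\<^bsub>G\<^esub> g" g w] \<alpha>mult[of g "inv\<^bsub>G\<^esub> g" w] g \<alpha>one WV[OF that] by auto
      then show "\<beta> (inv\<^bsub>G\<^esub> g) (\<beta> g x) = x" "\<beta> g (\<beta> (inv\<^bsub>G\<^esub> g) x) = x" if "x \<in> f ` W" for x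
        using that g by (auto simp: \<alpha>W)
    qed (use g in \<open>auto simp: \<alpha>W\<close>)
    then show ?thesis by (simp add: Bij_def \<beta>_def)
  qed
  have "group_action G (carrier ?V) \<beta>"
    unfolding group_action_def group_hom_def group_hom_axioms_def
  proof (intro conjI G.is_group group_BijGroup homI)
    fix g h assume g: "g \<in> carrier G" and h: "h \<in> carrier G"
    have "\<beta> (g \<otimes>\<^bsub>G\<^esub> h) = compose (f ` W) (\<beta> g) (\<beta> h)"
    proof (rule extensionalityI[of _ "f ` W"])
      show "\<beta> (g \<otimes>\<^bsub>G\<^esub> h) x = compose (f ` W) (\<beta> g) (\<beta> h) x" if "x \<in> f ` W" for x
        using that g h by (auto simp: compose_def \<alpha>mult \<alpha>W WV)
    qed (auto simp: \<beta>_def compose_def)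
    then show "\<beta> (g \<otimes>\<^bsub>G\<^esub> h) = \<beta> g \<otimes>\<^bsub>BijGroup (carrier ?V)\<^esub> \<beta> h"
      using \<beta>bij[OF g] \<beta>bij[OF h] by (simp add: BijGroup_def)
  qed (simp add: BijGroup_def \<beta>bij)
  moreover have "\<beta> g (((1 - t) \<odot>\<^bsub>?V\<^esub> x) \<oplus>\<^bsub>?V\<^esub> (t \<odot>\<^bsub>?V\<^esub> y))
      = ((1 - t) \<odot>\<^bsub>?V\<^esub> \<beta> g x) \<oplus>\<^bsub>?V\<^esub> (t \<odot>\<^bsub>?V\<^esub> \<beta> g y)"
    if "g \<in> carrier G" "x \<in> carrier ?V" "y \<in> carrier ?V" for g x y t
  proof -
    have add: "f u \<oplus>\<^bsub>?V\<^esub> f v = f (u \<oplus>\<^bsub>V\<^esub> v)" and smult: "r \<odot>\<^bsub>?V\<^esub> f u = f (r \<odot>\<^bsub>V\<^esub> u)"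
      if "u \<in> W" "v \<in> W" for u v r
      using that by (simp_all add: transport_space_def)
    from that show ?thesis by (auto simp: add smult WD \<alpha>W \<alpha>aff WV)
  qed
  moreover have "ip_dist ?V (\<beta> g x) (\<beta> g y) = ip_dist ?V x y"
    if "g \<in> carrier G" "x \<in> carrier ?V" "y \<in> carrier ?V" for g x y
    using that by (auto simp: dist \<alpha>W \<alpha>dist WV)
  moreover have "continuous_map (prod_topology T (ip_topology ?V)) (ip_topology ?V) (\<lambda>(g, y). \<beta> g y)"
  proof -
    have h: "continuous_map (ip_topology ?V) (ip_topology V) ?h"
      unfolding V.ip_topology_mtopology I.ip_topology_mtopology
        I.Met.metric_continuous_map[OF V.ip_metric]
      by (auto simp: dist WV)
    interpret S: Submetric "carrier V" "ip_dist V" W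
      by unfold_locales (rule WD(1))
    have f': "continuous_map (subtopology (ip_topology V) W) (ip_topology ?V) f"
      unfolding V.ip_topology_mtopology I.ip_topology_mtopology S.mtopology_submetric[symmetric]
        S.sub.metric_continuous_map[OF I.ip_metric]
      by (auto simp: dist)
    have "continuous_map (prod_topology T (ip_topology ?V)) (prod_topology T (ip_topology V))
        (\<lambda>(g, y). (g, ?h y))"
      using h by (intro continuous_map_prod_top[THEN iffD2]) simp
    then have "continuous_map (prod_topology T (ip_topology ?V)) (ip_topology V)
        ((\<lambda>(g, y). \<alpha> g y) \<circ> (\<lambda>(g, y). (g, ?h y)))"
      using act by (intro continuous_map_compose) auto
    then have "continuous_map (prod_topology T (ip_topology ?V)) (subtopology (ip_topology V) W)
        ((\<lambda>(g, y). \<alpha> g y) \<circ> (\<lambda>(g, y). (g, ?h y)))"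
      using T by (auto simp: continuous_map_in_subtopology \<alpha>W)
    from continuous_map_compose[OF this f'] show ?thesis
      by (rule continuous_map_eq) (auto simp: T)
  qed
  ultimately have "affine_isometric_action G T ?V \<beta>"
    by (simp only: affine_isometric_action_def) blast
  then obtain y where "y \<in> f ` W" "\<And>g. g \<in> carrier G \<Longrightarrow> \<beta> g y = y"
    using FH hilb unfolding property_FH_def by (metis car)
  then obtain w where w: "w \<in> W" "\<And>g. g \<in> carrier G \<Longrightarrow> f (\<alpha> g w) = f w" by auto
  then have "\<alpha> g w = w" if "g \<in> carrier G" for g
    using that \<alpha>W inj_onD[OF f] by blast
  then show ?thesis using w WV by blast
qed



section \<open>Compact Lie groups\<close>

text \<open>\<open>C\<^sup>k\<close> functions on an open subset \<open>S\<close> of \<open>\<real>\<^sup>n\<close> are those with continuous partial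
  derivatives up to order \<open>k\<close>; \<open>D i\<close> is the partial derivative in direction \<open>i\<close>. Points of
  \<^term>\<open>Euclidean_space n\<close> are sequences vanishing from index \<open>n\<close> on.\<close>

primrec Ck_on :: "nat \<Rightarrow> nat \<Rightarrow> (nat \<Rightarrow> real) set \<Rightarrow> ((nat \<Rightarrow> real) \<Rightarrow> real) \<Rightarrow> bool"
  where
    "Ck_on n 0 S f \<longleftrightarrow> continuous_map (subtopology (Euclidean_space n) S) euclideanreal f"
  | "Ck_on n (Suc k) S f \<longleftrightarrow>
      continuous_map (subtopology (Euclidean_space n) S) euclideanreal f \<and>
      (\<exists>D. \<forall>i<n.
        (\<forall>x\<in>S. ((\<lambda>t. f (x(i := t))) has_real_derivative D i x) (at (x i))) \<and> Ck_on n k S (D i))"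

definition smooth_on :: "nat \<Rightarrow> nat \<Rightarrow> (nat \<Rightarrow> real) set \<Rightarrow> ((nat \<Rightarrow> real) \<Rightarrow> nat \<Rightarrow> real) \<Rightarrow> bool"
  where "smooth_on n m S f \<longleftrightarrow> (\<forall>k. \<forall>j<m. Ck_on n k S (\<lambda>x. f x j))"

text \<open>A chart is a pair of its domain and its coordinate map.\<close>

type_synonym 'a chart = "'a set \<times> ('a \<Rightarrow> nat \<Rightarrow> real)"

definition is_chart :: "nat \<Rightarrow> 'a topology \<Rightarrow> 'a chart \<Rightarrow> bool"
  where "is_chart n X c \<longleftrightarrow>
    openin X (fst c) \<and> openin (Euclidean_space n) (snd c ` fst c) \<and>
    homeomorphic_map (subtopology X (fst c)) (subtopology (Euclidean_space n) (snd c ` fst c)) (snd c)"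

definition smooth_in_charts ::
    "nat \<Rightarrow> 'a chart set \<Rightarrow> nat \<Rightarrow> 'b chart set \<Rightarrow> ('a \<Rightarrow> 'b) \<Rightarrow> bool"
  where "smooth_in_charts n A m B f \<longleftrightarrow>
    (\<forall>c\<in>A. \<forall>d\<in>B. smooth_on n m (snd c ` {x \<in> fst c. f x \<in> fst d})
      (\<lambda>z. snd d (f (inv_into (fst c) (snd c) z))))"

definition smooth_atlas :: "nat \<Rightarrow> 'a topology \<Rightarrow> 'a chart set \<Rightarrow> bool"
  where "smooth_atlas n X A \<longleftrightarrow>
    (\<forall>c\<in>A. is_chart n X c) \<and> (\<Union>c\<in>A. fst c) = topspace X \<and> smooth_in_charts n A n A id"

definition smooth_map ::
    "nat \<Rightarrow> 'a topology \<Rightarrow> 'a chart set \<Rightarrow> nat \<Rightarrow> 'b topology \<Rightarrow> 'b chart set \<Rightarrow> ('a \<Rightarrow> 'b) \<Rightarrow> bool"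
  where "smooth_map n X A m Y B f \<longleftrightarrow> continuous_map X Y f \<and> smooth_in_charts n A m B f"

definition prod_atlas :: "nat \<Rightarrow> 'a chart set \<Rightarrow> 'b chart set \<Rightarrow> ('a \<times> 'b) chart set"
  where "prod_atlas n A B =
    {(U \<times> V, \<lambda>(x, y) i. if i < n then \<phi> x i else \<psi> y (i - n)) | U \<phi> V \<psi>. (U, \<phi>) \<in> A \<and> (V, \<psi>) \<in> B}"

text \<open>A topological group is a Lie group if its topology comes from a structure of smooth manifold
  for which multiplication and inversion are smooth. The dimension may be \<open>0\<close>. Requiring the charts
  to have one common dimension \<open>n\<close> is no restriction, as translations act transitively.\<close>

definition lie_group :: "('a, 'k) monoid_scheme \<Rightarrow> 'a topology \<Rightarrow> bool"
  where "lie_group G T \<longleftrightarrow>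
    group G \<and> topspace T = carrier G \<and> Hausdorff_space T \<and> second_countable T \<and>
    (\<exists>n A. smooth_atlas n T A \<and>
      smooth_map (n + n) (prod_topology T T) (prod_atlas n A A) n T A (\<lambda>(x, y). x \<otimes>\<^bsub>G\<^esub> y) \<and>
      smooth_map n T A n T A (\<lambda>x. inv\<^bsub>G\<^esub> x))"

definition compact_lie_group :: "('a, 'k) monoid_scheme \<Rightarrow> 'a topology \<Rightarrow> bool"
  where "compact_lie_group G T \<longleftrightarrow> compact_space T \<and> lie_group G T"

end

theory Submission
  imports Defs "HOL-Computational_Algebra.Fundamental_Theorem_Algebra"
begin

text \<open>As \<open>p \<le> 2\<close>, the Schatten class lies in the Hilbert-Schmidt class, so that \<open>g \<mapsto> g - 1\<close> is a
  cocycle for the left multiplication of \<open>G\<close> on the Hilbert-Schmidt operators. By property (FH) it is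
  a coboundary: there is a Hilbert-Schmidt operator \<open>x\<close> with \<open>g (x + 1) = x + 1\<close> for all \<open>g\<close> in \<open>G\<close>. As
  \<open>x + 1\<close> is Fredholm, \<open>G\<close> acts trivially on a subspace of finite codimension, hence \<open>G\<close> is a closed
  bounded group of operators differing from \<open>1\<close> by elements of a finite-dimensional space, and all
  topologies involved agree on it.

  For such a group the exponential map is avoided. Let \<open>\<gg>\<close> be the space of derivatives at \<open>1\<close> of curves in
  \<open>G\<close> and \<open>P\<close> a linear projection onto \<open>\<gg>\<close>. Charts are \<open>h \<mapsto> P (a\<^sup>-\<^sup>1 h - 1)\<close> near \<open>a\<close>. If \<open>\<psi>\<close> is the
  inverse of the chart at \<open>1\<close>, then the chart changes, multiplication and inversion are restrictions of
  linear or bilinear maps composed with \<open>\<psi>\<close>, and the smoothness of \<open>\<psi>\<close> follows from the differential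
  equations \<open>\<partial>\<^sub>i \<psi> = \<psi> Z\<^sub>i\<close> and \<open>\<partial>\<^sub>l Z\<^sub>i = - \<Sum>\<^sub>a P\<^sub>a(\<psi> Z\<^sub>l Z\<^sub>i) Z\<^sub>a\<close>, where \<open>Z\<^sub>i\<close> is the element of \<open>\<gg>\<close> for
  which \<open>P (\<psi> Z\<^sub>i)\<close> is the \<open>i\<close>-th basis vector.\<close>

section \<open>Positivity of polynomials on an interval\<close>

text \<open>The Schatten norm is given through limits of polynomials, so order arguments for it rest
  on an algebraic fact: a polynomial that is nonnegative on \<open>[0, norm A]\<close> is a sum of
  products of squares, \<open>t\<close> and \<open>norm A - t\<close>, and these take nonnegative
  values at a nonnegative operator \<open>A\<close>. Two comparisons are drawn from the resulting
  functional calculus. For \<open>p \<le> 2\<close> the bound \<open>t^2 \<le> M^(2-p) t^p\<close>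
  on \<open>[0, M]\<close> puts the Hilbert-Schmidt norm below the Schatten norm, so the cocycle
  takes values in a Hilbert space and is continuous. On operators supported by one fixed finite
  orthonormal set \<open>C\<close> the Schatten norm is at most \<open>(card C)^(1/p)\<close> times
  the operator norm; this is what makes the topologies agree. Operators are handled as real-linear
  maps, because the adjoint is then a bounded linear map, and on unitaries it is inversion.
  Smoothness of the inverse chart is a bootstrap: the right-hand sides of its differential equations
  are polynomial in unknowns of the same kind, so each order of differentiability yields the
  next.\<close>

definition nonneg_product :: "real \<Rightarrow> real poly \<Rightarrow> bool"
  where "nonneg_product M q \<longleftrightarrow> (\<exists>r i j. q = r\<^sup>2 * [:0, 1:] ^ i * [:M, -1:] ^ j)"

text \<open>Sums of generators \<open>r^2 t^i (M - t)^j\<close>. Each generator takes a nonnegative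
  value at a nonnegative operator of norm \<open>M\<close> for elementary reasons, and
  \<open>nonneg_coneI\<close> shows that the sums exhaust the polynomials nonnegative on
  \<open>[0, M]\<close>.\<close>

inductive nonneg_cone :: "real \<Rightarrow> real poly \<Rightarrow> bool" for M where
  zero: "nonneg_cone M 0"
| add: "nonneg_product M q \<Longrightarrow> nonneg_cone M p \<Longrightarrow> nonneg_cone M (q + p)"

lemma nonneg_product_mult:
  assumes "nonneg_product M p" "nonneg_product M q"
  shows "nonneg_product M (p * q)"
proof -
  obtain r i j s k l where "p = r\<^sup>2 * [:0, 1:] ^ i * [:M, -1:] ^ j" "q = s\<^sup>2 * [:0, 1:] ^ k * [:M, -1:] ^ l"
    using assms unfolding nonneg_product_def by metis
  then have "p * q = (r * s)\<^sup>2 * [:0, 1:] ^ (i + k) * [:M, -1:] ^ (j + l)"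
    by (simp only: power_mult_distrib power_add mult_ac)
  then show ?thesis unfolding nonneg_product_def by blast
qed

lemma nonneg_cone_product: "nonneg_product M q \<Longrightarrow> nonneg_cone M q"
  using nonneg_cone.add[OF _ nonneg_cone.zero] by fastforce

lemma nonneg_cone_add: "nonneg_cone M p \<Longrightarrow> nonneg_cone M q \<Longrightarrow> nonneg_cone M (p + q)"
  by (induction rule: nonneg_cone.induct) (auto simp: add.assoc intro: nonneg_cone.add)

lemma nonneg_cone_mult:
  assumes "nonneg_cone M p" "nonneg_cone M q"
  shows "nonneg_cone M (p * q)"
proof -
  have "nonneg_cone M (g * q)" if g: "nonneg_product M g" for g
    using assms(2)
    by induction (auto simp: distrib_left intro: nonneg_cone.intros nonneg_product_mult[OF g])
  from assms(1) this show ?thesis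
    by (induction rule: nonneg_cone.induct) (auto simp: distrib_right intro: nonneg_cone_add nonneg_cone.zero)
qed

lemma nonneg_cone_square: "nonneg_cone M (r\<^sup>2)"
  by (rule nonneg_cone_product[unfolded nonneg_product_def],
      rule exI[of _ r], rule exI[of _ 0], rule exI[of _ 0]) simp

lemma nonneg_cone_const: "c \<ge> 0 \<Longrightarrow> nonneg_cone M [:c:]"
  using nonneg_cone_square[of M "[:sqrt c:]"] by (simp add: power2_eq_square)

lemma nonneg_cone_lower: "nonneg_cone M [:0, 1:]"
  by (rule nonneg_cone_product[unfolded nonneg_product_def],
      rule exI[of _ 1], rule exI[of _ 1], rule exI[of _ 0]) simp

lemma nonneg_cone_upper: "nonneg_cone M [:M, -1:]"
  by (rule nonneg_cone_product[unfolded nonneg_product_def],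
      rule exI[of _ 1], rule exI[of _ 0], rule exI[of _ 1]) simp

text \<open>By continuity, as \<open>a\<close> can be approached from inside the interval. It
  restores the sign of a cofactor at the root that was divided out.\<close>

lemma poly_nonneg_extend:
  fixes k :: "real poly"
  assumes "M > 0" "\<And>t. 0 \<le> t \<Longrightarrow> t \<le> M \<Longrightarrow> t \<noteq> a \<Longrightarrow> 0 \<le> poly k t" "0 \<le> s" "s \<le> M"
  shows "0 \<le> poly k s"
proof (cases "s = a")
  case True
  \<comment> \<open>\<open>s + e\<close> is the right endpoint, or the left one when
    \<open>s\<close> is already the right; the segment towards it stays in the interval.\<close>
  define e where "e = (if s < M then M - s else - M)"
  define X where "X n = s + e / real (n + 2)" for n
  have e: "e \<noteq> 0" "0 \<le> s + e" "s + e \<le> M" using assms by (auto simp: e_def)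
  have X: "0 \<le> X n" "X n \<le> M" "X n \<noteq> s" for n
  proof -
    define l where "l = 1 / real (n + 2)"
    have l: "0 < l" "l \<le> 1" by (auto simp: l_def)
    have *: "X n = (1 - l) * s + l * (s + e)" by (simp add: X_def l_def ring_distribs)
    show "0 \<le> X n" unfolding * using l e assms by simp
    have "(1 - l) * s + l * (s + e) \<le> (1 - l) * M + l * M"
      using l e assms by (intro add_mono mult_left_mono) auto
    then show "X n \<le> M" unfolding * by (simp add: algebra_simps)
    show "X n \<noteq> s" using e by (simp add: X_def)
  qed
  have "X \<longlonglongrightarrow> s + 0"
    unfolding X_def
    by (intro tendsto_add tendsto_const LIMSEQ_ignore_initial_segment[OF lim_const_over_n])
  then have "X \<longlonglongrightarrow> s" by simp
  then have "(\<lambda>n. poly k (X n)) \<longlonglongrightarrow> poly k s" by (rule tendsto_poly)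
  then show ?thesis
    using assms(2) X True by (intro tendsto_lowerbound[where F = sequentially]) auto
qed (use assms in auto)

lemma poly_map_of_real_add:
  "poly (map_poly complex_of_real (p + q)) z
    = poly (map_poly of_real p) z + poly (map_poly of_real q) z"
  by (simp flip: poly_add) (intro arg_cong[where f = "\<lambda>p. poly p z"] poly_eqI; simp add: coeff_map_poly)

lemma poly_map_of_real_mult:
  "poly (map_poly complex_of_real (p * q)) z
    = poly (map_poly of_real p) z * poly (map_poly of_real q) z"
proof (induction p)
  case (pCons a p)
  have "poly (map_poly complex_of_real (Polynomial.smult a q)) z = a * poly (map_poly of_real q) z"
    by (simp add: map_poly_smult)
  then show ?case
    by (simp add: poly_map_of_real_add map_poly_pCons pCons.IH algebra_simps)
qed simp

lemma poly_map_of_real_of_real: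
  "poly (map_poly complex_of_real p) (of_real t) = of_real (poly p t)"
  by (induction p) (auto simp: map_poly_pCons)

text \<open>Modulo the real quadratic with roots \<open>z\<close> and its conjugate,
  \<open>q\<close> leaves a real remainder of degree at most one; vanishing at the nonreal
  \<open>z\<close>, it is zero.\<close>

lemma real_poly_nonreal_root:
  fixes q :: "real poly"
  assumes "poly (map_poly complex_of_real q) z = 0" and "Im z \<noteq> 0"
  obtains k where "q = ([:-Re z, 1:]\<^sup>2 + [:(Im z)\<^sup>2:]) * k"
proof -
  define d where "d = [:-Re z, 1:]\<^sup>2 + [:(Im z)\<^sup>2:]"
  have d: "d = [:(Re z)\<^sup>2 + (Im z)\<^sup>2, -2 * Re z, 1:]"
    by (simp add: d_def power2_eq_square)
  have deg: "degree d = 2" by (simp add: d)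
  have dz: "poly (map_poly complex_of_real d) z = 0"
    by (simp add: d map_poly_pCons complex_eq_iff power2_eq_square algebra_simps)
  define r where "r = q mod d"
  have "degree r < 2"
    using degree_mod_less[of d q] deg by (auto simp: r_def d)
  then have r: "r = [:coeff r 0, coeff r 1:]"
    by (intro poly_eqI) (auto simp: coeff_pCons coeff_eq_0 split: nat.split)
  have "q = d * (q div d) + r" by (simp add: r_def)
  then have "poly (map_poly complex_of_real r) z = 0"
    using assms(1) dz by (metis poly_map_of_real_add poly_map_of_real_mult mult_zero_left add_0)
  then have "r = 0"
    using assms(2) by (subst (asm) r, subst r) (auto simp: map_poly_pCons complex_eq_iff)
  then show thesis using that[of "q div d"] by (simp add: r_def d_def minus_mod_eq_mult_div[symmetric])
qed

text \<open>Induction on the degree, removing the factor of one complex root. A nonreal root gives a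
  positive quadratic, a real root outside the open interval gives a linear factor of constant sign,
  and an interior root must be double.\<close>

lemma nonneg_coneI:
  assumes "M > 0" "\<And>t. 0 \<le> t \<Longrightarrow> t \<le> M \<Longrightarrow> 0 \<le> poly q t"
  shows "nonneg_cone M q"
  using assms(2)
proof (induction "degree q" arbitrary: q rule: less_induct)
  case less
  show ?case
  proof (cases "degree q = 0")
    case True
    then obtain c where "q = [:c:]" using degree_eq_zeroE by blast
    then show ?thesis using less.prems[of 0] assms(1) by (simp add: nonneg_cone_const)
  next
    case False
    then have q0: "q \<noteq> 0" by auto
    have IH: "nonneg_cone M k" if k: "q = d * k" "degree d > 0"
      and nonneg: "\<And>t. 0 \<le> t \<Longrightarrow> t \<le> M \<Longrightarrow> t \<noteq> a \<Longrightarrow> 0 \<le> poly k t" for d k a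
    proof (rule less.hyps)
      show "degree k < degree q" using k q0 by (auto simp: degree_mult_eq)
    qed (use poly_nonneg_extend[OF assms(1)] nonneg in blast)
    have "degree (map_poly complex_of_real q) = degree q"
      by (intro degree_map_poly) auto
    then obtain z where z: "poly (map_poly complex_of_real q) z = 0"
      using False fundamental_theorem_of_algebra constant_degree by metis
    show ?thesis
    proof (cases "Im z = 0")
      case False
      then obtain k where k: "q = ([:-Re z, 1:]\<^sup>2 + [:(Im z)\<^sup>2:]) * k"
        using real_poly_nonreal_root[OF z] by blast
      have pos: "poly ([:-Re z, 1:]\<^sup>2 + [:(Im z)\<^sup>2:]) t > 0" for t
        using False by (simp add: add_nonneg_pos)
      have "nonneg_cone M k"
      proof (rule IH[OF k])
        show "0 < degree ([:- Re z, 1:]\<^sup>2 + [:(Im z)\<^sup>2:])"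
          by (simp add: power2_eq_square)
        fix t assume "0 \<le> t" "t \<le> M"
        then have "0 \<le> poly ([:-Re z, 1:]\<^sup>2 + [:(Im z)\<^sup>2:]) t * poly k t"
          using less.prems k poly_mult by metis
        then show "0 \<le> poly k t" using pos[of t] by (simp add: zero_le_mult_iff)
      qed
      then show ?thesis
        by (subst k) (intro nonneg_cone_mult nonneg_cone_add nonneg_cone_square nonneg_cone_const; simp)
    next
      case True
      define a where "a = Re z"
      have "z = of_real a" using True by (simp add: a_def complex_eq_iff)
      then have "poly q a = 0" using z by (simp add: poly_map_of_real_of_real)
      then obtain k where k: "q = [:-a, 1:] * k" by (metis poly_eq_0_iff_dvd dvdE)
      have qt: "0 \<le> (t - a) * poly k t" if "0 \<le> t" "t \<le> M" for t
        using less.prems[OF that] by (simp add: k algebra_simps)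
      consider "a \<le> 0" | "a \<ge> M" | "0 < a" "a < M" by linarith
      then show ?thesis
      proof cases
        case 1
        have "nonneg_cone M k"
        proof (rule IH[OF k, where a = a])
          show "0 \<le> poly k t" if "0 \<le> t" "t \<le> M" "t \<noteq> a" for t
            using qt[OF that(1,2)] that 1 by (simp add: zero_le_mult_iff)
        qed simp
        \<comment> \<open>The linear factor is \<open>t + (- a)\<close> here and
          \<open>(M - t) + (a - M)\<close> in the next case, each a sum of two elements of the
          cone.\<close>
        then have "nonneg_cone M (([:0, 1:] + [:-a:]) * k)"
          using 1 by (intro nonneg_cone_mult nonneg_cone_add nonneg_cone_lower nonneg_cone_const) auto
        then show ?thesis by (simp add: k)
      next
        case 2
        have k': "q = [:a, -1:] * (- k)" by (simp add: k)
        have "nonneg_cone M (- k)"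
        proof (rule IH[OF k', where a = a])
          show "0 \<le> poly (- k) t" if "0 \<le> t" "t \<le> M" "t \<noteq> a" for t
            using qt[OF that(1,2)] that 2 by (simp add: zero_le_mult_iff)
        qed simp
        then have "nonneg_cone M (([:M, -1:] + [:a - M:]) * (- k))"
          using 2 by (intro nonneg_cone_mult nonneg_cone_add nonneg_cone_upper nonneg_cone_const) auto
        then show ?thesis by (simp add: k')
      next
        case 3
        \<comment> \<open>The cofactor \<open>k\<close> is nonnegative to the right of
          \<open>a\<close> and nonpositive to the left, so it vanishes at \<open>a\<close>.\<close>
        have k1: "0 \<le> poly k t" if "a < t" "t \<le> M" for t
          using qt[of t] that 3 by (simp add: zero_le_mult_iff)
        have k2: "0 \<le> poly (- k) t" if "0 \<le> t" "t < a" for t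
          using qt[of t] that 3 by (simp add: zero_le_mult_iff)
        have ge: "0 \<le> poly (k \<circ>\<^sub>p [:a, 1:]) 0"
          by (rule poly_nonneg_extend[of "M - a" 0]) (use k1 3 in \<open>auto simp: poly_pcompose\<close>)
        have le: "0 \<le> poly (- k) a"
          by (rule poly_nonneg_extend[of a a]) (use k2 3 in auto)
        from ge le have "poly k a = 0" by (simp add: poly_pcompose)
        then obtain l where l: "k = [:-a, 1:] * l" by (metis poly_eq_0_iff_dvd dvdE)
        have q: "q = [:-a, 1:]\<^sup>2 * l" by (simp only: k l power2_eq_square mult.assoc)
        have "nonneg_cone M l"
        proof (rule IH[OF q, where a = a])
          fix t assume t: "0 \<le> t" "t \<le> M" "t \<noteq> a"
          have "0 \<le> (t - a)\<^sup>2 * poly l t"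
            using less.prems[OF t(1,2)] by (simp add: q)
          then show "0 \<le> poly l t" using t(3) by (simp add: zero_le_mult_iff)
        qed (simp add: power2_eq_square)
        then show ?thesis
          by (subst q) (intro nonneg_cone_mult nonneg_cone_square)
      qed
    qed
  qed
qed

section \<open>Continuous functional calculus\<close>

instance ell2 :: banach ..

definition symmetric_op :: "('a::real_inner \<Rightarrow>\<^sub>L 'a) \<Rightarrow> bool"
  where "symmetric_op A \<longleftrightarrow> (\<forall>x y. inner (A x) y = inner x (A y))"

definition nonneg_op :: "('a::real_inner \<Rightarrow>\<^sub>L 'a) \<Rightarrow> bool"
  where "nonneg_op A \<longleftrightarrow> symmetric_op A \<and> (\<forall>x. 0 \<le> inner x (A x))"

lemmas compose_add_right = bounded_bilinear.add_right[OF bounded_bilinear_blinfun_compose]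
  and compose_diff_left = bounded_bilinear.diff_left[OF bounded_bilinear_blinfun_compose]
  and compose_diff_right = bounded_bilinear.diff_right[OF bounded_bilinear_blinfun_compose]
  and compose_scaleR_right = bounded_bilinear.scaleR_right[OF bounded_bilinear_blinfun_compose]
  and compose_sum_right = bounded_bilinear.sum_right[OF bounded_bilinear_blinfun_compose]

lemma inner_le_norm_op: "inner x (A x) \<le> norm A * (norm x)\<^sup>2" for A :: "'a::real_inner \<Rightarrow>\<^sub>L 'a"
proof -
  have "inner x (A x) \<le> norm x * norm (A x)" by (rule norm_cauchy_schwarz)
  also have "\<dots> \<le> norm x * (norm A * norm x)" by (intro mult_left_mono norm_blinfun) simp
  finally show ?thesis by (simp add: power2_eq_square mult_ac)
qed

lemma poly_op_bound:
  assumes "degree q \<le> n"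
  shows "poly_op q A = (\<Sum>i\<le>n. coeff q i *\<^sub>R (((o\<^sub>L) A) ^^ i) id_blinfun)"
  unfolding poly_op_def
  by (rule sum.mono_neutral_left) (use assms in \<open>auto simp: coeff_eq_0\<close>)

lemma poly_op_0 [simp]: "poly_op 0 A = 0"
  by (simp add: poly_op_def)

lemma poly_op_pCons [simp]: "poly_op (pCons c q) A = c *\<^sub>R id_blinfun + (A o\<^sub>L poly_op q A)"
proof -
  have "poly_op (pCons c q) A
      = (\<Sum>i\<le>Suc (degree q). coeff (pCons c q) i *\<^sub>R (((o\<^sub>L) A) ^^ i) id_blinfun)"
    by (rule poly_op_bound) (simp add: degree_pCons_le)
  also have "\<dots> = c *\<^sub>R id_blinfun
      + (\<Sum>i\<le>degree q. coeff q i *\<^sub>R (A o\<^sub>L (((o\<^sub>L) A) ^^ i) id_blinfun))"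
    by (simp add: sum.atMost_Suc_shift del: sum.atMost_Suc)
  finally show ?thesis
    by (simp add: poly_op_def compose_sum_right compose_scaleR_right)
qed

lemma poly_op_add: "poly_op (p + q) A = poly_op p A + poly_op q A"
  by (induction p q rule: poly_induct2)
    (simp_all add: algebra_simps compose_add_right)

lemma poly_op_smult: "poly_op (Polynomial.smult c q) A = c *\<^sub>R poly_op q A"
  by (induction q) (simp_all add: algebra_simps compose_scaleR_right)

lemma poly_op_diff: "poly_op (p - q) A = poly_op p A - poly_op q A"
  using poly_op_add[of "p - q" q A] by simp

lemma poly_op_mult: "poly_op (p * q) A = poly_op p A o\<^sub>L poly_op q A"
  by (induction p)
    (auto simp: poly_op_add poly_op_smult blinfun.bilinear_simps intro!: blinfun_eqI)

lemma symmetric_poly_op: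
  assumes "symmetric_op A"
  shows "symmetric_op (poly_op q A)"
proof (induction q)
  case (pCons c q)
  have "A (poly_op q A x) = poly_op q A (A x)" for x
  proof -
    have "poly_op ([:0, 1:] * q) A x = poly_op (q * [:0, 1:]) A x" by (simp only: mult.commute)
    then show ?thesis unfolding poly_op_mult by (simp add: blinfun.bilinear_simps)
  qed
  then show ?case
    using assms pCons.IH
    by (simp add: symmetric_op_def blinfun.bilinear_simps inner_add_left inner_add_right)
qed (simp add: symmetric_op_def)

text \<open>With \<open>M = norm A\<close>, the identity
  \<open>M A (M - A) = (M - A) A (M - A) + A (M - A) A\<close> exhibits the difference of the two
  sides, up to the factor \<open>M\<close>, as a sum of symmetric conjugates of the nonnegative
  operators \<open>A\<close> and \<open>M - A\<close>.\<close>

lemma nonneg_op_mult_upper: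
  assumes A: "nonneg_op A"
  shows "(norm (A x))\<^sup>2 \<le> norm A * inner x (A x)"
proof (cases "norm A = 0")
  case False
  define M where "M = norm A"
  have M: "M > 0" using False by (simp add: M_def)
  define y where "y = M *\<^sub>R x - A x"
  have sym: "inner (A u) v = inner u (A v)" for u v using A by (simp add: nonneg_op_def symmetric_op_def)
  have "0 \<le> inner y (A y) + (M * (norm (A x))\<^sup>2 - inner (A x) (A (A x)))"
    using A inner_le_norm_op[of "A x" A] by (simp add: nonneg_op_def M_def)
  also have "\<dots> = M * (M * inner x (A x) - (norm (A x))\<^sup>2)"
    using sym[of x "A x"] sym[of "A x" "A x"]
    by (simp add: y_def blinfun.bilinear_simps inner_diff_left inner_diff_right
        power2_norm_eq_inner algebra_simps)
  finally show ?thesis using M by (simp add: M_def zero_le_mult_iff)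
qed simp

lemma nonneg_poly_op_cone:
  assumes A: "nonneg_op A" and q: "nonneg_cone (norm A) q"
  shows "nonneg_op (poly_op q A)"
proof -
  have sym: "symmetric_op (poly_op q A)" for q
    using A symmetric_poly_op by (auto simp: nonneg_op_def)
  have "0 \<le> inner x (poly_op q A x)" for x
    using q
  proof induction
    case (add q p)
    obtain r i j where q: "q = r\<^sup>2 * [:0, 1:] ^ i * [:norm A, -1:] ^ j"
      using add.hyps by (auto simp: nonneg_product_def)
    \<comment> \<open>Half of each exponent goes with \<open>r\<close> into the outer factor
      \<open>w\<close>; the middle factor \<open>d\<close> is left as one of \<open>1\<close>,
      \<open>t\<close>, \<open>M - t\<close> and \<open>t (M - t)\<close> with
      \<open>M = norm A\<close>.\<close>
    define w where "w = r * [:0, 1:] ^ (i div 2) * [:norm A, -1:] ^ (j div 2)"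
    define d where "d = [:0, 1:] ^ (i mod 2) * [:norm A, -1:] ^ (j mod 2)"
    have pw: "c ^ k = c ^ (k div 2) * c ^ (k div 2) * c ^ (k mod 2)" for c :: "real poly" and k
      by (metis power_add mult_2 mult_div_mod_eq)
    have "q = w * (d * w)"
      unfolding q w_def d_def power2_eq_square pw[of _ i] pw[of _ j] by (simp only: mult_ac)
    then have "inner x (poly_op q A x) = inner (poly_op w A x) (poly_op d A (poly_op w A x))"
      using sym[of w] by (simp add: poly_op_mult symmetric_op_def)
    also have "\<dots> \<ge> 0"
    proof -
      have "0 \<le> inner y (poly_op d A y)" for y
        using A nonneg_op_mult_upper[OF A, of y] inner_le_norm_op[of y A]
        by (cases "i mod 2 = 0"; cases "j mod 2 = 0")
          (auto simp: d_def nonneg_op_def poly_op_mult blinfun.bilinear_simps inner_diff_right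
            inner_add_right power2_norm_eq_inner symmetric_op_def one_pCons)
      then show ?thesis .
    qed
    finally show ?case using add.IH by (simp add: poly_op_add blinfun.bilinear_simps inner_add_right)
  qed simp
  then show ?thesis using sym by (simp add: nonneg_op_def)
qed

lemma nonneg_poly_op:
  assumes A: "nonneg_op A" and q: "\<And>t. 0 \<le> t \<Longrightarrow> t \<le> norm A \<Longrightarrow> 0 \<le> poly q t"
  shows "nonneg_op (poly_op q A)"
proof (cases "norm A = 0")
  case True
  then have "poly_op q A = poly q 0 *\<^sub>R id_blinfun"
    by (induction q) (auto intro!: blinfun_eqI)
  then show ?thesis
    using q[of 0] by (simp add: nonneg_op_def symmetric_op_def blinfun.bilinear_simps)
qed (use A q nonneg_poly_op_cone nonneg_coneI in simp)

text \<open>The polynomial \<open>s^2 - q^2\<close> is nonnegative on the interval, and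
  nonnegativity of its value at \<open>A\<close> is the norm bound. This estimate turns uniform
  convergence of polynomials into norm convergence of operators.\<close>

lemma norm_poly_op_le:
  assumes A: "nonneg_op A" and s: "0 \<le> s"
    and q: "\<And>t. 0 \<le> t \<Longrightarrow> t \<le> norm A \<Longrightarrow> \<bar>poly q t\<bar> \<le> s"
  shows "norm (poly_op q A) \<le> s"
proof (rule norm_blinfun_bound[OF s])
  fix x
  have sym: "symmetric_op (poly_op q A)"
    using A symmetric_poly_op by (auto simp: nonneg_op_def)
  have "nonneg_op (poly_op ([:s\<^sup>2:] - q * q) A)"
  proof (rule nonneg_poly_op[OF A])
    fix t assume "0 \<le> t" "t \<le> norm A"
    then show "0 \<le> poly ([:s\<^sup>2:] - q * q) t"
      using power_mono[OF q[of t], of 2] by (simp add: power2_eq_square)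
  qed
  then have "0 \<le> inner x ((poly_op ([:s\<^sup>2:] - q * q) A) x)" by (simp add: nonneg_op_def)
  also have "poly_op ([:s\<^sup>2:] - q * q) A x = s\<^sup>2 *\<^sub>R x - poly_op q A (poly_op q A x)"
    by (simp add: poly_op_diff poly_op_mult blinfun.bilinear_simps)
  also have "inner x \<dots> = s\<^sup>2 * (norm x)\<^sup>2 - (norm (poly_op q A x))\<^sup>2"
    using sym by (simp add: inner_diff_right symmetric_op_def power2_norm_eq_inner)
  finally have "(norm (poly_op q A x))\<^sup>2 \<le> (s * norm x)\<^sup>2" by (simp add: power_mult_distrib)
  then show "norm (poly_op q A x) \<le> s * norm x"
    by (rule power2_le_imp_le) (use s in simp)
qed

lemma uniform_poly_approx:
  assumes "continuous_on {0..M::real} f"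
  obtains q :: "nat \<Rightarrow> real poly" where "uniform_limit {0..M} (\<lambda>k. poly (q k)) f sequentially"
proof -
  have "\<exists>p::real poly. \<forall>x\<in>{0..M}. \<bar>f x - poly p x\<bar> < 1 / real (Suc k)" for k
  proof -
    obtain g where g: "real_polynomial_function g" "\<And>x. x \<in> {0..M} \<Longrightarrow> \<bar>f x - g x\<bar> < 1 / real (Suc k)"
      using Stone_Weierstrass_real_polynomial_function[of "{0..M}" f "1 / real (Suc k)"] assms by auto
    obtain a n where "g = (\<lambda>x. \<Sum>i\<le>n. a i * x ^ i)"
      using g(1) real_polynomial_function_iff_sum by blast
    then have "g = poly (\<Sum>i\<le>n. monom (a i) i)"
      by (simp add: poly_sum poly_monom fun_eq_iff)
    then show ?thesis using g(2) by metis
  qed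
  then obtain q :: "nat \<Rightarrow> real poly"
    where q: "\<And>k x. x \<in> {0..M} \<Longrightarrow> \<bar>f x - poly (q k) x\<bar> < 1 / real (Suc k)" by metis
  have "uniform_limit {0..M} (\<lambda>k. poly (q k)) f sequentially"
  proof (rule uniform_limitI)
    fix e :: real assume "e > 0"
    then obtain N where N: "1 / real (Suc N) < e" using nat_approx_posE by blast
    have "dist (poly (q k) x) (f x) < e" if "k \<ge> N" "x \<in> {0..M}" for k x
    proof -
      have "\<bar>f x - poly (q k) x\<bar> < 1 / real (Suc k)" by (rule q[OF that(2)])
      also have "\<dots> \<le> 1 / real (Suc N)" using that by (simp add: frac_le)
      finally show ?thesis using N by (simp add: dist_real_def abs_minus_commute)
    qed
    then show "\<forall>\<^sub>F k in sequentially. \<forall>x\<in>{0..M}. dist (poly (q k) x) (f x) < e"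
      unfolding eventually_sequentially by blast
  qed
  then show thesis by (rule that)
qed

text \<open>Two approximating sequences are compared at once: with \<open>p = q\<close> this is the
  Cauchy property, and in general it shows that the limit does not depend on the sequence.\<close>

lemma poly_op_dist_tendsto:
  assumes A: "nonneg_op A"
    and p: "uniform_limit {0..norm A} (\<lambda>k. poly (p k)) f sequentially"
    and q: "uniform_limit {0..norm A} (\<lambda>k. poly (q k)) f sequentially"
    and e: "e > 0"
  obtains N where "\<And>k l. k \<ge> N \<Longrightarrow> l \<ge> N \<Longrightarrow> norm (poly_op (p k) A - poly_op (q l) A) < e"
proof -
  have "\<forall>\<^sub>F k in sequentially. \<forall>x\<in>{0..norm A}. dist (poly (p k) x) (f x) < e/4"
    "\<forall>\<^sub>F k in sequentially. \<forall>x\<in>{0..norm A}. dist (poly (q k) x) (f x) < e/4"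
    using uniform_limitD[OF p, of "e/4"] uniform_limitD[OF q, of "e/4"] e by auto
  then have "\<forall>\<^sub>F k in sequentially. (\<forall>x\<in>{0..norm A}. dist (poly (p k) x) (f x) < e/4) \<and>
      (\<forall>x\<in>{0..norm A}. dist (poly (q k) x) (f x) < e/4)"
    by (rule eventually_conj)
  then obtain N where N: "\<And>k x. k \<ge> N \<Longrightarrow> x \<in> {0..norm A} \<Longrightarrow> dist (poly (p k) x) (f x) < e/4"
    "\<And>k x. k \<ge> N \<Longrightarrow> x \<in> {0..norm A} \<Longrightarrow> dist (poly (q k) x) (f x) < e/4"
    unfolding eventually_sequentially by blast
  have "norm (poly_op (p k) A - poly_op (q l) A) < e" if "k \<ge> N" "l \<ge> N" for k l
  proof -
    have "norm (poly_op (p k - q l) A) \<le> e/2"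
    proof (rule norm_poly_op_le[OF A])
      fix t assume "0 \<le> t" "t \<le> norm A"
      then have "\<bar>poly (p k) t - f t\<bar> < e/4" "\<bar>poly (q l) t - f t\<bar> < e/4"
        using N(1)[OF that(1), of t] N(2)[OF that(2), of t] by (simp_all add: dist_real_def)
      then show "\<bar>poly (p k - q l) t\<bar> \<le> e/2"
        unfolding poly_diff by linarith
    qed (use e in simp)
    then show ?thesis using e by (simp add: poly_op_diff)
  qed
  then show thesis by (rule that)
qed

text \<open>Supplies existence and uniqueness for the definite description in
  \<open>fun_calc\<close>. From here on its properties are passed to the limit from
  polynomials.\<close>

lemma fun_calc_tendsto:
  assumes A: "nonneg_op A" and f: "continuous_on {0..norm A} f"
    and q: "uniform_limit {0..norm A} (\<lambda>k. poly (q k)) f sequentially"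
  shows "(\<lambda>k. poly_op (q k) A) \<longlonglongrightarrow> fun_calc f A"
proof -
  let ?lim = "\<lambda>B. \<forall>q :: nat \<Rightarrow> real poly.
    uniform_limit {0..norm A} (\<lambda>k. poly (q k)) f sequentially \<longrightarrow> (\<lambda>k. poly_op (q k) A) \<longlonglongrightarrow> B"
  have "Cauchy (\<lambda>k. poly_op (q k) A)"
    unfolding Cauchy_def dist_norm using poly_op_dist_tendsto[OF A q q] by metis
  then obtain B where B: "(\<lambda>k. poly_op (q k) A) \<longlonglongrightarrow> B"
    by (auto simp: Cauchy_convergent_iff convergent_def)
  have "?lim B"
  proof (intro allI impI)
    fix p :: "nat \<Rightarrow> real poly"
    assume p: "uniform_limit {0..norm A} (\<lambda>k. poly (p k)) f sequentially"
    have "(\<lambda>k. poly_op (p k) A - poly_op (q k) A) \<longlonglongrightarrow> 0"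
      unfolding LIMSEQ_iff diff_zero using poly_op_dist_tendsto[OF A p q] by metis
    from tendsto_add[OF this B] show "(\<lambda>k. poly_op (p k) A) \<longlonglongrightarrow> B" by simp
  qed
  moreover have "C = B" if "?lim C" for C
    using that q B LIMSEQ_unique by blast
  ultimately have "?lim (fun_calc f A)"
    unfolding fun_calc_def by (intro theI[of ?lim B])
  then show ?thesis using q by blast
qed

lemma fun_calc_poly:
  assumes A: "nonneg_op A" and f: "\<And>t. 0 \<le> t \<Longrightarrow> t \<le> norm A \<Longrightarrow> f t = poly q t"
  shows "fun_calc f A = poly_op q A"
proof -
  have "continuous_on {0..norm A} (poly q)" by (intro continuous_intros)
  then have "continuous_on {0..norm A} f"
    by (rule continuous_on_eq) (use f in auto)
  moreover have "uniform_limit {0..norm A} (\<lambda>k. poly q) f sequentially"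
    using f by (intro uniform_limitI) auto
  ultimately show ?thesis
    using fun_calc_tendsto[OF A, of f "\<lambda>_. q"] LIMSEQ_unique tendsto_const by blast
qed

lemma fun_calc_mono:
  assumes A: "nonneg_op A" and f: "continuous_on {0..norm A} f" and g: "continuous_on {0..norm A} g"
    and le: "\<And>t. 0 \<le> t \<Longrightarrow> t \<le> norm A \<Longrightarrow> f t \<le> g t"
  shows "inner x (fun_calc f A x) \<le> inner x (fun_calc g A x)"
proof (rule field_le_epsilon)
  fix d :: real assume "d > 0"
  \<comment> \<open>Chosen so that \<open>2 * e * (norm x)^2 \<le> d\<close>, also for
    \<open>x = 0\<close>.\<close>
  define e where "e = d / (2 * ((norm x)\<^sup>2 + 1))"
  have e: "e > 0" using \<open>d > 0\<close> by (simp add: e_def add_nonneg_pos)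
  obtain q :: "nat \<Rightarrow> real poly" where q: "uniform_limit {0..norm A} (\<lambda>k. poly (q k)) f sequentially"
    using uniform_poly_approx[OF f] .
  obtain r :: "nat \<Rightarrow> real poly" where r: "uniform_limit {0..norm A} (\<lambda>k. poly (r k)) g sequentially"
    using uniform_poly_approx[OF g] .
  have "\<forall>\<^sub>F k in sequentially. inner x (poly_op (q k) A x) \<le> inner x (poly_op (r k) A x) + 2 * e * (norm x)\<^sup>2"
    using uniform_limitD[OF q e] uniform_limitD[OF r e]
  proof eventually_elim
    case (elim k)
    \<comment> \<open>Both approximants are within \<open>e\<close> of their limits, so adding
      \<open>2 * e\<close> restores the order on the interval.\<close>
    have "nonneg_op (poly_op (r k - q k + [:2 * e:]) A)"
    proof (rule nonneg_poly_op[OF A])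
      fix t assume t: "0 \<le> t" "t \<le> norm A"
      then have "\<bar>poly (q k) t - f t\<bar> < e" "\<bar>poly (r k) t - g t\<bar> < e"
        using elim by (auto simp: dist_real_def)
      then show "0 \<le> poly (r k - q k + [:2 * e:]) t" using le[OF t] by simp
    qed
    then have "0 \<le> inner x (poly_op (r k - q k + [:2 * e:]) A x)" by (simp add: nonneg_op_def)
    then show ?case
      by (simp add: poly_op_add poly_op_diff blinfun.bilinear_simps inner_add_right inner_diff_right
          power2_norm_eq_inner)
  qed
  moreover have "(\<lambda>k. inner x (poly_op (q k) A x)) \<longlonglongrightarrow> inner x (fun_calc f A x)"
    by (intro tendsto_intros fun_calc_tendsto[OF A f q])
  moreover have "(\<lambda>k. inner x (poly_op (r k) A x) + 2 * e * (norm x)\<^sup>2)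
      \<longlonglongrightarrow> inner x (fun_calc g A x) + 2 * e * (norm x)\<^sup>2"
    by (intro tendsto_intros fun_calc_tendsto[OF A g r])
  ultimately have "inner x (fun_calc f A x) \<le> inner x (fun_calc g A x) + 2 * e * (norm x)\<^sup>2"
    using tendsto_le[OF sequentially_bot] by blast
  also have "2 * e * (norm x)\<^sup>2 \<le> d"
  proof -
    have "d * (norm x)\<^sup>2 \<le> d * ((norm x)\<^sup>2 + 1)" using \<open>d > 0\<close> by simp
    moreover have "(norm x)\<^sup>2 + 1 > 0" by (simp add: add_nonneg_pos)
    ultimately show ?thesis using \<open>d > 0\<close> by (simp add: e_def divide_le_eq algebra_simps)
  qed
  finally show "inner x (fun_calc f A x) \<le> inner x (fun_calc g A x) + d" by simp
qed

lemma symmetric_fun_calc: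
  assumes A: "nonneg_op A" and f: "continuous_on {0..norm A} f"
  shows "symmetric_op (fun_calc f A)"
proof -
  obtain q :: "nat \<Rightarrow> real poly" where q: "uniform_limit {0..norm A} (\<lambda>k. poly (q k)) f sequentially"
    using uniform_poly_approx[OF f] .
  note lim = fun_calc_tendsto[OF A f q]
  have "inner (fun_calc f A x) y = inner x (fun_calc f A y)" for x y
  proof (rule LIMSEQ_unique)
    show "(\<lambda>k. inner (poly_op (q k) A x) y) \<longlonglongrightarrow> inner (fun_calc f A x) y"
      by (intro tendsto_intros lim)
    have "inner (poly_op (q k) A x) y = inner x (poly_op (q k) A y)" for k
      using A symmetric_poly_op[of A "q k"] by (auto simp: nonneg_op_def symmetric_op_def)
    then show "(\<lambda>k. inner (poly_op (q k) A x) y) \<longlonglongrightarrow> inner x (fun_calc f A y)"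
      by (simp only:) (intro tendsto_intros lim)
  qed
  then show ?thesis by (simp add: symmetric_op_def)
qed

lemma nonneg_fun_calc:
  assumes A: "nonneg_op A" and f: "continuous_on {0..norm A} f"
    and le: "\<And>t. 0 \<le> t \<Longrightarrow> t \<le> norm A \<Longrightarrow> 0 \<le> f t"
  shows "nonneg_op (fun_calc f A)"
  using fun_calc_mono[OF A _ f, of "\<lambda>_. 0"] le fun_calc_poly[OF A, of "\<lambda>_. 0" 0]
    symmetric_fun_calc[OF A f]
  by (simp add: nonneg_op_def)

lemma fun_calc_le_bound:
  assumes A: "nonneg_op A" and f: "continuous_on {0..norm A} f"
    and le: "\<And>t. 0 \<le> t \<Longrightarrow> t \<le> norm A \<Longrightarrow> f t \<le> c"
  shows "inner x (fun_calc f A x) \<le> c * (norm x)\<^sup>2"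
  using fun_calc_mono[OF A f, of "\<lambda>_. c" x] le fun_calc_poly[OF A, of "\<lambda>_. c" "[:c:]"]
  by (simp add: blinfun.bilinear_simps power2_norm_eq_inner)

text \<open>On a vector of the kernel a polynomial in \<open>A\<close> acts by its constant term,
  and the constant terms of the approximants tend to \<open>f 0\<close>.\<close>

lemma fun_calc_kernel:
  assumes A: "nonneg_op A" and f: "continuous_on {0..norm A} f" and 0: "f 0 = 0" and v: "A v = 0"
  shows "fun_calc f A v = 0"
proof -
  obtain q :: "nat \<Rightarrow> real poly" where q: "uniform_limit {0..norm A} (\<lambda>k. poly (q k)) f sequentially"
    using uniform_poly_approx[OF f] .
  have "poly_op r A v = poly r 0 *\<^sub>R v" for r
    by (induction r) (simp_all add: blinfun.bilinear_simps v)
  moreover have "(\<lambda>k. poly (q k) 0) \<longlonglongrightarrow> 0"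
    using tendsto_uniform_limitI[OF q, of 0] 0 by simp
  then have "(\<lambda>k. poly (q k) 0 *\<^sub>R v) \<longlonglongrightarrow> 0 *\<^sub>R v" by (intro tendsto_intros)
  moreover have "(\<lambda>k. poly_op (q k) A v) \<longlonglongrightarrow> fun_calc f A v"
    by (intro tendsto_intros fun_calc_tendsto[OF A f q])
  ultimately show ?thesis using LIMSEQ_unique by fastforce
qed

text \<open>The squares of polynomials approximating the square root converge uniformly to
  \<open>t\<close>, as the square root is bounded on the interval.\<close>

lemma fun_calc_sqrt_compose:
  assumes A: "nonneg_op A"
  shows "fun_calc sqrt A o\<^sub>L fun_calc sqrt A = A"
proof -
  have f: "continuous_on {0..norm A} sqrt" by (intro continuous_intros)
  obtain q :: "nat \<Rightarrow> real poly" where q: "uniform_limit {0..norm A} (\<lambda>k. poly (q k)) sqrt sequentially"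
    using uniform_poly_approx[OF f] .
  have "bounded (sqrt ` {0..norm A})"
    by (intro compact_imp_bounded compact_continuous_image f compact_Icc)
  then have "uniform_limit {0..norm A} (\<lambda>k t. poly (q k) t * poly (q k) t) (\<lambda>t. sqrt t * sqrt t) sequentially"
    by (intro uniform_lim_mult q)
  then have "uniform_limit {0..norm A} (\<lambda>k. poly (q k * q k)) (poly [:0, 1:]) sequentially"
    by (rule uniform_limit_cong'[THEN iffD1, rotated -1]) auto
  then have "(\<lambda>k. poly_op (q k * q k) A) \<longlonglongrightarrow> fun_calc (poly [:0, 1:]) A"
    by (intro fun_calc_tendsto[OF A] continuous_intros)
  moreover have "(\<lambda>k. poly_op (q k * q k) A) \<longlonglongrightarrow> (fun_calc sqrt A o\<^sub>L fun_calc sqrt A)"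
    unfolding poly_op_mult
    by (intro bounded_bilinear.tendsto[OF bounded_bilinear_blinfun_compose] fun_calc_tendsto[OF A f q])
  moreover have "fun_calc (poly [:0, 1:]) A = A"
    by (subst fun_calc_poly[OF A, of _ "[:0, 1:]"]) (auto intro: blinfun_eqI simp: blinfun.bilinear_simps)
  ultimately show ?thesis using LIMSEQ_unique by metis
qed

section \<open>Coordinates and linear functionals\<close>

lemma coord_unit_vec: "coord (unit_vec n) m = (if m = n then 1 else 0)"
proof -
  have "summable (\<lambda>m. (cmod (if m = n then 1 else 0))\<^sup>2)"
    by (rule summable_finite[of "{n}"]) auto
  then show ?thesis by (simp add: unit_vec_def Abs_ell2_inverse)
qed

lemma coord_sum: "coord (\<Sum>i\<in>I. f i) n = (\<Sum>i\<in>I. coord (f i) n)"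
  by (induction I rule: infinite_finite_induct) (auto simp: plus_ell2.rep_eq zero_ell2.rep_eq)

lemmas coord_simps = plus_ell2.rep_eq minus_ell2.rep_eq uminus_ell2.rep_eq zero_ell2.rep_eq
  scaleR_ell2.rep_eq scaleC.rep_eq coord_unit_vec coord_sum

definition partial_vec :: "(nat \<Rightarrow> complex) \<Rightarrow> nat \<Rightarrow> ell2"
  where "partial_vec a N = (\<Sum>n<N. scaleC (a n) (unit_vec n))"

lemma coord_partial_vec: "coord (partial_vec a N) n = (if n < N then a n else 0)"
  by (simp add: partial_vec_def coord_simps if_distrib[of "\<lambda>c. _ * c"] sum.delta' cong: if_cong)

lemma norm_partial_vec: "(norm (partial_vec a N))\<^sup>2 = (\<Sum>n<N. (cmod (a n))\<^sup>2)"
proof -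
  have "(\<Sum>n. (cmod (coord (partial_vec a N) n))\<^sup>2) = (\<Sum>n<N. (cmod (coord (partial_vec a N) n))\<^sup>2)"
    by (rule suminf_finite) (auto simp: coord_partial_vec)
  then show ?thesis by (simp add: norm_ell2_sum coord_partial_vec)
qed

lemma partial_vec_tendsto: "partial_vec (coord x) \<longlonglongrightarrow> x"
proof -
  have "(norm (x - partial_vec (coord x) N))\<^sup>2
      = (\<Sum>n. (cmod (coord x n))\<^sup>2) - (\<Sum>n<N. (cmod (coord x n))\<^sup>2)" for N
  proof -
    have "(\<lambda>n. if n \<in> {..<N} then (cmod (coord x n))\<^sup>2 else 0) sums (\<Sum>n<N. (cmod (coord x n))\<^sup>2)"
      by (rule sums_If_finite_set) simp
    from sums_diff[OF summable_sums[OF coord_summable[of x]] this]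
    have "(\<lambda>n. (cmod (coord (x - partial_vec (coord x) N) n))\<^sup>2)
        sums ((\<Sum>n. (cmod (coord x n))\<^sup>2) - (\<Sum>n<N. (cmod (coord x n))\<^sup>2))"
      by (rule sums_cong[THEN iffD1, rotated]) (auto simp: coord_simps coord_partial_vec)
    then show ?thesis by (simp add: norm_ell2_sum sums_iff)
  qed
  moreover have "(\<lambda>N. (\<Sum>n. (cmod (coord x n))\<^sup>2) - (\<Sum>n<N. (cmod (coord x n))\<^sup>2))
      \<longlonglongrightarrow> (\<Sum>n. (cmod (coord x n))\<^sup>2) - (\<Sum>n. (cmod (coord x n))\<^sup>2)"
    by (intro tendsto_diff tendsto_const summable_LIMSEQ coord_summable)
  ultimately have "(\<lambda>N. (norm (x - partial_vec (coord x) N))\<^sup>2) \<longlonglongrightarrow> 0" by simp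
  then have "(\<lambda>N. sqrt ((norm (x - partial_vec (coord x) N))\<^sup>2)) \<longlonglongrightarrow> sqrt 0"
    by (rule tendsto_real_sqrt)
  then have "(\<lambda>N. x - partial_vec (coord x) N) \<longlonglongrightarrow> 0"
    by (simp add: tendsto_norm_zero_iff)
  from tendsto_diff[OF tendsto_const[of x] this] show ?thesis by simp
qed

lemma scaleC_eq: "scaleC c x = Re c *\<^sub>R x + Im c *\<^sub>R scaleC \<i> x"
  by (rule ell2_eqI) (simp add: coord_simps complex_eq_iff)

lemma norm_scaleC: "norm (scaleC c x) = cmod c * norm x"
proof -
  have "(norm (scaleC c x))\<^sup>2 = (cmod c * norm x)\<^sup>2"
    by (simp add: norm_ell2_sum coord_simps norm_mult power_mult_distrib suminf_mult coord_summable)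
  then show ?thesis by (simp only: power2_eq_iff_nonneg norm_ge_zero mult_nonneg_nonneg)
qed

lemma inner_scaleC_left: "inner (scaleC c x) y = inner x (scaleC (cnj c) y)"
  by (simp add: inner_ell2_sum coord_simps algebra_simps)

lemma inner_unit_vec: "inner (unit_vec n) x = Re (coord x n)"
proof -
  have "inner (unit_vec n) x = (\<Sum>m\<in>{n}. Re (cnj (coord (unit_vec n) m) * coord x m))"
    unfolding inner_ell2_sum by (rule suminf_finite) (auto simp: coord_unit_vec)
  then show ?thesis by (simp add: coord_unit_vec)
qed

lemma inner_i_unit_vec: "inner (scaleC \<i> (unit_vec n)) x = Im (coord x n)"
  by (simp add: inner_scaleC_left inner_unit_vec coord_simps)

text \<open>Identities for the complex inner product are reduced to real ones in this way.\<close>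

lemma cinner_eq: "cinner x y = Complex (inner x y) (inner (scaleC \<i> x) y)"
proof -
  have "cinner (scaleC \<i> x) y = (\<Sum>n. - \<i> * (cnj (coord x n) * coord y n))"
    by (simp add: cinner_def coord_simps mult_ac)
  also have "\<dots> = - \<i> * cinner x y"
    unfolding cinner_def by (rule suminf_mult[OF cinner_summable])
  finally show ?thesis by (simp add: inner_ell2_def)
qed

text \<open>The coordinates of the representing vector are read off from \<open>f\<close> on
  \<open>unit_vec n\<close> and on \<open>\<i>\<close> times it. Testing \<open>f\<close> on the
  partial sums of that vector bounds their norms by the bound of \<open>f\<close>, so the
  coordinates are square-summable.\<close>

lemma ell2_Riesz:
  assumes f: "bounded_linear (f :: ell2 \<Rightarrow> real)"
  obtains z where "\<And>y. f y = inner z y"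
proof -
  interpret f: bounded_linear f by (rule f)
  obtain K where K: "\<And>x. \<bar>f x\<bar> \<le> norm x * K" and "K > 0"
    using f.pos_bounded by auto
  define a where "a n = Complex (f (unit_vec n)) (f (scaleC \<i> (unit_vec n)))" for n
  have fa: "f (scaleC c (unit_vec n)) = Re (cnj (a n) * c)" for c n
    by (subst scaleC_eq) (simp add: f.add f.scaleR a_def)
  have bound: "(\<Sum>n<N. (cmod (a n))\<^sup>2) \<le> K\<^sup>2" for N
  proof -
    let ?v = "partial_vec a N"
    have "f ?v = (\<Sum>n<N. (cmod (a n))\<^sup>2)"
      unfolding partial_vec_def f.sum fa by (simp add: cmod_power2) (simp add: power2_eq_square)
    then have "(norm ?v)\<^sup>2 \<le> norm ?v * K"
      using K[of ?v] by (simp add: norm_partial_vec)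
    then have "norm ?v \<le> K" using \<open>K > 0\<close>
      by (cases "norm ?v = 0") (auto simp: power2_eq_square)
    then have "(norm ?v)\<^sup>2 \<le> K\<^sup>2" by (intro power_mono) auto
    then show ?thesis by (simp add: norm_partial_vec)
  qed
  have "summable (\<lambda>n. (cmod (a n))\<^sup>2)"
    using bound[of "Suc _"] unfolding lessThan_Suc_atMost
    by (intro bounded_imp_summable[where B = "K\<^sup>2"]) auto
  then have a: "coord (Abs_ell2 a) = a" by (simp add: Abs_ell2_inverse)
  have "f y = inner (Abs_ell2 a) y" for y
  proof (rule LIMSEQ_unique)
    show "(\<lambda>N. f (partial_vec (coord y) N)) \<longlonglongrightarrow> f y"
      by (intro f.tendsto partial_vec_tendsto)
    have "f (partial_vec (coord y) N) = inner (Abs_ell2 a) (partial_vec (coord y) N)" for N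
    proof -
      have "inner (Abs_ell2 a) (scaleC c (unit_vec n)) = Re (cnj (a n) * c)" for c n
        by (subst inner_commute) (simp add: inner_scaleC_left inner_unit_vec coord_simps a)
      then show ?thesis
        unfolding partial_vec_def f.sum inner_sum_right by (simp add: fa)
    qed
    then show "(\<lambda>N. f (partial_vec (coord y) N)) \<longlonglongrightarrow> inner (Abs_ell2 a) y"
      by (simp only:) (intro tendsto_intros partial_vec_tendsto)
  qed
  then show thesis by (rule that)
qed

section \<open>Adjoints and Schatten classes\<close>

text \<open>Taken for the real inner product, the adjoint exists for every bounded real-linear map
  and is a linear function on the whole operator space; on complex-linear maps it agrees with
  \<open>adjoint_op\<close>.\<close>

definition real_adjoint :: "(ell2 \<Rightarrow>\<^sub>L ell2) \<Rightarrow> (ell2 \<Rightarrow>\<^sub>L ell2)"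
  where "real_adjoint A = (SOME B :: ell2 \<Rightarrow>\<^sub>L ell2. \<forall>x y. inner (B x) y = inner x (A y))"

lemma inner_eqI:
  fixes u v :: "'a::real_inner"
  assumes "\<And>y. inner u y = inner v y"
  shows "u = v"
  using assms by (intro vector_eq_rdot[THEN iffD1]) blast

lemma inner_real_adjoint: "inner (real_adjoint A x) y = inner x (A y)"
proof -
  have "\<exists>z. \<forall>y. inner x (A y) = inner z y" for x
  proof -
    have "bounded_linear (\<lambda>y. inner x (A y))"
      by (intro bounded_linear_compose[OF bounded_linear_inner_right] blinfun.bounded_linear_right)
    then show ?thesis using ell2_Riesz by metis
  qed
  then obtain b where b: "\<And>x y. inner x (A y) = inner (b x) y" by metis
  have "bounded_linear b"
  proof (rule bounded_linear_intro[where K = "norm A"])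
    show "b (x + y) = b x + b y" for x y
      by (rule inner_eqI) (simp add: b[symmetric] inner_add_left)
    show "b (r *\<^sub>R x) = r *\<^sub>R b x" for r x
      by (rule inner_eqI) (simp add: b[symmetric])
    fix x
    have "(norm (b x))\<^sup>2 = inner x (A (b x))" by (simp add: b power2_norm_eq_inner)
    also have "\<dots> \<le> norm x * norm (A (b x))" by (rule norm_cauchy_schwarz)
    also have "\<dots> \<le> norm x * (norm A * norm (b x))" by (intro mult_left_mono norm_blinfun) simp
    finally show "norm (b x) \<le> norm x * norm A"
      by (cases "norm (b x) = 0") (auto simp: power2_eq_square)
  qed
  then have "\<forall>x y. inner (Blinfun b x) y = inner x (A y)"
    by (simp add: bounded_linear_Blinfun_apply b)
  then have "\<forall>x y. inner (real_adjoint A x) y = inner x (A y)"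
    unfolding real_adjoint_def by (rule someI[where P = "\<lambda>B. \<forall>x y. inner (blinfun_apply B x) y = inner x (A y)"])
  then show ?thesis by blast
qed

lemma real_adjointI:
  fixes A B :: "ell2 \<Rightarrow>\<^sub>L ell2"
  assumes "\<And>x y. inner (B x) y = inner x (A y)"
  shows "real_adjoint A = B"
proof (rule blinfun_eqI)
  fix x
  have "inner (real_adjoint A x) y = inner (B x) y" for y
    by (simp add: inner_real_adjoint assms)
  then show "real_adjoint A x = B x" by (rule inner_eqI)
qed

lemma real_adjoint_simps:
  "real_adjoint (A + B) = real_adjoint A + real_adjoint B"
  "real_adjoint (A - B) = real_adjoint A - real_adjoint B"
  "real_adjoint (r *\<^sub>R A) = r *\<^sub>R real_adjoint A"
  "real_adjoint (A o\<^sub>L B) = real_adjoint B o\<^sub>L real_adjoint A"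
  "real_adjoint (real_adjoint A) = A"
  "real_adjoint id_blinfun = id_blinfun"
  subgoal by (rule real_adjointI) (simp add: blinfun.add_left inner_add_left inner_add_right inner_real_adjoint)
  subgoal by (rule real_adjointI) (simp add: blinfun.diff_left inner_diff_left inner_diff_right inner_real_adjoint)
  subgoal by (rule real_adjointI) (simp add: blinfun.scaleR_left inner_real_adjoint)
  subgoal by (rule real_adjointI) (simp add: inner_real_adjoint)
  subgoal by (rule real_adjointI) (simp add: inner_real_adjoint inner_commute[of "A _"] inner_commute[of _ "real_adjoint A _"])
  subgoal by (rule real_adjointI) simp
  done

lemma bounded_linear_real_adjoint: "bounded_linear real_adjoint"
proof (rule bounded_linear_intro[where K = 1])
  show "norm (real_adjoint A) \<le> norm A * 1" for A
  proof (rule norm_blinfun_bound)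
    fix x
    have "(norm (real_adjoint A x))\<^sup>2 = inner x (A (real_adjoint A x))"
      by (simp add: inner_real_adjoint power2_norm_eq_inner)
    also have "\<dots> \<le> norm x * norm (A (real_adjoint A x))" by (rule norm_cauchy_schwarz)
    also have "\<dots> \<le> norm x * (norm A * norm (real_adjoint A x))"
      by (intro mult_left_mono norm_blinfun) simp
    finally show "norm (real_adjoint A x) \<le> norm A * 1 * norm x"
      by (cases "norm (real_adjoint A x) = 0") (auto simp: power2_eq_square mult_ac)
  qed simp
qed (simp_all add: real_adjoint_simps)

lemma scaleC_simps:
  "scaleC c (x + y) = scaleC c x + scaleC c y" "scaleC c (x - y) = scaleC c x - scaleC c y"
  "scaleC c (r *\<^sub>R x) = r *\<^sub>R scaleC c x"
  by (rule ell2_eqI; simp add: coord_simps algebra_simps)+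

lemma complex_linear_simps:
  "complex_linear A \<Longrightarrow> complex_linear B \<Longrightarrow> complex_linear (A + B)"
  "complex_linear A \<Longrightarrow> complex_linear B \<Longrightarrow> complex_linear (A - B)"
  "complex_linear A \<Longrightarrow> complex_linear B \<Longrightarrow> complex_linear (A o\<^sub>L B)"
  "complex_linear id_blinfun"
  by (simp_all add: complex_linear_def blinfun.bilinear_simps scaleC_simps)

lemma complex_linear_real_adjoint:
  assumes "complex_linear A"
  shows "complex_linear (real_adjoint A)"
  unfolding complex_linear_def
proof (intro allI)
  fix c x
  have "inner (real_adjoint A (scaleC c x)) y = inner (scaleC c (real_adjoint A x)) y" for y
    using assms by (simp add: inner_real_adjoint inner_scaleC_left complex_linear_def)
  then show "real_adjoint A (scaleC c x) = scaleC c (real_adjoint A x)"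
    by (rule inner_eqI)
qed

lemma adjoint_op_eq:
  assumes "complex_linear A"
  shows "adjoint_op A = real_adjoint A"
  unfolding adjoint_op_def
proof (rule the_equality)
  have *: "real_adjoint A (scaleC c x) = scaleC c (real_adjoint A x)" for c x
    using complex_linear_real_adjoint[OF assms] by (simp add: complex_linear_def)
  show "\<forall>x y. cinner (real_adjoint A x) y = cinner x (A y)"
    by (simp add: cinner_eq flip: *) (simp add: inner_real_adjoint)
  show "B = real_adjoint A" if "\<forall>x y. cinner (blinfun_apply B x) y = cinner x (A y)" for B
    using that by (intro real_adjointI[symmetric]) (simp add: cinner_eq)
qed

lemma unitary_op_eq:
  "unitary_op u \<longleftrightarrow> complex_linear u \<and>
    real_adjoint u o\<^sub>L u = id_blinfun \<and> u o\<^sub>L real_adjoint u = id_blinfun"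
  by (auto simp: unitary_op_def adjoint_op_eq)

lemma unitary_op_adjoint: "unitary_op u \<Longrightarrow> unitary_op (real_adjoint u)"
  by (auto simp: unitary_op_eq real_adjoint_simps complex_linear_real_adjoint)

lemma unitary_op_apply:
  assumes "unitary_op u"
  shows "real_adjoint u (u x) = x" "u (real_adjoint u x) = x"
  using assms unfolding unitary_op_eq by (metis blinfun_apply_blinfun_compose blinfun_apply_id_blinfun id_apply)+

lemma norm_unitary_op_apply:
  assumes "unitary_op u"
  shows "norm (u x) = norm x"
proof -
  have "inner (u x) (u x) = inner (real_adjoint u (u x)) x" by (simp add: inner_real_adjoint)
  then show ?thesis by (simp add: unitary_op_apply[OF assms] norm_eq)
qed

lemma norm_unitary_op_le: "unitary_op u \<Longrightarrow> norm u \<le> 1"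
  by (rule norm_blinfun_bound) (simp_all add: norm_unitary_op_apply)

lemma nonneg_op_gram: "nonneg_op (real_adjoint x o\<^sub>L x)"
  by (simp add: nonneg_op_def symmetric_op_def inner_real_adjoint
      inner_real_adjoint[of "real_adjoint x", unfolded real_adjoint_simps, symmetric])

lemma abs_op_eq: "complex_linear x \<Longrightarrow> abs_op x = fun_calc sqrt (real_adjoint x o\<^sub>L x)"
  by (simp add: abs_op_def adjoint_op_eq)

lemma nonneg_abs_op: "complex_linear x \<Longrightarrow> nonneg_op (abs_op x)"
  unfolding abs_op_eq by (intro nonneg_fun_calc nonneg_op_gram continuous_intros) auto

lemma abs_op_square: "complex_linear x \<Longrightarrow> abs_op x o\<^sub>L abs_op x = real_adjoint x o\<^sub>L x"
  unfolding abs_op_eq by (intro fun_calc_sqrt_compose nonneg_op_gram)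

lemma inner_abs_op_square:
  assumes "complex_linear x"
  shows "inner v (abs_op x (abs_op x v)) = (norm (x v))\<^sup>2"
proof -
  have "abs_op x (abs_op x v) = real_adjoint x (x v)"
    using abs_op_square[OF assms] by (metis blinfun_apply_blinfun_compose)
  then show ?thesis
    by (simp add: power2_norm_eq_inner) (metis inner_commute inner_real_adjoint)
qed

lemma norm_abs_op_apply:
  assumes "complex_linear x"
  shows "norm (abs_op x v) = norm (x v)"
proof -
  have "(norm (abs_op x v))\<^sup>2 = (norm (x v))\<^sup>2"
    using nonneg_abs_op[OF assms] inner_abs_op_square[OF assms, of v]
    by (simp add: nonneg_op_def symmetric_op_def power2_norm_eq_inner)
  then show ?thesis by (simp add: power2_eq_iff_nonneg)
qed

lemma norm_abs_op: "complex_linear x \<Longrightarrow> norm (abs_op x) = norm x"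
  by (simp add: norm_blinfun.rep_eq onorm_def norm_abs_op_apply)

lemma fun_calc_cmult:
  assumes A: "nonneg_op A" and f: "continuous_on {0..norm A} f"
  shows "fun_calc (\<lambda>t. c * f t) A = c *\<^sub>R fun_calc f A"
proof -
  obtain q :: "nat \<Rightarrow> real poly" where q: "uniform_limit {0..norm A} (\<lambda>k. poly (q k)) f sequentially"
    using uniform_poly_approx[OF f] .
  have "uniform_limit {0..norm A} (\<lambda>k t. c * poly (q k) t) (\<lambda>t. c * f t) sequentially"
    by (intro bounded_linear.uniform_limit[OF bounded_linear_mult_right] q)
  then have "uniform_limit {0..norm A} (\<lambda>k. poly (Polynomial.smult c (q k))) (\<lambda>t. c * f t) sequentially"
    by (simp add: poly_smult[abs_def])
  then have "(\<lambda>k. poly_op (Polynomial.smult c (q k)) A) \<longlonglongrightarrow> fun_calc (\<lambda>t. c * f t) A"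
    by (intro fun_calc_tendsto[OF A] continuous_intros f)
  moreover have "(\<lambda>k. poly_op (Polynomial.smult c (q k)) A) \<longlonglongrightarrow> c *\<^sub>R fun_calc f A"
    unfolding poly_op_smult by (intro tendsto_intros fun_calc_tendsto[OF A f q])
  ultimately show ?thesis using LIMSEQ_unique by blast
qed

lemma schatten_trace_eq:
  "schatten_trace p x
    = (\<Sum>n. ennreal (inner (unit_vec n) (fun_calc (\<lambda>t. t powr p) (abs_op x) (unit_vec n))))"
  by (simp add: schatten_trace_def pos_trace_def inner_ell2_def)

text \<open>Cauchy-Schwarz for the expansion of \<open>v\<close> in unit vectors, first for partial
  sums and then in the limit.\<close>

lemma norm_le_hilbert_schmidt:
  assumes x: "complex_linear x" and s: "summable (\<lambda>n. (norm (x (unit_vec n)))\<^sup>2)"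
  shows "norm x \<le> sqrt (\<Sum>n. (norm (x (unit_vec n)))\<^sup>2)"
proof (rule norm_blinfun_bound)
  fix v
  let ?s = "\<Sum>n. (norm (x (unit_vec n)))\<^sup>2"
  show "norm (x v) \<le> sqrt ?s * norm v"
  proof (rule tendsto_upperbound)
    show "(\<lambda>N. norm (x (partial_vec (coord v) N))) \<longlonglongrightarrow> norm (x v)"
      by (intro tendsto_intros partial_vec_tendsto)
    have "norm (x (partial_vec (coord v) N)) \<le> sqrt ?s * norm v" for N
    proof -
      have "x (partial_vec (coord v) N) = (\<Sum>n<N. scaleC (coord v n) (x (unit_vec n)))"
        using x by (simp add: partial_vec_def blinfun.sum_right complex_linear_def)
      also have "norm \<dots> \<le> (\<Sum>n<N. \<bar>cmod (coord v n)\<bar> * \<bar>norm (x (unit_vec n))\<bar>)"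
        by (rule order_trans[OF norm_sum]) (simp add: norm_scaleC)
      also have "\<dots> \<le> L2_set (\<lambda>n. cmod (coord v n)) {..<N} * L2_set (\<lambda>n. norm (x (unit_vec n))) {..<N}"
        by (rule L2_set_mult_ineq)
      also have "\<dots> \<le> norm v * sqrt ?s"
      proof (intro mult_mono)
        have "(\<Sum>n<N. (cmod (coord v n))\<^sup>2) \<le> (norm v)\<^sup>2"
          unfolding norm_ell2_sum by (rule sum_le_suminf[OF coord_summable]) auto
        then show "L2_set (\<lambda>n. cmod (coord v n)) {..<N} \<le> norm v"
          unfolding L2_set_def by (intro real_le_lsqrt) (auto simp: sum_nonneg)
        show "L2_set (\<lambda>n. norm (x (unit_vec n))) {..<N} \<le> sqrt ?s"
          unfolding L2_set_def by (intro real_sqrt_le_mono sum_le_suminf[OF s]) auto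
      qed (auto simp: L2_set_nonneg)
      finally show ?thesis by (simp add: mult.commute)
    qed
    then show "\<forall>\<^sub>F N in sequentially. norm (x (partial_vec (coord v) N)) \<le> sqrt ?s * norm v"
      by simp
  qed simp
qed (use s in \<open>simp add: suminf_nonneg\<close>)

text \<open>On \<open>[0, M]\<close> with \<open>M = norm x\<close> one has
  \<open>t^2 \<le> M^(2 - p) t^p\<close>, so the squared Hilbert-Schmidt norm \<open>s2\<close> is
  at most \<open>M^(2 - p)\<close> times the Schatten trace. As \<open>M \<le> sqrt s2\<close>,
  cancelling \<open>s2^(1 - p/2)\<close> leaves a comparison with constant 1.\<close>

lemma hilbert_schmidt_le_schatten:
  assumes p: "1 \<le> p" "p \<le> 2" and x: "x \<in> schatten_class p"
  shows "summable (\<lambda>n. (norm (x (unit_vec n)))\<^sup>2)"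
    and "sqrt (\<Sum>n. (norm (x (unit_vec n)))\<^sup>2) \<le> schatten_norm p x"
proof -
  have lin: "complex_linear x" and fin: "schatten_trace p x < \<infinity>"
    using x by (auto simp: schatten_class_def)
  define T M a where "T = abs_op x" and "M = norm x"
    and "a n = inner (unit_vec n) (fun_calc (\<lambda>t. t powr p) (abs_op x) (unit_vec n))" for n
  have T: "nonneg_op T" and normT: "norm T = M"
    using nonneg_abs_op[OF lin] norm_abs_op[OF lin] by (auto simp: T_def M_def)
  have cont: "continuous_on {0..norm T} (\<lambda>t. t powr p)"
    using p by (intro continuous_on_powr' continuous_intros) auto
  have a0: "0 \<le> a n" for n
    using nonneg_fun_calc[OF T cont] by (simp add: a_def T_def nonneg_op_def)
  have tr: "schatten_trace p x = (\<Sum>n. ennreal (a n))"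
    by (simp add: schatten_trace_eq a_def)
  then have sa: "summable a"
    using fin a0 by (intro summable_suminf_not_top) auto
  define \<tau> where "\<tau> = (\<Sum>n. a n)"
  have \<tau>: "schatten_trace p x = ennreal \<tau>" "0 \<le> \<tau>"
    using tr suminf_ennreal2[OF a0 sa] suminf_nonneg[OF sa a0] by (auto simp: \<tau>_def)
  have le: "(norm (x (unit_vec n)))\<^sup>2 \<le> M powr (2 - p) * a n" for n
  proof -
    have "inner (unit_vec n) (fun_calc (\<lambda>t. t\<^sup>2) T (unit_vec n))
        \<le> inner (unit_vec n) (fun_calc (\<lambda>t. M powr (2 - p) * t powr p) T (unit_vec n))"
    proof (rule fun_calc_mono[OF T])
      fix t assume t: "0 \<le> t" "t \<le> norm T"
      show "t\<^sup>2 \<le> M powr (2 - p) * t powr p"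
      proof (cases "t = 0")
        case False
        then have "t\<^sup>2 = t powr (2 - p) * t powr p"
          using t by (simp flip: powr_add powr_numeral)
        also have "\<dots> \<le> M powr (2 - p) * t powr p"
          using t p normT by (intro mult_right_mono powr_mono2) auto
        finally show ?thesis .
      qed simp
    qed (intro continuous_intros cont)+
    also have "fun_calc (\<lambda>t. t\<^sup>2) T = T o\<^sub>L T"
      by (subst fun_calc_poly[OF T, of _ "[:0, 1:] * [:0, 1:]"])
        (simp_all only: poly_op_mult, auto simp: power2_eq_square intro: blinfun_eqI)
    also have "fun_calc (\<lambda>t. M powr (2 - p) * t powr p) T = M powr (2 - p) *\<^sub>R fun_calc (\<lambda>t. t powr p) T"
      by (rule fun_calc_cmult[OF T cont])
    finally show ?thesis
      using inner_abs_op_square[OF lin] by (simp add: a_def T_def blinfun.bilinear_simps)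
  qed
  show s: "summable (\<lambda>n. (norm (x (unit_vec n)))\<^sup>2)"
    by (rule summable_comparison_test'[OF summable_mult[OF sa]]) (use le in simp)
  define s2 where "s2 = (\<Sum>n. (norm (x (unit_vec n)))\<^sup>2)"
  have s2: "0 \<le> s2" unfolding s2_def by (rule suminf_nonneg[OF s]) simp
  have s2_le: "s2 \<le> M powr (2 - p) * \<tau>"
    unfolding s2_def \<tau>_def suminf_mult[OF sa, symmetric]
    by (intro suminf_le le s summable_mult sa)
  have M: "0 \<le> M" "M \<le> sqrt s2"
    using norm_le_hilbert_schmidt[OF lin s] by (auto simp: M_def s2_def)
  have "sqrt s2 \<le> \<tau> powr (1 / p)"
  proof (cases "s2 = 0")
    case False
    then have pos: "s2 > 0" using s2 by simp
    have "s2 \<le> sqrt s2 powr (2 - p) * \<tau>"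
      using s2_le M p \<tau>(2) by (intro order_trans[OF s2_le] mult_right_mono powr_mono2) auto
    also have "sqrt s2 powr (2 - p) = s2 powr (1 - p / 2)"
      using pos by (simp add: powr_half_sqrt[symmetric] powr_powr field_simps)
    finally have "s2 powr (p / 2) * s2 powr (1 - p / 2) \<le> \<tau> * s2 powr (1 - p / 2)"
      using pos by (simp add: powr_add[symmetric] mult.commute)
    then have "s2 powr (p / 2) \<le> \<tau>" using pos by simp
    then have "(s2 powr (p / 2)) powr (1 / p) \<le> \<tau> powr (1 / p)"
      using p by (intro powr_mono2) auto
    then show ?thesis using p pos by (simp add: powr_powr powr_half_sqrt)
  qed simp
  then show "sqrt (\<Sum>n. (norm (x (unit_vec n)))\<^sup>2) \<le> schatten_norm p x"
    using \<tau> by (simp add: schatten_norm_def s2_def)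
qed

text \<open>The kernel condition makes the \<open>p\<close>-th power of \<open>abs_op x\<close>
  equal to its compression to the span of \<open>C\<close>, where it is at most
  \<open>norm x powr p\<close>; the trace of the projection to that span is then estimated by
  \<open>card C\<close>.\<close>

lemma schatten_finite_rank:
  assumes p: "0 < p" and x: "complex_linear x" and C: "finite C"
    and orth: "\<And>c d. c \<in> C \<Longrightarrow> d \<in> C \<Longrightarrow> inner c d = (if c = d then 1 else 0)"
    and ker: "\<And>v. (\<And>c. c \<in> C \<Longrightarrow> inner c v = 0) \<Longrightarrow> x v = 0"
  shows "x \<in> schatten_class p" and "schatten_norm p x \<le> norm x * real (card C) powr (1 / p)"
proof -
  define T S where "T = abs_op x" and "S = fun_calc (\<lambda>t. t powr p) T"
  define P where "P v = (\<Sum>c\<in>C. inner c v *\<^sub>R c)" for v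
  have T: "nonneg_op T" and normT: "norm T = norm x"
    using nonneg_abs_op[OF x] norm_abs_op[OF x] by (auto simp: T_def)
  have cont: "continuous_on {0..norm T} (\<lambda>t. t powr p)"
    using p by (intro continuous_on_powr' continuous_intros) auto
  have S: "nonneg_op S" unfolding S_def by (rule nonneg_fun_calc[OF T cont]) simp
  have SP: "S v = S (P v)" for v
  proof -
    have "inner c (v - P v) = 0" if "c \<in> C" for c
      using C that orth[OF that]
      by (simp add: P_def inner_diff_right inner_sum_right if_distrib[of "\<lambda>r. _ * r"] cong: if_cong)
    then have "T (v - P v) = 0"
      using ker norm_abs_op_apply[OF x, of "v - P v"] by (simp add: T_def)
    then have "S (v - P v) = 0"
      unfolding S_def by (intro fun_calc_kernel[OF T cont]) (use p in auto)
    then show ?thesis by (simp add: blinfun.bilinear_simps)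
  qed
  have normP: "(norm (P v))\<^sup>2 = (\<Sum>c\<in>C. (inner c v)\<^sup>2)" for v
    unfolding power2_norm_eq_inner P_def inner_sum_left inner_sum_right
    using C by (intro sum.cong)
      (auto simp: orth power2_eq_square if_distrib[of "\<lambda>r. _ * r"] cong: if_cong)
  define a where "a n = inner (unit_vec n) (S (unit_vec n))" for n
  have a0: "0 \<le> a n" for n using S by (simp add: a_def nonneg_op_def)
  have a: "a n \<le> norm x powr p * (\<Sum>c\<in>C. (cmod (coord c n))\<^sup>2)" for n
  proof -
    let ?e = "unit_vec n"
    have "a n = inner (S (P ?e)) (P ?e)"
      using S SP[of ?e] by (metis a_def nonneg_op_def symmetric_op_def)
    also have "\<dots> = inner (P ?e) (S (P ?e))" by (rule inner_commute)
    also have "\<dots> \<le> norm x powr p * (norm (P ?e))\<^sup>2"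
      unfolding S_def by (rule fun_calc_le_bound[OF T cont]) (use normT p in \<open>auto intro: powr_mono2\<close>)
    \<comment> \<open>\<open>C\<close> is orthonormal for the real inner product, so
      \<open>inner c\<close> sees only the real part of a coordinate. Bounding it by the modulus
      makes the sum over \<open>n\<close> equal to \<open>(norm c)^2 = 1\<close>.\<close>
    also have "(norm (P ?e))\<^sup>2 \<le> (\<Sum>c\<in>C. (cmod (coord c n))\<^sup>2)"
      unfolding normP
      by (intro sum_mono) (simp add: inner_commute[of _ ?e] inner_unit_vec cmod_power2)
    finally show ?thesis by (simp add: mult_left_mono)
  qed
  have sC: "summable (\<lambda>n. \<Sum>c\<in>C. (cmod (coord c n))\<^sup>2)"
    by (intro summable_sum coord_summable)
  have "(\<Sum>n. \<Sum>c\<in>C. (cmod (coord c n))\<^sup>2) = (\<Sum>c\<in>C. (norm c)\<^sup>2)"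
    unfolding norm_ell2_sum by (intro suminf_sum coord_summable)
  also have "\<dots> = card C"
    by (simp add: power2_norm_eq_inner orth)
  finally have cardC: "(\<Sum>n. \<Sum>c\<in>C. (cmod (coord c n))\<^sup>2) = card C" .
  have sa: "summable a"
    by (rule summable_comparison_test'[OF summable_mult[OF sC]]) (use a a0 in simp)
  have tr: "schatten_trace p x = ennreal (\<Sum>n. a n)"
    using suminf_ennreal2[OF a0 sa] by (simp add: schatten_trace_eq a_def S_def T_def)
  show "x \<in> schatten_class p" using x tr by (simp add: schatten_class_def)
  have "(\<Sum>n. a n) \<le> norm x powr p * card C"
    unfolding cardC[symmetric] suminf_mult[OF sC, symmetric]
    by (intro suminf_le a sa summable_mult sC)
  then have "(\<Sum>n. a n) powr (1 / p) \<le> (norm x powr p * card C) powr (1 / p)"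
    using p suminf_nonneg[OF sa a0] by (intro powr_mono2) auto
  also have "\<dots> = norm x * real (card C) powr (1 / p)"
    using p by (simp add: powr_mult powr_powr)
  finally show "schatten_norm p x \<le> norm x * real (card C) powr (1 / p)"
    using suminf_nonneg[OF sa a0] by (simp add: schatten_norm_def tr)
qed

text \<open>\<open>u - 1\<close> commutes with its adjoint, so both have the same absolute
  value.\<close>

lemma schatten_unitary_adjoint:
  assumes "u \<in> carrier (schatten_unitary_group p)"
  shows "real_adjoint u \<in> carrier (schatten_unitary_group p)"
proof -
  have u: "unitary_op u" "u - id_blinfun \<in> schatten_class p"
    using assms by (auto simp: schatten_unitary_group_def)
  then have lin: "complex_linear u" by (simp add: unitary_op_eq)
  have lin': "complex_linear (u - id_blinfun)" "complex_linear (real_adjoint u - id_blinfun)"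
    by (intro complex_linear_simps lin complex_linear_real_adjoint)+
  have "real_adjoint (real_adjoint u - id_blinfun) o\<^sub>L (real_adjoint u - id_blinfun)
      = real_adjoint (u - id_blinfun) o\<^sub>L (u - id_blinfun)"
    by (intro blinfun_eqI)
      (simp add: real_adjoint_simps blinfun.bilinear_simps unitary_op_apply[OF u(1)])
  then have "abs_op (real_adjoint u - id_blinfun) = abs_op (u - id_blinfun)"
    using lin' by (simp add: abs_op_eq)
  then have "real_adjoint u - id_blinfun \<in> schatten_class p"
    using u(2) lin'(2) by (simp add: schatten_class_def schatten_trace_def)
  then show ?thesis using unitary_op_adjoint[OF u(1)] by (simp add: schatten_unitary_group_def)
qed

text \<open>The definite description is evaluated directly from unitarity, as
  \<open>subgroup\<close> makes no claim that the ambient structure is a group.\<close>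

lemma inv_schatten_unitary:
  assumes "u \<in> carrier (schatten_unitary_group p)"
  shows "inv\<^bsub>schatten_unitary_group p\<^esub> u = real_adjoint u"
proof -
  have u: "unitary_op u" using assms by (simp add: schatten_unitary_group_def)
  show ?thesis
    unfolding m_inv_def
  proof (rule the_equality)
    show "real_adjoint u \<in> carrier (schatten_unitary_group p) \<and>
        u \<otimes>\<^bsub>schatten_unitary_group p\<^esub> real_adjoint u = \<one>\<^bsub>schatten_unitary_group p\<^esub> \<and>
        real_adjoint u \<otimes>\<^bsub>schatten_unitary_group p\<^esub> u = \<one>\<^bsub>schatten_unitary_group p\<^esub>"
      using schatten_unitary_adjoint[OF assms] u
      by (simp add: schatten_unitary_group_def unitary_op_eq)
    fix v assume "v \<in> carrier (schatten_unitary_group p) \<and>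
        u \<otimes>\<^bsub>schatten_unitary_group p\<^esub> v = \<one>\<^bsub>schatten_unitary_group p\<^esub> \<and>
        v \<otimes>\<^bsub>schatten_unitary_group p\<^esub> u = \<one>\<^bsub>schatten_unitary_group p\<^esub>"
    then have "u o\<^sub>L v = id_blinfun" by (simp add: schatten_unitary_group_def)
    then have "u (v x) = x" for x by (metis blinfun_apply_blinfun_compose blinfun_apply_id_blinfun id_apply)
    then show "v = real_adjoint u"
      by (intro blinfun_eqI) (metis unitary_op_apply(1)[OF u])
  qed
qed

section \<open>The action on Hilbert-Schmidt operators\<close>

text \<open>A finite basis of \<open>V\<close> with dual functionals that are bounded on the whole
  space, so that summing \<open>p k v *\<^sub>R Y k\<close> is a bounded projection onto
  \<open>V\<close>.\<close>

definition biorthogonal ::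
    "'a::real_normed_vector set \<Rightarrow> nat \<Rightarrow> (nat \<Rightarrow> 'a) \<Rightarrow> (nat \<Rightarrow> 'a \<Rightarrow> real) \<Rightarrow> bool"
  where "biorthogonal V n Y p \<longleftrightarrow> (\<forall>k<n. Y k \<in> V \<and> bounded_linear (p k)) \<and>
    (\<forall>j<n. \<forall>k<n. p k (Y j) = (if j = k then 1 else 0)) \<and> (\<forall>v\<in>V. (\<Sum>k<n. p k v *\<^sub>R Y k) = v)"

lemma biorthogonalD:
  assumes "biorthogonal V n Y p"
  shows "k < n \<Longrightarrow> Y k \<in> V" and "k < n \<Longrightarrow> bounded_linear (p k)"
    and "\<lbrakk>j < n; k < n\<rbrakk> \<Longrightarrow> p k (Y j) = (if j = k then 1 else 0)"
    and "v \<in> V \<Longrightarrow> (\<Sum>k<n. p k v *\<^sub>R Y k) = v"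
  using assms unfolding biorthogonal_def by blast+

text \<open>Finite dimension enters as a finite set of bounded functionals separating the points of
  \<open>V\<close>. The induction restricts to the kernel of one functional \<open>q\<close>; if
  \<open>q\<close> is nonzero on \<open>V\<close>, it becomes dual to a vector \<open>y\<close> with
  \<open>q y = 1\<close>, and the earlier functionals are composed with
  \<open>v \<mapsto> v - q v *\<^sub>R y\<close>.\<close>

lemma biorthogonal_basis:
  fixes V :: "'a::real_normed_vector set" and Q :: "('a \<Rightarrow> real) set"
  assumes "finite Q" and "subspace V" and "\<And>q. q \<in> Q \<Longrightarrow> bounded_linear q"
    and "\<And>v. v \<in> V \<Longrightarrow> (\<And>q. q \<in> Q \<Longrightarrow> q v = 0) \<Longrightarrow> v = 0"
  shows "\<exists>n Y p. biorthogonal V n Y p"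
  using assms
proof (induction Q arbitrary: V rule: finite_induct)
  case empty
  then show ?case by (intro exI[of _ 0]) (auto simp: biorthogonal_def)
next
  case (insert q Q)
  interpret q: bounded_linear q using insert.prems by simp
  define V' where "V' = {v \<in> V. q v = 0}"
  have V': "subspace V'"
    using insert.prems(1) by (auto simp: V'_def subspace_def q.add q.scaleR)
  have "\<exists>n Y p. biorthogonal V' n Y p"
  proof (rule insert.IH[OF V'])
    show "v = 0" if "v \<in> V'" "\<And>q. q \<in> Q \<Longrightarrow> q v = 0" for v
      using that by (intro insert.prems(3)) (auto simp: V'_def)
  qed (use insert.prems(2) in blast)
  then obtain n Y p where basis: "biorthogonal V' n Y p" by blast
  note Y = biorthogonalD(1)[OF basis] and p = biorthogonalD(2)[OF basis]
    and pY = biorthogonalD(3)[OF basis] and exp = biorthogonalD(4)[OF basis]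
  show ?case
  proof (cases "\<forall>v\<in>V. q v = 0")
    case True
    then have VV: "V' = V" by (auto simp: V'_def)
    from basis show ?thesis unfolding VV by blast
  next
    case False
    then obtain y0 where y0: "y0 \<in> V" "q y0 \<noteq> 0" by blast
    define y where "y = (1 / q y0) *\<^sub>R y0"
    have y: "y \<in> V" "q y = 1"
      using y0 insert.prems(1) by (auto simp: y_def q.scaleR subspace_scale)
    define p' where "p' k = (if k < n then (\<lambda>v. p k (v - q v *\<^sub>R y)) else q)" for k
    define Y' where "Y' k = (if k < n then Y k else y)" for k
    have bl: "bounded_linear (\<lambda>v. v - q v *\<^sub>R y)"
      by (intro bounded_linear_sub bounded_linear_ident bounded_linear_compose[OF bounded_linear_scaleR_left]
          q.bounded_linear_axioms)
    have "bounded_linear (p' k)" if "k < Suc n" for k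
      using bounded_linear_compose[OF p[of k] bl] by (simp add: p'_def q.bounded_linear_axioms)
    moreover have "Y' k \<in> V" if "k < Suc n" for k
      using Y y by (auto simp: Y'_def V'_def)
    moreover have "p' k (Y' j) = (if j = k then 1 else 0)" if "j < Suc n" "k < Suc n" for j k
    proof -
      have "p k 0 = 0" if "k < n" for k
        using p[OF that] linear_0 bounded_linear.linear by blast
      then show ?thesis
        using that pY[of j k] Y[of j] y by (auto simp: p'_def Y'_def V'_def less_Suc_eq)
    qed
    moreover have "(\<Sum>k<Suc n. p' k v *\<^sub>R Y' k) = v" if v: "v \<in> V" for v
    proof -
      have "v - q v *\<^sub>R y \<in> V'"
        using v y insert.prems(1) by (auto simp: V'_def q.diff q.scaleR subspace_diff subspace_scale)
      note e = exp[OF this]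
      have "(\<Sum>k<Suc n. p' k v *\<^sub>R Y' k)
          = (\<Sum>k<n. p k (v - q v *\<^sub>R y) *\<^sub>R Y k) + q v *\<^sub>R y"
        by (simp add: p'_def Y'_def)
      also have "\<dots> = v"
        by (simp only: e diff_add_cancel)
      finally show ?thesis .
    qed
    ultimately have "biorthogonal V (Suc n) Y' p'" unfolding biorthogonal_def by blast
    then show ?thesis by blast
  qed
qed

section \<open>Hilbert-Schmidt operators as square-summable sequences of columns\<close>

definition column :: "ell2 \<Rightarrow> nat \<Rightarrow> ell2"
  where "column x n = Abs_ell2 (\<lambda>m. coord x (prod_encode (n, m)))"

lemma coord_column: "coord (column x n) m = coord x (prod_encode (n, m))"
proof -
  have "summable ((\<lambda>k. (cmod (coord x k))\<^sup>2) \<circ> (\<lambda>m. prod_encode (n, m)))"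
    by (rule summable_reindex[OF coord_summable]) (auto simp: inj_on_def)
  then show ?thesis by (simp add: column_def Abs_ell2_inverse o_def)
qed

lemma coord_eq_column:
  "coord x k = coord (column x (fst (prod_decode k))) (snd (prod_decode k))"
  by (simp add: coord_column)

lemma column_eqI: "(\<And>n. column x n = column y n) \<Longrightarrow> x = y"
  by (rule ell2_eqI, subst (1 2) coord_eq_column) simp

lemma column_simps:
  "column (x + y) n = column x n + column y n"
  "column (x - y) n = column x n - column y n"
  "column (r *\<^sub>R x) n = r *\<^sub>R column x n"
  by (rule ell2_eqI; simp add: coord_column coord_simps)+

lemma ennreal_norm_sum: "(\<Sum>n. ennreal ((cmod (coord x n))\<^sup>2)) = ennreal ((norm x)\<^sup>2)"
  by (simp add: norm_ell2_sum suminf_ennreal2 coord_summable)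

text \<open>The double sum is rearranged in the extended nonnegative reals; summability is read off
  afterwards from finiteness of the value.\<close>

lemma ennreal_norm_column: "(\<Sum>n. ennreal ((norm (column x n))\<^sup>2)) = ennreal ((norm x)\<^sup>2)"
proof -
  have "(\<Sum>i. case prod_decode i of (n, m) \<Rightarrow> ennreal ((cmod (coord x (prod_encode (n, m))))\<^sup>2))
      = (\<Sum>n. ennreal ((norm (column x n))\<^sup>2))"
    by (rule suminf_ennreal_2dimen) (simp add: coord_column flip: ennreal_norm_sum)
  also have "(\<lambda>i. case prod_decode i of (n, m) \<Rightarrow> ennreal ((cmod (coord x (prod_encode (n, m))))\<^sup>2))
      = (\<lambda>i. ennreal ((cmod (coord x i))\<^sup>2))"
    by (simp add: case_prod_beta)
  finally show ?thesis by (simp add: ennreal_norm_sum)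
qed

lemma summable_norm_column: "summable (\<lambda>n. (norm (column x n))\<^sup>2)"
  by (rule summable_suminf_not_top) (simp_all add: ennreal_norm_column)

lemma suminf_norm_column: "(\<Sum>n. (norm (column x n))\<^sup>2) = (norm x)\<^sup>2"
proof -
  have "ennreal (\<Sum>n. (norm (column x n))\<^sup>2) = ennreal ((norm x)\<^sup>2)"
    using ennreal_norm_column[of x]
    by (subst (asm) suminf_ennreal2) (simp_all add: summable_norm_column)
  then show ?thesis
    using suminf_nonneg[OF summable_norm_column[of x]] by (simp only: ennreal_inj zero_le_power2)
qed

definition from_columns :: "(nat \<Rightarrow> ell2) \<Rightarrow> ell2"
  where "from_columns f = Abs_ell2 (\<lambda>i. case prod_decode i of (n, m) \<Rightarrow> coord (f n) m)"

lemma column_from_columns: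
  assumes "summable (\<lambda>n. (norm (f n))\<^sup>2)"
  shows "column (from_columns f) n = f n"
proof -
  let ?a = "\<lambda>i. case prod_decode i of (n, m) \<Rightarrow> coord (f n) m"
  have "(\<Sum>i. case prod_decode i of (n, m) \<Rightarrow> ennreal ((cmod (coord (f n) m))\<^sup>2))
      = (\<Sum>n. ennreal ((norm (f n))\<^sup>2))"
    by (rule suminf_ennreal_2dimen) (simp flip: ennreal_norm_sum)
  moreover have "(\<lambda>i. case prod_decode i of (n, m) \<Rightarrow> ennreal ((cmod (coord (f n) m))\<^sup>2))
      = (\<lambda>i. ennreal ((cmod (?a i))\<^sup>2))"
    by (auto simp: fun_eq_iff split: prod.split)
  ultimately have "(\<Sum>i. ennreal ((cmod (?a i))\<^sup>2)) = (\<Sum>n. ennreal ((norm (f n))\<^sup>2))"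
    by (simp only:)
  also have "\<dots> = ennreal (\<Sum>n. (norm (f n))\<^sup>2)"
    by (rule suminf_ennreal2[OF _ assms]) simp
  finally have "(\<Sum>i. ennreal ((cmod (?a i))\<^sup>2)) \<noteq> top_class.top"
    by (simp only: ennreal_neq_top not_False_eq_True)
  then have "summable (\<lambda>i. (cmod (?a i))\<^sup>2)"
    by (rule summable_suminf_not_top[rotated]) simp
  then have "coord (from_columns f) = ?a"
    by (simp add: from_columns_def Abs_ell2_inverse)
  then show ?thesis by (intro ell2_eqI) (simp add: coord_column)
qed

definition apply_columns :: "(ell2 \<Rightarrow>\<^sub>L ell2) \<Rightarrow> ell2 \<Rightarrow> ell2"
  where "apply_columns g x = from_columns (\<lambda>n. g (column x n))"

lemma norm_blinfun_square: "(norm (g v))\<^sup>2 \<le> (norm g)\<^sup>2 * (norm v)\<^sup>2" for g :: "'a::real_normed_vector \<Rightarrow>\<^sub>L 'b::real_normed_vector"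
  using power_mono[OF norm_blinfun[of g v], of 2] by (simp add: power_mult_distrib)

lemma summable_apply_columns: "summable (\<lambda>n. (norm (blinfun_apply g (column x n)))\<^sup>2)"
  by (rule summable_comparison_test'[OF summable_mult[OF summable_norm_column[of x], of "(norm g)\<^sup>2"]])
    (simp add: norm_blinfun_square)

lemma column_apply_columns: "column (apply_columns g x) n = g (column x n)"
  unfolding apply_columns_def by (rule column_from_columns[OF summable_apply_columns])

lemma norm_apply_columns: "norm (apply_columns g x) \<le> norm g * norm x"
proof -
  have "(norm (apply_columns g x))\<^sup>2 = (\<Sum>n. (norm (g (column x n)))\<^sup>2)"
    unfolding column_apply_columns[symmetric] by (rule suminf_norm_column[symmetric])
  also have "\<dots> \<le> (\<Sum>n. (norm g)\<^sup>2 * (norm (column x n))\<^sup>2)"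
    by (intro suminf_le summable_apply_columns summable_mult summable_norm_column norm_blinfun_square)
  also have "\<dots> = (norm g * norm x)\<^sup>2"
    by (simp add: suminf_mult summable_norm_column suminf_norm_column power_mult_distrib)
  finally show ?thesis by (rule power2_le_imp_le) simp
qed

text \<open>The space \<^typ>\<open>ell2\<close> itself serves as the Hilbert space of Hilbert-Schmidt operators, an operator being
  encoded by the sequence of its columns.\<close>

definition ell2_space :: "ell2 inner_space"
  where "ell2_space = \<lparr>carrier = UNIV, mult = undefined, one = undefined, zero = 0, add = (+),
    smult = scaleR, ip = inner\<rparr>"

lemma ell2_space_simps [simp]:
  "carrier ell2_space = UNIV" "zero ell2_space = 0" "add ell2_space = (+)"
  "smult ell2_space = scaleR" "ip ell2_space = inner"
  by (simp_all add: ell2_space_def)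

lemma ell2_space_hilbert:
  shows "real_hilbert_space ell2_space" and ip_dist_ell2: "ip_dist ell2_space = dist"
    and ip_topology_ell2: "ip_topology ell2_space = euclidean"
proof -
  have ag: "abelian_group ell2_space"
  proof (rule abelian_groupI)
    show "\<exists>y\<in>carrier ell2_space. y \<oplus>\<^bsub>ell2_space\<^esub> x = \<zero>\<^bsub>ell2_space\<^esub>" for x
      by (rule bexI[of _ "- x"]) auto
  qed (auto simp: algebra_simps)
  interpret A: abelian_group ell2_space by (rule ag)
  have neg: "\<ominus>\<^bsub>ell2_space\<^esub> x = - x" for x
    by (rule A.minus_equality) auto
  show d: "ip_dist ell2_space = dist"
    by (simp add: fun_eq_iff ip_dist_def a_minus_def neg dist_norm norm_eq_sqrt_inner)
  show "ip_topology ell2_space = euclidean"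
    by (simp add: ip_topology_def d)
  have "module real_ring ell2_space"
    by (rule moduleI[OF cring_real_ring ag]) (auto simp: algebra_simps)
  then show "real_hilbert_space ell2_space"
    by (intro real_hilbert_space.intro real_inner_space.intro real_inner_space_axioms.intro
        real_hilbert_space_axioms.intro)
      (auto simp: d inner_add_left complete_UNIV intro: inner_commute)
qed

section \<open>Topologies generated by a distance function\<close>

lemma topspace_metric_topology [simp]: "topspace (metric_topology M d) = M"
proof -
  have "openin (metric_topology M d) M"
    unfolding openin_metric_topology by (auto intro: gt_ex)
  moreover have "topspace (metric_topology M d) \<subseteq> M"
    using openin_topspace[of "metric_topology M d"] unfolding openin_metric_topology by blast
  ultimately show ?thesis using openin_subset by blast
qed

lemma continuous_map_metric_topology:
  fixes f :: "'a \<Rightarrow> 'b::metric_space"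
  assumes "\<And>x y. x \<in> M \<Longrightarrow> y \<in> M \<Longrightarrow> dist (f x) (f y) \<le> d x y"
  shows "continuous_map (metric_topology M d) euclidean f"
  unfolding continuous_map_def topspace_metric_topology openin_metric_topology
proof (intro conjI allI impI ballI)
  fix U x assume U: "openin euclidean U" and x: "x \<in> {x \<in> M. f x \<in> U}"
  then obtain r where r: "r > 0" "ball (f x) r \<subseteq> U"
    using open_contains_ball[of U] by auto
  have "f y \<in> U" if "y \<in> M" "d x y < r" for y
    using assms[of x y] that x by (intro subsetD[OF r(2)]) auto
  then show "\<exists>r>0. {y \<in> M. d x y < r} \<subseteq> {x \<in> M. f x \<in> U}"
    using r(1) by (intro exI[of _ r]) auto
qed auto

text \<open>For an arbitrary function \<open>d\<close> the balls need not be open, so a relatively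
  open \<open>V\<close> is extended to \<open>V \<union> (M - G)\<close>; closedness of
  \<open>G\<close> makes this set open.\<close>

lemma subtopology_metric_topology:
  assumes "closedin (metric_topology M d) G"
  shows "subtopology (metric_topology M d) G = metric_topology G d"
proof -
  have GM: "G \<subseteq> M" using closedin_subset[OF assms] by simp
  have MG: "\<exists>r>0. {y \<in> M. d x y < r} \<subseteq> M - G" if "x \<in> M - G" for x
    using assms that unfolding closedin_def openin_metric_topology by simp
  show ?thesis
    unfolding topology_eq openin_subtopology
  proof (intro allI iffI)
    fix V
    assume "\<exists>U. openin (metric_topology M d) U \<and> V = U \<inter> G"
    then obtain U where U: "openin (metric_topology M d) U" "V = U \<inter> G" by blast
    have "\<exists>r>0. {y \<in> G. d x y < r} \<subseteq> V" if x: "x \<in> V" for x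
    proof -
      obtain r where "r > 0" "{y \<in> M. d x y < r} \<subseteq> U"
        using U x unfolding openin_metric_topology by blast
      then show ?thesis using U(2) GM by (intro exI[of _ r]) auto
    qed
    then show "openin (metric_topology G d) V"
      using U(2) unfolding openin_metric_topology by blast
  next
    fix V
    assume V: "openin (metric_topology G d) V"
    then have VG: "V \<subseteq> G" by (simp add: openin_metric_topology)
    have "\<exists>r>0. {y \<in> M. d x y < r} \<subseteq> V \<union> (M - G)" if x: "x \<in> V \<union> (M - G)" for x
    proof (cases "x \<in> V")
      case True
      then obtain r where "r > 0" "{y \<in> G. d x y < r} \<subseteq> V"
        using V unfolding openin_metric_topology by blast
      then show ?thesis by (intro exI[of _ r]) auto
    qed (use x MG in blast)
    then have "openin (metric_topology M d) (V \<union> (M - G))"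
      using VG GM unfolding openin_metric_topology by blast
    then show "\<exists>U. openin (metric_topology M d) U \<and> V = U \<inter> G"
      using VG by blast
  qed
qed

text \<open>The absolute value depends only on the adjoint of \<open>x\<close> composed with
  \<open>x\<close>, and in that product a unitary left factor cancels.\<close>

lemma schatten_trace_unitary_compose:
  assumes h: "unitary_op h" and x: "complex_linear x"
  shows "schatten_trace p (h o\<^sub>L x) = schatten_trace p x"
proof -
  have "complex_linear (h o\<^sub>L x)"
    using h x by (simp add: unitary_op_eq complex_linear_simps)
  moreover have "real_adjoint (h o\<^sub>L x) o\<^sub>L (h o\<^sub>L x) = real_adjoint x o\<^sub>L x"
    by (intro blinfun_eqI) (simp add: real_adjoint_simps unitary_op_apply[OF h])
  ultimately have "abs_op (h o\<^sub>L x) = abs_op x"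
    using x by (simp add: abs_op_eq)
  then show ?thesis by (simp add: schatten_trace_def)
qed

section \<open>Closed subgroups of the Schatten unitary group\<close>

locale schatten_subgroup =
  fixes p :: real and G :: "(ell2 \<Rightarrow>\<^sub>L ell2) set"
  assumes p: "1 \<le> p" "p \<le> 2"
    and subgroup: "subgroup G (schatten_unitary_group p)"
    and closed: "closedin (schatten_unitary_topology p) G"
begin

lemma G_subset: "G \<subseteq> carrier (schatten_unitary_group p)"
  using subgroup by (rule subgroup.subset)

lemma G_unitary: "g \<in> G \<Longrightarrow> unitary_op g"
  and G_schatten: "g \<in> G \<Longrightarrow> g - id_blinfun \<in> schatten_class p"
  using G_subset by (auto simp: schatten_unitary_group_def)

lemma G_complex_linear: "g \<in> G \<Longrightarrow> complex_linear g"
  using G_unitary by (simp add: unitary_op_eq)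

lemma G_mult: "g \<in> G \<Longrightarrow> h \<in> G \<Longrightarrow> g o\<^sub>L h \<in> G"
  using subgroup.m_closed[OF subgroup, of g h] by (simp add: schatten_unitary_group_def)

lemma G_one: "id_blinfun \<in> G"
  using subgroup.one_closed[OF subgroup] by (simp add: schatten_unitary_group_def)

lemma G_adjoint: "g \<in> G \<Longrightarrow> real_adjoint g \<in> G"
  using subgroup.m_inv_closed[OF subgroup, of g] inv_schatten_unitary G_subset by auto

text \<open>\<open>g - h = h (h^-1 g - 1)\<close>, and composing with a unitary on the left keeps
  the Schatten trace.\<close>

lemma G_diff:
  assumes "g \<in> G" "h \<in> G"
  shows "g - h \<in> schatten_class p"
proof -
  define u where "u = real_adjoint h o\<^sub>L g"
  have u: "u \<in> G" unfolding u_def by (intro G_mult G_adjoint assms)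
  have lin: "complex_linear (u - id_blinfun)"
    using G_schatten[OF u] by (simp add: schatten_class_def)
  have "g - h = h o\<^sub>L (u - id_blinfun)"
    by (intro blinfun_eqI) (simp add: u_def blinfun.bilinear_simps unitary_op_apply[OF G_unitary[OF assms(2)]])
  then show ?thesis
    using G_schatten[OF u] schatten_trace_unitary_compose[OF G_unitary[OF assms(2)] lin]
      complex_linear_simps(3)[OF G_complex_linear[OF assms(2)] lin]
    by (simp add: schatten_class_def)
qed

lemma G_topology:
  "subtopology (schatten_unitary_topology p) G = metric_topology G (\<lambda>u v. schatten_norm p (u - v))"
  using closed unfolding schatten_unitary_topology_def by (rule subtopology_metric_topology)

text \<open>The group acts on the Hilbert-Schmidt operators by \<open>x \<mapsto> g x + (g - 1)\<close>; a fixed point \<open>x\<close>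
  satisfies \<open>g (x + 1) = x + 1\<close>.\<close>

lemma fixed_columns:
  assumes FH: "property_FH ((schatten_unitary_group p)\<lparr>carrier := G\<rparr>)
      (subtopology (schatten_unitary_topology p) G)"
  obtains x where "\<And>g n. g \<in> G \<Longrightarrow> blinfun_apply g (column x n + unit_vec n) = column x n + unit_vec n"
proof -
  let ?U = "schatten_unitary_group p"
  let ?H = "?U\<lparr>carrier := G\<rparr>"
  let ?T = "metric_topology G (\<lambda>u v. schatten_norm p (u - v))"
  define b where "b g = from_columns (\<lambda>n. (g - id_blinfun) (unit_vec n))" for g :: "ell2 \<Rightarrow>\<^sub>L ell2"
  have colb: "column (b g) n = g (unit_vec n) - unit_vec n" if "g \<in> G" for g n
    unfolding b_def
    using column_from_columns[OF hilbert_schmidt_le_schatten(1)[OF p G_schatten[OF that]]]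
    by (simp add: blinfun.bilinear_simps)
  \<comment> \<open>Both estimates pass through the Hilbert-Schmidt norm of \<open>g - h\<close>,
    which lies between the operator norm and the Schatten norm.\<close>
  have b_diff: "norm (b g - b h) \<le> schatten_norm p (g - h)"
    and op_diff: "norm (g - h) \<le> norm (b g - b h)"
    if gh: "g \<in> G" "h \<in> G" for g h
  proof -
    note D = G_diff[OF gh]
    have "(norm (b g - b h))\<^sup>2 = (\<Sum>n. (norm ((g - h) (unit_vec n)))\<^sup>2)"
      by (subst suminf_norm_column[symmetric])
        (simp add: column_simps colb gh blinfun.bilinear_simps)
    then have eq: "norm (b g - b h) = sqrt (\<Sum>n. (norm ((g - h) (unit_vec n)))\<^sup>2)"
      by (simp add: real_sqrt_unique)
    show "norm (b g - b h) \<le> schatten_norm p (g - h)"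
      unfolding eq by (rule hilbert_schmidt_le_schatten(2)[OF p D])
    show "norm (g - h) \<le> norm (b g - b h)"
      unfolding eq using D
      by (intro norm_le_hilbert_schmidt hilbert_schmidt_le_schatten(1)[OF p D])
        (simp add: schatten_class_def)
  qed
  define \<alpha> where "\<alpha> g x = apply_columns g x + b g" for g x
  \<comment> \<open>Columnwise, \<open>\<alpha> g\<close> is multiplication by \<open>g\<close>
    conjugated with the shift by the identity, which is not Hilbert-Schmidt itself; the action law
    becomes immediate.\<close>
  have col: "column (\<alpha> g x) n = g (column x n + unit_vec n) - unit_vec n" if "g \<in> G" for g x n
    using colb[OF that] by (simp add: \<alpha>_def column_simps column_apply_columns blinfun.bilinear_simps)
  have \<alpha>_mult: "\<alpha> (g o\<^sub>L h) x = \<alpha> g (\<alpha> h x)" if "g \<in> G" "h \<in> G" for g h x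
    by (rule column_eqI) (simp add: col that G_mult)
  have \<alpha>_one: "\<alpha> id_blinfun x = x" for x
    by (rule column_eqI) (simp add: col G_one)
  have adj: "real_adjoint g o\<^sub>L g = id_blinfun" "g o\<^sub>L real_adjoint g = id_blinfun" if "g \<in> G" for g
    using G_unitary[OF that] by (auto simp: unitary_op_eq)
  have \<alpha>_adj: "\<alpha> (real_adjoint g) (\<alpha> g x) = x" "\<alpha> g (\<alpha> (real_adjoint g) x) = x" if "g \<in> G" for g x
    using that by (simp_all add: \<alpha>_mult[symmetric] G_adjoint adj \<alpha>_one)
  have \<alpha>_dist: "dist (\<alpha> g x) (\<alpha> g y) = dist x y" if "g \<in> G" for g x y
  proof -
    have "column (\<alpha> g x - \<alpha> g y) n = g (column (x - y) n)" for n
      using that by (simp add: col column_simps blinfun.bilinear_simps)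
    then have "(norm (\<alpha> g x - \<alpha> g y))\<^sup>2 = (norm (x - y))\<^sup>2"
      using norm_unitary_op_apply[OF G_unitary[OF that]]
        suminf_norm_column[of "\<alpha> g x - \<alpha> g y"] suminf_norm_column[of "x - y"] by simp
    then show ?thesis by (simp add: dist_norm power2_eq_iff_nonneg)
  qed
  have \<alpha>_affine: "\<alpha> g ((1 - t) *\<^sub>R x + t *\<^sub>R y) = (1 - t) *\<^sub>R \<alpha> g x + t *\<^sub>R \<alpha> g y" if "g \<in> G" for g t x y
    by (rule column_eqI)
      (simp add: col that column_simps blinfun.bilinear_simps algebra_simps)
  have bij: "\<alpha> g \<in> Bij UNIV" if "g \<in> G" for g
    unfolding Bij_def
    by (auto intro!: bij_betwI[where g = "\<alpha> (real_adjoint g)"] simp: \<alpha>_adj that)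
  interpret G: Group.group ?H
  proof (rule groupI)
    show "\<exists>y\<in>carrier ?H. y \<otimes>\<^bsub>?H\<^esub> x = \<one>\<^bsub>?H\<^esub>" if "x \<in> carrier ?H" for x
      using that by (intro bexI[of _ "real_adjoint x"])
        (auto simp: schatten_unitary_group_def adj G_adjoint)
  qed (auto simp: schatten_unitary_group_def G_mult G_one intro: blinfun_eqI)
  have "group_action ?H UNIV \<alpha>"
    unfolding group_action_def group_hom_def group_hom_axioms_def
  proof (intro conjI G.is_group group_BijGroup homI)
    show "\<alpha> (g \<otimes>\<^bsub>?H\<^esub> h) = \<alpha> g \<otimes>\<^bsub>BijGroup UNIV\<^esub> \<alpha> h" if "g \<in> carrier ?H" "h \<in> carrier ?H" for g h
      using that by (auto simp: BijGroup_def bij compose_def schatten_unitary_group_def \<alpha>_mult)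
  qed (simp add: BijGroup_def bij)
  moreover have "continuous_map (prod_topology ?T euclidean) euclidean (\<lambda>(g, x). \<alpha> g x)"
    unfolding mtopology_is_euclidean[symmetric] Met_TC.continuous_map_to_metric
    unfolding mtopology_is_euclidean
  proof (intro ballI allI impI)
    fix q :: "(ell2 \<Rightarrow>\<^sub>L ell2) \<times> ell2" and e :: real
    assume q: "q \<in> topspace (prod_topology ?T euclidean)" and e: "e > 0"
    obtain g x where gx: "q = (g, x)" "g \<in> G" using q by (cases q) auto
    have "continuous_map ?T euclidean b"
      by (intro continuous_map_metric_topology) (simp add: dist_norm b_diff)
    \<comment> \<open>At a fixed \<open>x\<close> the variation of \<open>\<alpha>\<close> is at
      most \<open>norm (b g - b h) * (norm x + 1)\<close>; the other half of \<open>e\<close> is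
      kept for moving \<open>x\<close>, where the action is isometric.\<close>
    define d where "d = e / (2 * (norm x + 1))"
    have d: "d > 0" using e by (simp add: d_def add_nonneg_pos)
    define U where "U = {h \<in> G. b h \<in> ball (b g) d}"
    have "openin ?T U"
      using openin_continuous_map_preimage[OF \<open>continuous_map ?T euclidean b\<close>, of "ball (b g) d"]
      by (simp add: U_def)
    then have "openin (prod_topology ?T euclidean) (U \<times> ball x (e / 2))"
      by (simp add: openin_prod_Times_iff)
    moreover have "q \<in> U \<times> ball x (e / 2)" using gx d e by (simp add: U_def)
    moreover have "dist (\<alpha> g x) (\<alpha> h y) < e" if "h \<in> U" "y \<in> ball x (e / 2)" for h y
    proof -
      have h: "h \<in> G" and hd: "norm (b g - b h) < d" using that(1) by (auto simp: U_def dist_norm)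
      have "\<alpha> g x - \<alpha> h x = apply_columns (g - h) x + (b g - b h)"
        by (rule column_eqI)
          (simp add: \<alpha>_def column_simps column_apply_columns blinfun.bilinear_simps)
      then have "dist (\<alpha> g x) (\<alpha> h x) \<le> norm (g - h) * norm x + norm (b g - b h)"
        using norm_triangle_ineq[of "apply_columns (g - h) x" "b g - b h"] norm_apply_columns[of "g - h" x]
        by (simp add: dist_norm)
      also have "\<dots> \<le> norm (b g - b h) * norm x + norm (b g - b h)"
        using op_diff[OF gx(2) h] by (intro add_mono mult_right_mono) auto
      also have "\<dots> = norm (b g - b h) * (norm x + 1)" by (simp add: algebra_simps)
      also have "\<dots> < d * (norm x + 1)"
        using hd by (intro mult_strict_right_mono) (auto simp: add_nonneg_pos)
      also have "\<dots> = e / 2"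
      proof -
        have half: "e / (2 * N) * N = e / 2" if "N > 0" for N :: real using that by simp
        show ?thesis unfolding d_def by (rule half) (simp add: add_nonneg_pos)
      qed
      finally have "dist (\<alpha> g x) (\<alpha> h x) < e / 2" .
      moreover have "dist (\<alpha> h x) (\<alpha> h y) < e / 2" using that(2) \<alpha>_dist[OF h] by simp
      ultimately show ?thesis using dist_triangle[of "\<alpha> g x" "\<alpha> h y" "\<alpha> h x"] by simp
    qed
    ultimately show "\<exists>U. openin (prod_topology ?T euclidean) U \<and> q \<in> U \<and>
        (\<forall>r\<in>U. (case r of (g, x) \<Rightarrow> \<alpha> g x) \<in> Met_TC.mball (case q of (g, x) \<Rightarrow> \<alpha> g x) e)"
      by (intro exI[of _ "U \<times> ball x (e / 2)"]) (auto simp: gx)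
  qed
  ultimately have "affine_isometric_action ?H ?T ell2_space \<alpha>"
    unfolding affine_isometric_action_def
    by (simp add: ip_topology_ell2 ip_dist_ell2 \<alpha>_affine \<alpha>_dist)
  from property_FH_fixed_point[OF FH _ ell2_space_hilbert(1) this[folded G_topology]]
  obtain x where "\<And>g. g \<in> G \<Longrightarrow> \<alpha> g x = x"
    using G_topology by auto
  then have "g (column x n + unit_vec n) = column x n + unit_vec n" if "g \<in> G" for g n
    using col[OF that, of x n] that by (simp add: algebra_simps)
  then show thesis by (rule that)
qed

text \<open>With \<open>x\<close> Hilbert-Schmidt, \<open>x + 1\<close> is bounded below outside finitely many coordinates, so that the
  orthogonal complement of its range is finite-dimensional.\<close>

lemma finite_dimensional_support:
  assumes FH: "property_FH ((schatten_unitary_group p)\<lparr>carrier := G\<rparr>)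
      (subtopology (schatten_unitary_topology p) G)"
  obtains C where "finite C"
    and "\<And>c d. c \<in> C \<Longrightarrow> d \<in> C \<Longrightarrow> inner c d = (if c = d then 1 else (0::real))"
    and "\<And>g v. g \<in> G \<Longrightarrow> (\<And>c. c \<in> C \<Longrightarrow> inner c v = 0) \<Longrightarrow> blinfun_apply g v = v"
    and "\<And>g v. g \<in> G \<Longrightarrow> blinfun_apply g v - v \<in> span C"
proof -
  obtain x where x: "\<And>g n. g \<in> G \<Longrightarrow> blinfun_apply g (column x n + unit_vec n) = column x n + unit_vec n"
    using fixed_columns[OF FH] by blast
  \<comment> \<open>\<open>K\<close> is the space of fixed vectors and \<open>F\<close> its
    orthogonal complement, which contains every \<open>g v - v\<close> because \<open>G\<close> is
    closed under adjoints.\<close>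
  define K where "K = {v. \<forall>g\<in>G. blinfun_apply g v = v}"
  define F where "F = {v. \<forall>k\<in>K. inner k v = 0}"
  have F: "subspace F"
    by (auto simp: F_def subspace_def inner_add_right)
  have diff_F: "g v - v \<in> F" if g: "g \<in> G" for g v
  proof -
    have "inner k (g v) = inner k v" if "k \<in> K" for k
      using that G_adjoint[OF g] inner_real_adjoint[of g k v] by (simp add: K_def)
    then show ?thesis by (simp add: F_def inner_diff_right)
  qed
  \<comment> \<open>\<open>g v - v\<close> lies in \<open>F\<close> and, moving \<open>g\<close> to
    the other side of the inner product, is orthogonal to \<open>F\<close>, hence to itself.\<close>
  have fix_orth: "g v = v" if g: "g \<in> G" and v: "\<And>f. f \<in> F \<Longrightarrow> inner f v = 0" for g v
  proof -
    have "inner f (g v - v) = 0" if "f \<in> F" for f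
      using v[OF diff_F[OF G_adjoint[OF g], of f]] inner_real_adjoint[of g f v]
      by (simp add: inner_diff_left inner_diff_right)
    from this[OF diff_F[OF g, of v]] show ?thesis by simp
  qed
  \<comment> \<open>The coordinate bound below has a factor 2, from real and imaginary parts, so a
    tail below \<open>1/4\<close> yields \<open>(norm v)^2 \<le> (norm v)^2 / 2\<close>.\<close>
  obtain N where N: "norm (\<Sum>n. (norm (column x (n + N)))\<^sup>2) < 1 / 4"
    using suminf_exist_split[of "1/4" "\<lambda>n. (norm (column x n))\<^sup>2", OF _ summable_norm_column] by auto
  define Q where "Q = (\<lambda>n. inner (unit_vec n)) ` {..<N} \<union> (\<lambda>n. inner (scaleC \<i> (unit_vec n))) ` {..<N}"
  have "v = 0" if v: "v \<in> F" and Q0: "\<And>q. q \<in> Q \<Longrightarrow> q v = 0" for v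
  proof -
    have v0: "coord v n = 0" if "n < N" for n
      using that Q0[of "inner (unit_vec n)"] Q0[of "inner (scaleC \<i> (unit_vec n))"]
      by (auto simp: Q_def inner_unit_vec inner_i_unit_vec complex_eq_iff)
    have le: "(cmod (coord v n))\<^sup>2 \<le> 2 * (norm v)\<^sup>2 * (norm (column x n))\<^sup>2" for n
    proof -
      let ?c = "column x n"
      \<comment> \<open>\<open>v\<close> is orthogonal to the columns of \<open>x + 1\<close> and to
        their multiples by \<open>\<i>\<close>, so up to sign its coordinates are inner products
        with the columns of \<open>x\<close>.\<close>
      have K: "?c + unit_vec n \<in> K" "scaleC \<i> (?c + unit_vec n) \<in> K"
        using x G_complex_linear by (auto simp: K_def complex_linear_def)
      have sq: "(inner u v)\<^sup>2 \<le> (norm u)\<^sup>2 * (norm v)\<^sup>2" for u :: ell2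
        using power_mono[OF Cauchy_Schwarz_ineq2[of u v], of 2] by (simp add: power_mult_distrib)
      have "Re (coord v n) = - inner ?c v"
        using K(1) v by (auto simp: F_def inner_add_left inner_unit_vec)
      moreover have "Im (coord v n) = - inner (scaleC \<i> ?c) v"
        using K(2) v by (auto simp: F_def inner_add_left inner_i_unit_vec scaleC_simps)
      ultimately have "(cmod (coord v n))\<^sup>2 = (inner ?c v)\<^sup>2 + (inner (scaleC \<i> ?c) v)\<^sup>2"
        by (simp add: cmod_power2)
      also have "\<dots> \<le> (norm ?c)\<^sup>2 * (norm v)\<^sup>2 + (norm (scaleC \<i> ?c))\<^sup>2 * (norm v)\<^sup>2"
        by (intro add_mono sq)
      finally show ?thesis by (simp add: norm_scaleC)
    qed
    have s: "summable (\<lambda>n. (norm (column x (n + N)))\<^sup>2)"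
      by (rule summable_ignore_initial_segment[OF summable_norm_column])
    have "(norm v)\<^sup>2 = (\<Sum>n. (cmod (coord v (n + N)))\<^sup>2)"
      unfolding norm_ell2_sum by (subst suminf_split_initial_segment[OF coord_summable, of _ N]) (simp add: v0)
    also have "\<dots> \<le> (\<Sum>n. 2 * (norm v)\<^sup>2 * (norm (column x (n + N)))\<^sup>2)"
      by (intro suminf_le le summable_mult s summable_ignore_initial_segment[OF coord_summable])
    also have "\<dots> = 2 * (norm v)\<^sup>2 * (\<Sum>n. (norm (column x (n + N)))\<^sup>2)"
      by (rule suminf_mult[OF s])
    also have "\<dots> \<le> 2 * (norm v)\<^sup>2 * (1 / 4)"
      using N by (intro mult_left_mono) auto
    finally show ?thesis by simp
  qed
  then have "\<exists>n Y p. biorthogonal F n Y p"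
    by (intro biorthogonal_basis[of Q] F) (auto simp: Q_def bounded_linear_inner_right)
  then obtain n Y p where basis: "biorthogonal F n Y p" by blast
  have FY: "F = span (Y ` {..<n})"
  proof (intro subset_antisym span_minimal F subsetI)
    fix v assume "v \<in> F"
    then have "v = (\<Sum>k<n. p k v *\<^sub>R Y k)" by (simp add: biorthogonalD(4)[OF basis])
    also have "\<dots> \<in> span (Y ` {..<n})" by (intro span_sum span_scale span_base) auto
    finally show "v \<in> span (Y ` {..<n})" .
  qed (use biorthogonalD(1)[OF basis] in auto)
  obtain B where B: "finite B" "span B = span (Y ` {..<n})" "pairwise orthogonal B"
    using basis_orthogonal[of "Y ` {..<n}"] by auto
  \<comment> \<open>\<open>B\<close> may contain \<open>0\<close>, which is dropped before
    normalising.\<close>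
  define C where "C = (\<lambda>b. (1 / norm b) *\<^sub>R b) ` (B - {0})"
  have orthB: "inner c d = 0" if "c \<in> B" "d \<in> B" "c \<noteq> d" for c d
    using B(3) that by (auto simp: pairwise_def orthogonal_def)
  have BC: "b \<in> span C" if "b \<in> B" for b
  proof (cases "b = 0")
    case False
    have "norm b *\<^sub>R ((1 / norm b) *\<^sub>R b) \<in> span C"
      using that False by (intro span_scale span_base) (auto simp: C_def)
    then show ?thesis using False by simp
  qed (simp add: span_zero)
  have FC: "F \<subseteq> span C"
    unfolding FY B(2)[symmetric] by (intro span_minimal subspace_span) (use BC in auto)
  show thesis
  proof (rule that[of C])
    show "finite C" using B(1) by (simp add: C_def)
    show "inner c d = (if c = d then 1 else 0)" if "c \<in> C" "d \<in> C" for c d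
    proof (cases "c = d")
      case True
      then show ?thesis using that by (auto simp: C_def power2_norm_eq_inner[symmetric] power2_eq_square split: if_splits)
    next
      case False
      obtain b b' where b: "b \<in> B" "b' \<in> B" "c = (1 / norm b) *\<^sub>R b" "d = (1 / norm b') *\<^sub>R b'"
        using \<open>c \<in> C\<close> \<open>d \<in> C\<close> by (auto simp: C_def)
      with False have "b \<noteq> b'" by auto
      then show ?thesis using False b orthB[of b b'] by simp
    qed
    show "g v = v" if g: "g \<in> G" and v: "\<And>c. c \<in> C \<Longrightarrow> inner c v = 0" for g v
    proof (rule fix_orth[OF g])
      fix f assume "f \<in> F"
      then have "f \<in> span C" using FC by blast
      then have "orthogonal v f"
        by (rule orthogonal_to_span) (use v in \<open>simp add: orthogonal_def inner_commute\<close>)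
      then show "inner f v = 0" by (simp add: orthogonal_def inner_commute)
    qed
    show "g v - v \<in> span C" if "g \<in> G" for g v
      using diff_F[OF that] FC by blast
  qed
qed

end

section \<open>Functions of class C^k\<close>

lemma Euclidean_space_eq: "Euclidean_space n = top_of_set {x. \<forall>i\<ge>n. x i = 0}"
  by (simp add: Euclidean_space_def euclidean_product_topology)

lemma openin_Euclidean_line:
  assumes "openin (Euclidean_space n) S" and "x \<in> S" and "i < n"
  obtains d where "d > 0" and "\<And>t. \<bar>t - x i\<bar> < d \<Longrightarrow> x(i := t) \<in> S"
proof -
  obtain T where T: "open T" "S = {x. \<forall>i\<ge>n. x i = 0} \<inter> T"
    using assms(1) by (auto simp: Euclidean_space_eq openin_open)
  have "continuous_on UNIV (\<lambda>t. (x(i := t)) j)" for j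
    by (cases "j = i") (auto intro!: continuous_intros)
  then have "continuous_on UNIV (\<lambda>t. x(i := t))"
    by (rule continuous_on_coordinatewise_then_product)
  then have "open ((\<lambda>t. x(i := t)) -` T)"
    using T(1) by (rule open_vimage[rotated])
  moreover have "x i \<in> (\<lambda>t. x(i := t)) -` T" using assms(2) T(2) by simp
  ultimately obtain d where "d > 0" "\<And>t. dist t (x i) < d \<Longrightarrow> x(i := t) \<in> T"
    unfolding open_dist by blast
  moreover have "x(i := t) \<in> {x. \<forall>i\<ge>n. x i = 0}" for t using assms T(2) by auto
  ultimately show thesis using that T(2) by (auto simp: dist_real_def)
qed

lemma Ck_on_SucE:
  assumes "Ck_on n (Suc k) S f"
  obtains D where "\<And>i x. i < n \<Longrightarrow> x \<in> S \<Longrightarrow> ((\<lambda>t. f (x(i := t))) has_real_derivative D i x) (at (x i))"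
    and "\<And>i. i < n \<Longrightarrow> Ck_on n k S (D i)"
proof -
  obtain D where "\<forall>i<n. (\<forall>x\<in>S. ((\<lambda>t. f (x(i := t))) has_real_derivative D i x) (at (x i))) \<and> Ck_on n k S (D i)"
    using assms unfolding Ck_on.simps by (elim conjE exE)
  then show thesis using that by blast
qed

lemma Ck_on_SucI:
  assumes "continuous_map (subtopology (Euclidean_space n) S) euclideanreal f"
    and "\<And>i x. i < n \<Longrightarrow> x \<in> S \<Longrightarrow> ((\<lambda>t. f (x(i := t))) has_real_derivative D i x) (at (x i))"
    and "\<And>i. i < n \<Longrightarrow> Ck_on n k S (D i)"
  shows "Ck_on n (Suc k) S f"
  using assms unfolding Ck_on.simps by blast

lemma Ck_on_continuous: "Ck_on n k S f \<Longrightarrow> continuous_map (subtopology (Euclidean_space n) S) euclideanreal f"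
  by (cases k) auto

text \<open>Holds for arbitrary subsets, as the derivative condition looks at \<open>f\<close> along
  whole coordinate lines. It later passes from the full chart image to the image of a chart
  overlap.\<close>

lemma Ck_on_subset: "Ck_on n k S f \<Longrightarrow> S' \<subseteq> S \<Longrightarrow> Ck_on n k S' f"
proof (induction k arbitrary: f)
  case 0
  then show ?case by (auto elim: continuous_map_from_subtopology_mono)
next
  case (Suc k)
  obtain D where D: "\<And>i x. i < n \<Longrightarrow> x \<in> S \<Longrightarrow> ((\<lambda>t. f (x(i := t))) has_real_derivative D i x) (at (x i))"
    "\<And>i. i < n \<Longrightarrow> Ck_on n k S (D i)" using Ck_on_SucE[OF Suc.prems(1)] by blast
  have "continuous_map (subtopology (Euclidean_space n) S') euclideanreal f"
    using Ck_on_continuous[OF Suc.prems(1)] Suc.prems(2) by (auto elim: continuous_map_from_subtopology_mono)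
  moreover have "((\<lambda>t. f (x(i := t))) has_real_derivative D i x) (at (x i))" if "i < n" "x \<in> S'" for i x
    using D(1) that Suc.prems(2) by blast
  ultimately show ?case using Suc.IH[OF D(2) Suc.prems(2)] by (rule Ck_on_SucI)
qed

lemma Ck_on_SucD: "Ck_on n (Suc k) S f \<Longrightarrow> Ck_on n k S f"
proof (induction k arbitrary: f)
  case 0
  then show ?case using Ck_on_continuous by simp
next
  case (Suc k)
  obtain D where D: "\<And>i x. i < n \<Longrightarrow> x \<in> S \<Longrightarrow> ((\<lambda>t. f (x(i := t))) has_real_derivative D i x) (at (x i))"
    "\<And>i. i < n \<Longrightarrow> Ck_on n (Suc k) S (D i)" using Ck_on_SucE[OF Suc.prems] by blast
  show ?case
    using Ck_on_continuous[OF Suc.prems] D(1) Suc.IH[OF D(2)] by (rule Ck_on_SucI)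
qed

text \<open>The partial derivatives at a point of \<open>S\<close> involve values of the function on
  a full interval of the coordinate line; openness of \<open>S\<close> puts a neighbourhood of the
  point on that line inside \<open>S\<close>.\<close>

lemma Ck_on_cong:
  assumes S: "openin (Euclidean_space n) S" and eq: "\<And>x. x \<in> S \<Longrightarrow> f x = g x" and f: "Ck_on n k S f"
  shows "Ck_on n k S g"
proof -
  have cont: "continuous_map (subtopology (Euclidean_space n) S) euclideanreal g"
    by (rule continuous_map_eq[OF Ck_on_continuous[OF f]]) (use eq in auto)
  show ?thesis
  proof (cases k)
    case (Suc l)
    with f have "Ck_on n (Suc l) S f" by simp
    then obtain D where D: "\<And>i x. i < n \<Longrightarrow> x \<in> S \<Longrightarrow> ((\<lambda>t. f (x(i := t))) has_real_derivative D i x) (at (x i))"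
      "\<And>i. i < n \<Longrightarrow> Ck_on n l S (D i)" using Ck_on_SucE by blast
    have "((\<lambda>t. g (x(i := t))) has_real_derivative D i x) (at (x i))" if i: "i < n" and x: "x \<in> S" for i x
    proof -
      obtain d where d: "d > 0" "\<And>t. \<bar>t - x i\<bar> < d \<Longrightarrow> x(i := t) \<in> S"
        using openin_Euclidean_line[OF S x i] by blast
      show ?thesis
        by (rule has_field_derivative_transform_within[OF D(1)[OF i x] d(1)])
          (use d(2) eq in \<open>auto simp: dist_real_def\<close>)
    qed
    then show ?thesis unfolding Suc by (rule Ck_on_SucI[OF cont _ D(2)])
  qed (use cont in simp)
qed

lemma Ck_on_const: "Ck_on n k S (\<lambda>_. c)"
proof (induction k arbitrary: c)
  case (Suc k)
  then show ?case by (auto intro!: exI[of _ "\<lambda>_ _. 0"])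
qed simp

lemma Ck_on_add: "Ck_on n k S f \<Longrightarrow> Ck_on n k S g \<Longrightarrow> Ck_on n k S (\<lambda>x. f x + g x)"
proof (induction k arbitrary: f g)
  case 0
  then show ?case by (auto intro: continuous_map_add)
next
  case (Suc k)
  obtain D where D: "\<And>i x. i < n \<Longrightarrow> x \<in> S \<Longrightarrow> ((\<lambda>t. f (x(i := t))) has_real_derivative D i x) (at (x i))"
    "\<And>i. i < n \<Longrightarrow> Ck_on n k S (D i)" using Ck_on_SucE[OF Suc.prems(1)] by blast
  obtain E where E: "\<And>i x. i < n \<Longrightarrow> x \<in> S \<Longrightarrow> ((\<lambda>t. g (x(i := t))) has_real_derivative E i x) (at (x i))"
    "\<And>i. i < n \<Longrightarrow> Ck_on n k S (E i)" using Ck_on_SucE[OF Suc.prems(2)] by blast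
  have "continuous_map (subtopology (Euclidean_space n) S) euclideanreal (\<lambda>x. f x + g x)"
    using Suc.prems[THEN Ck_on_continuous] by (intro continuous_map_add)
  then show ?case
    by (rule Ck_on_SucI[where D = "\<lambda>i x. D i x + E i x"]) (intro DERIV_add D E Suc.IH; assumption)+
qed

lemma Ck_on_mult: "Ck_on n k S f \<Longrightarrow> Ck_on n k S g \<Longrightarrow> Ck_on n k S (\<lambda>x. f x * g x)"
proof (induction k arbitrary: f g)
  case 0
  then show ?case by (auto intro: continuous_map_real_mult)
next
  case (Suc k)
  obtain D where D: "\<And>i x. i < n \<Longrightarrow> x \<in> S \<Longrightarrow> ((\<lambda>t. f (x(i := t))) has_real_derivative D i x) (at (x i))"
    "\<And>i. i < n \<Longrightarrow> Ck_on n k S (D i)" using Ck_on_SucE[OF Suc.prems(1)] by blast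
  obtain E where E: "\<And>i x. i < n \<Longrightarrow> x \<in> S \<Longrightarrow> ((\<lambda>t. g (x(i := t))) has_real_derivative E i x) (at (x i))"
    "\<And>i. i < n \<Longrightarrow> Ck_on n k S (E i)" using Ck_on_SucE[OF Suc.prems(2)] by blast
  have "continuous_map (subtopology (Euclidean_space n) S) euclideanreal (\<lambda>x. f x * g x)"
    using Suc.prems[THEN Ck_on_continuous] by (intro continuous_map_real_mult)
  moreover have "((\<lambda>t. f (x(i := t)) * g (x(i := t))) has_real_derivative D i x * g x + f x * E i x) (at (x i))"
    if "i < n" "x \<in> S" for i x
    using DERIV_mult[OF D(1)[OF that] E(1)[OF that]] by (simp add: algebra_simps)
  moreover have "Ck_on n k S (\<lambda>x. D i x * g x + f x * E i x)" if "i < n" for i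
    using D(2)[OF that] E(2)[OF that] Suc.prems[THEN Ck_on_SucD]
    by (intro Ck_on_add Suc.IH)
  ultimately show ?case by (rule Ck_on_SucI)
qed

lemma Ck_on_sum: "(\<And>j. j \<in> J \<Longrightarrow> Ck_on n k S (f j)) \<Longrightarrow> Ck_on n k S (\<lambda>x. \<Sum>j\<in>J. f j x)"
  by (induction J rule: infinite_finite_induct) (auto intro: Ck_on_const Ck_on_add)

lemma continuous_map_reindex:
  assumes "\<And>z. z \<in> S' \<Longrightarrow> (\<lambda>j. if j < n then z (e j) else 0) \<in> S"
  shows "continuous_map (subtopology (Euclidean_space m) S') (subtopology (Euclidean_space n) S)
    (\<lambda>z j. if j < n then z (e j) else 0)"
proof -
  have "continuous_map (Euclidean_space m) euclideanreal (\<lambda>z. z (e j))" if "j < n" for j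
    unfolding Euclidean_space_def
    by (intro continuous_map_from_subtopology continuous_map_product_projection) simp
  then have "continuous_map (subtopology (Euclidean_space m) S') (Euclidean_space n)
      (\<lambda>z j. if j < n then z (e j) else 0)"
    unfolding continuous_map_componentwise_Euclidean_space
    by (intro allI impI continuous_map_from_subtopology)
  then show ?thesis
    using assms by (auto simp: continuous_map_in_subtopology)
qed

text \<open>Composition with a selection of coordinates: the derivative in direction
  \<open>e j\<close> is the old one in direction \<open>j\<close>, and the remaining ones vanish. It
  is applied to the two halves of the coordinates of a product chart.\<close>

lemma Ck_on_reindex:
  fixes e :: "nat \<Rightarrow> nat"
  assumes f: "Ck_on n k S f" and e: "inj_on e {..<n}" "e ` {..<n} \<subseteq> {..<m}"
    and S': "\<And>z. z \<in> S' \<Longrightarrow> (\<lambda>j. if j < n then z (e j) else 0) \<in> S"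
  shows "Ck_on m k S' (\<lambda>z. f (\<lambda>j. if j < n then z (e j) else 0))"
proof -
  let ?\<pi> = "\<lambda>z j. if j < n then z (e j) else (0::real)"
  have \<pi>: "continuous_map (subtopology (Euclidean_space m) S') (subtopology (Euclidean_space n) S) ?\<pi>"
    using S' by (rule continuous_map_reindex)
  have cont: "continuous_map (subtopology (Euclidean_space m) S') euclideanreal (\<lambda>z. f (?\<pi> z))"
    if "continuous_map (subtopology (Euclidean_space n) S) euclideanreal f" for f
    using continuous_map_compose[OF \<pi> that] by (simp add: o_def)
  show ?thesis
    using f
  proof (induction k arbitrary: f)
    case 0
    then show ?case using cont by simp
  next
    case (Suc k)
    obtain D where D: "\<And>i x. i < n \<Longrightarrow> x \<in> S \<Longrightarrow> ((\<lambda>t. f (x(i := t))) has_real_derivative D i x) (at (x i))"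
      "\<And>i. i < n \<Longrightarrow> Ck_on n k S (D i)" using Ck_on_SucE[OF Suc.prems] by blast
    define D' where "D' i = (if i \<in> e ` {..<n} then (\<lambda>z. D (inv_into {..<n} e i) (?\<pi> z)) else (\<lambda>_. 0))" for i
    have "Ck_on m k S' (D' i)" if "i < m" for i
      using that e(1) by (auto simp: D'_def intro!: Suc.IH D(2) Ck_on_const)
    moreover have "((\<lambda>t. f (?\<pi> (z(i := t)))) has_real_derivative D' i z) (at (z i))"
      if "i < m" and z: "z \<in> S'" for i z
    proof (cases "i \<in> e ` {..<n}")
      case True
      then obtain j where j: "j < n" "i = e j" by auto
      have "?\<pi> (z(i := t)) = (?\<pi> z)(j := t)" for t
        using j e(1) by (auto simp: fun_eq_iff inj_on_def)
      then show ?thesis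
        using D(1)[OF j(1) S'[OF z]] j e(1) by (simp add: D'_def)
    next
      case False
      then have "?\<pi> (z(i := t)) = ?\<pi> z" for t by (auto simp: fun_eq_iff)
      then show ?thesis using False by (simp add: D'_def)
    qed
    ultimately show ?case
      using cont[OF Ck_on_continuous[OF Suc.prems]] by (intro Ck_on_SucI[where D = D'])
  qed
qed

section \<open>Tangent vectors of a group of operators\<close>

text \<open>The vectors \<open>B k\<close> may be dependent, so the set is treated as a continuous
  image of a box, built up one coordinate at a time.\<close>

lemma compact_bounded_combinations:
  fixes B :: "nat \<Rightarrow> 'a::real_normed_vector"
  shows "compact {(\<Sum>k<m. a k *\<^sub>R B k) | a. \<forall>k<m. \<bar>a k\<bar> \<le> R}"
proof (induction m)
  case (Suc m)
  let ?K = "{(\<Sum>k<m. a k *\<^sub>R B k) | a. \<forall>k<m. \<bar>a k\<bar> \<le> R}"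
  have "compact ((\<lambda>(x, c). x + c *\<^sub>R B m) ` (?K \<times> {-R..R}))"
    unfolding case_prod_beta
    by (intro compact_continuous_image compact_Times Suc compact_Icc continuous_intros)
  also have "(\<lambda>(x, c). x + c *\<^sub>R B m) ` (?K \<times> {-R..R})
      = {(\<Sum>k<Suc m. a k *\<^sub>R B k) | a. \<forall>k<Suc m. \<bar>a k\<bar> \<le> R}" (is "?L = ?N")
  proof (intro subset_antisym subsetI)
    fix y assume "y \<in> ?L"
    then obtain x c where xc: "x \<in> ?K" "c \<in> {-R..R}" "y = x + c *\<^sub>R B m"
      by (elim imageE SigmaE) simp
    then obtain a where "\<forall>k<m. \<bar>a k\<bar> \<le> R" "x = (\<Sum>k<m. a k *\<^sub>R B k)" by blast
    with xc have a: "\<forall>k<m. \<bar>a k\<bar> \<le> R" "c \<in> {-R..R}" "y = (\<Sum>k<m. a k *\<^sub>R B k) + c *\<^sub>R B m"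
      by auto
    have "(\<Sum>k<m. (a(m := c)) k *\<^sub>R B k) = (\<Sum>k<m. a k *\<^sub>R B k)"
      by (rule sum.cong) auto
    then have "y = (\<Sum>k<Suc m. (a(m := c)) k *\<^sub>R B k)" using a(3) by simp
    moreover have "\<forall>k<Suc m. \<bar>(a(m := c)) k\<bar> \<le> R"
      using a(1,2) by (simp add: less_Suc_eq abs_le_iff minus_le_iff)
    ultimately show "y \<in> ?N" by (intro CollectI exI[of _ "a(m := c)"] conjI)
  next
    fix y assume "y \<in> ?N"
    then obtain a where a: "y = (\<Sum>k<Suc m. a k *\<^sub>R B k)" "\<forall>k<Suc m. \<bar>a k\<bar> \<le> R" by blast
    have "(\<Sum>k<m. a k *\<^sub>R B k) \<in> ?K" using a(2) by (intro CollectI exI[of _ a]) simp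
    moreover have "a m \<in> {-R..R}" using a(2) by (simp add: abs_le_iff minus_le_iff)
    ultimately show "y \<in> ?L"
      using a(1) by (intro image_eqI[of _ _ "((\<Sum>k<m. a k *\<^sub>R B k), a m)"] SigmaI) simp_all
  qed
  finally show ?case .
qed auto

text \<open>The conditions on \<open>q\<close> and \<open>B\<close> say that all
  \<open>g - 1\<close> lie in a finite-dimensional space. \<open>\<sigma>\<close> extends inversion
  to a bounded linear map; in the application it is the adjoint.\<close>

locale operator_group =
  fixes G :: "('a::banach \<Rightarrow>\<^sub>L 'a) set" and \<sigma> :: "('a \<Rightarrow>\<^sub>L 'a) \<Rightarrow> ('a \<Rightarrow>\<^sub>L 'a)"
    and m :: nat and B :: "nat \<Rightarrow> ('a \<Rightarrow>\<^sub>L 'a)" and q :: "nat \<Rightarrow> ('a \<Rightarrow>\<^sub>L 'a) \<Rightarrow> real"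
  assumes closed: "closed G" and one: "id_blinfun \<in> G"
    and mult: "\<lbrakk>g \<in> G; h \<in> G\<rbrakk> \<Longrightarrow> g o\<^sub>L h \<in> G"
    and norm_le: "g \<in> G \<Longrightarrow> norm g \<le> 1"
    and inv_linear: "bounded_linear \<sigma>"
    and inv: "g \<in> G \<Longrightarrow> \<sigma> g \<in> G" "g \<in> G \<Longrightarrow> \<sigma> g o\<^sub>L g = id_blinfun" "g \<in> G \<Longrightarrow> g o\<^sub>L \<sigma> g = id_blinfun"
    and q_linear: "k < m \<Longrightarrow> bounded_linear (q k)"
    and span: "g \<in> G \<Longrightarrow> (\<Sum>k<m. q k (g - id_blinfun) *\<^sub>R B k) = g - id_blinfun"
begin

definition proj :: "('a \<Rightarrow>\<^sub>L 'a) \<Rightarrow> ('a \<Rightarrow>\<^sub>L 'a)"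
  where "proj A = (\<Sum>k<m. q k A *\<^sub>R B k)"

text \<open>Nothing forces \<open>proj\<close> to be idempotent, as \<open>q\<close> and
  \<open>B\<close> are related only on the elements \<open>g - 1\<close>. Its fixed space is still a
  closed subspace of the span of \<open>B\<close> that contains them.\<close>

definition E :: "('a \<Rightarrow>\<^sub>L 'a) set"
  where "E = {A. proj A = A}"

lemma proj_linear: "bounded_linear proj"
  unfolding proj_def[abs_def]
  by (intro bounded_linear_sum bounded_linear_compose[OF bounded_linear_scaleR_left] q_linear) simp

lemma E_subspace: "subspace E"
proof -
  interpret bounded_linear proj by (rule proj_linear)
  show ?thesis unfolding E_def by (rule subspaceI) (simp_all add: zero add scaleR)
qed

lemma E_closed: "closed E"
  unfolding E_def
  by (rule closed_Collect_eq[OF linear_continuous_on[OF proj_linear] continuous_on_id])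

lemma G_minus_one: "g \<in> G \<Longrightarrow> g - id_blinfun \<in> E"
  using span unfolding E_def proj_def by simp

text \<open>The functionals \<open>q k\<close> are bounded on a bounded set, so it is a closed part
  of a compact set of combinations of the \<open>B k\<close>.\<close>

lemma E_compact:
  assumes "S \<subseteq> E" "closed S" "bounded S"
  shows "compact S"
proof -
  obtain R where R: "\<forall>A\<in>S. norm A \<le> R" using assms(3) unfolding bounded_iff by blast
  define M where "M = (\<Sum>k<m. onorm (q k) * \<bar>R\<bar>)"
  have "\<bar>q k A\<bar> \<le> M" if A: "A \<in> S" and k: "k < m" for k A
  proof -
    have "\<bar>q k A\<bar> \<le> onorm (q k) * norm A" using onorm[OF q_linear[OF k], of A] by simp
    also have "\<dots> \<le> onorm (q k) * \<bar>R\<bar>"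
      using R A by (intro mult_left_mono onorm_pos_le q_linear k) auto
    also have "\<dots> \<le> M"
      unfolding M_def using k by (intro member_le_sum mult_nonneg_nonneg onorm_pos_le q_linear) auto
    finally show ?thesis .
  qed
  then have "A \<in> {(\<Sum>k<m. a k *\<^sub>R B k) | a. \<forall>k<m. \<bar>a k\<bar> \<le> M}" if "A \<in> S" for A
    using assms(1) that unfolding E_def proj_def by (intro CollectI exI[of _ "\<lambda>k. q k A"]) auto
  then have "S \<inter> {(\<Sum>k<m. a k *\<^sub>R B k) | a. \<forall>k<m. \<bar>a k\<bar> \<le> M} = S" by blast
  then show ?thesis
    using closed_Int_compact[OF assms(2) compact_bounded_combinations[where m = m and B = B and R = M]] by simp
qed

lemma compact_G: "compact G"
proof -
  have "compact ((\<lambda>g. g - id_blinfun) ` G)"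
  proof (rule E_compact)
    have "norm (g - id_blinfun) \<le> 1 + 1" if "g \<in> G" for g
      by (intro order_trans[OF norm_triangle_ineq4] add_mono norm_le that one)
    then show "bounded ((\<lambda>g. g - id_blinfun) ` G)" unfolding bounded_iff by blast
    show "closed ((\<lambda>g. g - id_blinfun) ` G)"
      using closed_translation[OF closed, of "- id_blinfun"] by simp
  qed (use G_minus_one in blast)
  then have "compact ((+) id_blinfun ` (\<lambda>g. g - id_blinfun) ` G)"
    by (rule compact_translation)
  moreover have "(+) id_blinfun ` (\<lambda>g. g - id_blinfun) ` G = G"
    unfolding image_image by simp
  ultimately show ?thesis by metis
qed

lemma inv_one: "\<sigma> id_blinfun = id_blinfun"
  using inv(2)[OF one] by (metis blinfun_apply_blinfun_compose blinfun_apply_id_blinfun blinfun_eqI id_apply)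

lemma inv_apply: "g \<in> G \<Longrightarrow> \<sigma> g (g x) = x" "g \<in> G \<Longrightarrow> g (\<sigma> g x) = x"
  using inv(2,3) by (metis blinfun_apply_blinfun_compose blinfun_apply_id_blinfun id_apply)+

text \<open>Neither \<open>g\<close> nor its inverse increases norms.\<close>

lemma norm_G_compose: "g \<in> G \<Longrightarrow> norm (g o\<^sub>L A) = norm A" for A :: "'a \<Rightarrow>\<^sub>L 'a"
proof -
  assume g: "g \<in> G"
  have le: "norm (h o\<^sub>L C) \<le> norm C" if "h \<in> G" for h and C :: "'a \<Rightarrow>\<^sub>L 'a"
    using norm_blinfun_compose[of h C] mult_right_mono[OF norm_le[OF that] norm_ge_zero[of C]] by simp
  have "\<sigma> g o\<^sub>L (g o\<^sub>L A) = A"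
    by (rule blinfun_eqI) (simp add: inv_apply g)
  then show ?thesis using le[OF g, of A] le[OF inv(1)[OF g], of "g o\<^sub>L A"] by simp
qed

text \<open>The set of directions of curves in \<open>G\<close> through the identity. It is the Lie algebra of \<open>G\<close>, but is
  defined without the exponential map.\<close>

definition tangent :: "('a \<Rightarrow>\<^sub>L 'a) set"
  where "tangent = {W. \<forall>e>0. \<exists>d>0. \<forall>s. \<bar>s\<bar> < d \<longrightarrow> (\<exists>u\<in>G. norm (u - id_blinfun - s *\<^sub>R W) \<le> e * \<bar>s\<bar>)}"

lemma tangentE:
  assumes "W \<in> tangent" "e > 0"
  obtains d where "d > 0" "\<And>s. \<bar>s\<bar> < d \<Longrightarrow> \<exists>u\<in>G. norm (u - id_blinfun - s *\<^sub>R W) \<le> e * \<bar>s\<bar>"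
  using assms unfolding tangent_def by blast

text \<open>The element \<open>w\<close> is the power \<open>u\<^sup>j\<close>.\<close>

lemma power_bound:
  assumes u: "u \<in> G"
  shows "\<exists>w\<in>G. norm (w - id_blinfun - real j *\<^sub>R (u - id_blinfun)) \<le> (real j)\<^sup>2 * (norm (u - id_blinfun))\<^sup>2"
proof (induction j)
  case 0
  show ?case using one by (intro bexI[of _ id_blinfun]) auto
next
  case (Suc j)
  then obtain w where w: "w \<in> G"
    "norm (w - id_blinfun - real j *\<^sub>R (u - id_blinfun)) \<le> (real j)\<^sup>2 * (norm (u - id_blinfun))\<^sup>2" by blast
  let ?a = "u - id_blinfun"
  \<comment> \<open>In this splitting the isometry \<open>u\<close> carries the previous error over
    unchanged, and only \<open>j a^2\<close> is added.\<close>
  have "(u o\<^sub>L w) - id_blinfun - real (Suc j) *\<^sub>R ?a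
      = (u o\<^sub>L (w - id_blinfun - real j *\<^sub>R ?a)) + real j *\<^sub>R (?a o\<^sub>L ?a)"
    by (rule blinfun_eqI) (simp add: blinfun.bilinear_simps algebra_simps)
  then have "norm ((u o\<^sub>L w) - id_blinfun - real (Suc j) *\<^sub>R ?a)
      \<le> norm (w - id_blinfun - real j *\<^sub>R ?a) + real j * norm (?a o\<^sub>L ?a)"
    using norm_triangle_ineq[of "u o\<^sub>L (w - id_blinfun - real j *\<^sub>R ?a)" "real j *\<^sub>R (?a o\<^sub>L ?a)"]
    by (simp add: norm_G_compose[OF u])
  also have "\<dots> \<le> (real j)\<^sup>2 * (norm ?a)\<^sup>2 + real j * (norm ?a)\<^sup>2"
    using w(2) norm_blinfun_compose[of ?a ?a]
    by (intro add_mono mult_left_mono) (auto simp: power2_eq_square)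
  also have "\<dots> = ((real j)\<^sup>2 + real j) * (norm ?a)\<^sup>2" by (simp add: algebra_simps)
  also have "\<dots> \<le> (real (Suc j))\<^sup>2 * (norm ?a)\<^sup>2"
    by (intro mult_right_mono) (auto simp: power2_eq_square algebra_simps)
  finally show ?case using mult[OF u w(1)] by blast
qed

text \<open>The \<open>j\<close>-th power of \<open>u k\<close>, with \<open>j\<close> the integer
  part of \<open>t / \<tau> k\<close>, takes the place of \<open>exp (t W)\<close>. For
  \<open>k\<close> large depending on \<open>t\<close>, it differs from \<open>1 + t W\<close> by
  the second-order error of the power, the error of the direction and the rounding of
  \<open>t\<close>, all of order \<open>t^2\<close>.\<close>

lemma tangent_positive:
  assumes u: "\<And>k. u k \<in> G" and \<tau>: "\<And>k. \<tau> k > 0" "\<tau> \<longlonglongrightarrow> 0"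
    and lim: "(\<lambda>k. (1 / \<tau> k) *\<^sub>R (u k - id_blinfun)) \<longlonglongrightarrow> W" and e: "e > 0"
  shows "\<exists>d>0. \<forall>t. 0 < t \<and> t < d \<longrightarrow> (\<exists>w\<in>G. norm (w - id_blinfun - t *\<^sub>R W) \<le> e * t)"
proof -
  \<comment> \<open>The summands are the constants of the three errors: power, direction,
    rounding.\<close>
  define K where "K = (norm W + 1)\<^sup>2 + 1 + norm W"
  have K: "K > 0" by (simp add: K_def add_nonneg_pos add_pos_nonneg)
  have "\<exists>w\<in>G. norm (w - id_blinfun - t *\<^sub>R W) \<le> e * t" if t: "0 < t" "t < min 1 (e / K)" for t
  proof -
    \<comment> \<open>This makes the rounding error, at most \<open>\<tau> k\<close>, quadratic in
      \<open>t\<close>.\<close>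
    have "\<forall>\<^sub>F k in sequentially. \<tau> k < t\<^sup>2" using order_tendstoD(2)[OF \<tau>(2), of "t\<^sup>2"] t by simp
    moreover have "\<forall>\<^sub>F k in sequentially. dist ((1 / \<tau> k) *\<^sub>R (u k - id_blinfun)) W < t"
      using lim t(1) by (rule tendstoD)
    ultimately have "\<forall>\<^sub>F k in sequentially. \<tau> k < t\<^sup>2 \<and> dist ((1 / \<tau> k) *\<^sub>R (u k - id_blinfun)) W < t"
      by (rule eventually_conj)
    then obtain k where k: "\<tau> k < t\<^sup>2" "norm ((1 / \<tau> k) *\<^sub>R (u k - id_blinfun) - W) < t"
      unfolding eventually_sequentially dist_norm by blast
    define a where "a = u k - id_blinfun"
    define b where "b = (1 / \<tau> k) *\<^sub>R a"
    have a: "a = \<tau> k *\<^sub>R b" using \<tau>(1)[of k] by (simp add: b_def)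
    have bW: "norm (b - W) < t" using k(2) by (simp add: a_def b_def)
    have nb: "norm b \<le> norm W + 1" using bW t norm_triangle_ineq2[of b W] by simp
    define j where "j = nat \<lfloor>t / \<tau> k\<rfloor>"
    have "0 \<le> t / \<tau> k" using t \<tau>(1)[of k] by simp
    then have "real j \<le> t / \<tau> k" "t / \<tau> k < real j + 1" by (simp_all add: j_def)
    then have j: "real j * \<tau> k \<le> t" "t - real j * \<tau> k \<le> \<tau> k"
      using \<tau>(1)[of k] by (simp_all add: field_simps)
    obtain w where w: "w \<in> G" "norm (w - id_blinfun - real j *\<^sub>R a) \<le> (real j)\<^sup>2 * (norm a)\<^sup>2"
      using power_bound[OF u[of k], of j] unfolding a_def[symmetric] by blast
    have j0: "0 \<le> real j * \<tau> k" using \<tau>(1)[of k] by simp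
    have "real j * norm a = real j * \<tau> k * norm b"
      unfolding a norm_scaleR using \<tau>(1)[of k] by simp
    also have "\<dots> \<le> t * (norm W + 1)" by (rule mult_mono[OF j(1) nb]) (use t in auto)
    finally have "(real j * norm a)\<^sup>2 \<le> (t * (norm W + 1))\<^sup>2" by (rule power_mono) simp
    then have "(real j)\<^sup>2 * (norm a)\<^sup>2 \<le> t\<^sup>2 * (norm W + 1)\<^sup>2" by (simp only: power_mult_distrib)
    with w(2) have 1: "norm (w - id_blinfun - real j *\<^sub>R a) \<le> t\<^sup>2 * (norm W + 1)\<^sup>2" by linarith
    have "real j *\<^sub>R a - (real j * \<tau> k) *\<^sub>R W = (real j * \<tau> k) *\<^sub>R (b - W)"
      unfolding a by (simp only: scaleR_diff_right scaleR_scaleR)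
    then have "norm (real j *\<^sub>R a - (real j * \<tau> k) *\<^sub>R W) = real j * \<tau> k * norm (b - W)"
      using j0 by simp
    also have "\<dots> \<le> t * t" by (rule mult_mono[OF j(1)]) (use bW t in auto)
    finally have 2: "norm (real j *\<^sub>R a - (real j * \<tau> k) *\<^sub>R W) \<le> t\<^sup>2" by (simp only: power2_eq_square)
    have "norm ((real j * \<tau> k) *\<^sub>R W - t *\<^sub>R W) = \<bar>real j * \<tau> k - t\<bar> * norm W"
      by (simp only: scaleR_diff_left[symmetric] norm_scaleR)
    also have "\<dots> \<le> t\<^sup>2 * norm W" by (rule mult_right_mono) (use j k(1) in auto)
    finally have 3: "norm ((real j * \<tau> k) *\<^sub>R W - t *\<^sub>R W) \<le> t\<^sup>2 * norm W" .
    have eq: "w - id_blinfun - t *\<^sub>R W = (w - id_blinfun - real j *\<^sub>R a)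
        + (real j *\<^sub>R a - (real j * \<tau> k) *\<^sub>R W) + ((real j * \<tau> k) *\<^sub>R W - t *\<^sub>R W)" by simp
    have "norm (w - id_blinfun - t *\<^sub>R W) \<le> t\<^sup>2 * (norm W + 1)\<^sup>2 + t\<^sup>2 + t\<^sup>2 * norm W"
      unfolding eq by (intro norm_triangle_le add_mono 1 2 3)
    also have "\<dots> = t * (t * K)" by (simp add: K_def power2_eq_square algebra_simps)
    also have "\<dots> \<le> t * e" using t K by (intro mult_left_mono) (auto simp: field_simps)
    finally show ?thesis using w(1) by (auto simp: mult.commute)
  qed
  then show ?thesis using e K by (intro exI[of _ "min 1 (e / K)"]) auto
qed

text \<open>\<open>tangent_positive\<close> covers positive parameters; negative ones come from the
  inverses, whose quotients \<open>- \<sigma> (u k) (u k - 1) / \<tau> k\<close> converge to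
  \<open>- W\<close>.\<close>

lemma tangent_sequence:
  assumes u: "\<And>k. u k \<in> G" and \<tau>: "\<And>k. \<tau> k > 0" "\<tau> \<longlonglongrightarrow> 0"
    and lim: "(\<lambda>k. (1 / \<tau> k) *\<^sub>R (u k - id_blinfun)) \<longlonglongrightarrow> W"
  shows "W \<in> tangent"
proof -
  have "(\<lambda>k. \<tau> k *\<^sub>R ((1 / \<tau> k) *\<^sub>R (u k - id_blinfun))) \<longlonglongrightarrow> 0 *\<^sub>R W"
    by (intro tendsto_scaleR \<tau> lim)
  moreover have "\<tau> k \<noteq> 0" for k using \<tau>(1)[of k] by simp
  ultimately have "(\<lambda>k. u k - id_blinfun) \<longlonglongrightarrow> 0" by simp
  from tendsto_add[OF this tendsto_const[of id_blinfun]] have "u \<longlonglongrightarrow> id_blinfun" by simp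
  then have "(\<lambda>k. \<sigma> (u k)) \<longlonglongrightarrow> \<sigma> id_blinfun"
    by (rule bounded_linear.tendsto[OF inv_linear])
  then have "(\<lambda>k. - (\<sigma> (u k) o\<^sub>L ((1 / \<tau> k) *\<^sub>R (u k - id_blinfun)))) \<longlonglongrightarrow> - (id_blinfun o\<^sub>L W)"
    by (intro tendsto_minus bounded_bilinear.tendsto[OF bounded_bilinear_blinfun_compose] lim)
      (simp add: inv_one)
  moreover have "id_blinfun o\<^sub>L W = W" by (rule blinfun_eqI) simp
  moreover have "- (\<sigma> (u k) o\<^sub>L ((1 / \<tau> k) *\<^sub>R (u k - id_blinfun))) = (1 / \<tau> k) *\<^sub>R (\<sigma> (u k) - id_blinfun)" for k
    by (rule blinfun_eqI) (simp add: blinfun.bilinear_simps inv_apply u algebra_simps)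
  ultimately have lim': "(\<lambda>k. (1 / \<tau> k) *\<^sub>R (\<sigma> (u k) - id_blinfun)) \<longlonglongrightarrow> - W" by simp
  show ?thesis
    unfolding tangent_def
  proof (intro CollectI allI impI)
    fix e :: real assume e: "e > 0"
    obtain d1 where d1: "d1 > 0" "\<And>t. 0 < t \<Longrightarrow> t < d1 \<Longrightarrow> \<exists>w\<in>G. norm (w - id_blinfun - t *\<^sub>R W) \<le> e * t"
      using tangent_positive[OF u \<tau> lim e] by blast
    obtain d2 where d2: "d2 > 0" "\<And>t. 0 < t \<Longrightarrow> t < d2 \<Longrightarrow> \<exists>w\<in>G. norm (w - id_blinfun - t *\<^sub>R (- W)) \<le> e * t"
      using tangent_positive[OF inv(1)[OF u] \<tau> lim' e] by blast
    have "\<exists>w\<in>G. norm (w - id_blinfun - s *\<^sub>R W) \<le> e * \<bar>s\<bar>" if s: "\<bar>s\<bar> < min d1 d2" for s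
    proof -
      consider "s = 0" | "s > 0" | "s < 0" by linarith
      then show ?thesis
      proof cases
        case 1
        then show ?thesis using one by (intro bexI[of _ id_blinfun]) auto
      next
        case 2
        then show ?thesis using d1(2)[of s] s by simp
      next
        case 3
        then show ?thesis using d2(2)[of "- s"] s by simp
      qed
    qed
    then show "\<exists>d>0. \<forall>s. \<bar>s\<bar> < d \<longrightarrow> (\<exists>u\<in>G. norm (u - id_blinfun - s *\<^sub>R W) \<le> e * \<bar>s\<bar>)"
      using d1(1) d2(1) by (intro exI[of _ "min d1 d2"]) auto
  qed
qed

text \<open>The quotients \<open>(u - 1) / s\<close> lie in the subspace \<open>E\<close>, which is
  closed.\<close>

lemma tangent_subset: "tangent \<subseteq> E"
proof
  fix W assume W: "W \<in> tangent"
  have "\<exists>A\<in>E. dist A W < e" if e: "e > 0" for e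
  proof -
    obtain d where d: "d > 0" "\<And>s. \<bar>s\<bar> < d \<Longrightarrow> \<exists>u\<in>G. norm (u - id_blinfun - s *\<^sub>R W) \<le> (e / 2) * \<bar>s\<bar>"
      using tangentE[OF W, of "e / 2"] e by auto
    define s where "s = d / 2"
    have s: "s > 0" "\<bar>s\<bar> < d" using d(1) by (auto simp: s_def)
    obtain u where u: "u \<in> G" "norm (u - id_blinfun - s *\<^sub>R W) \<le> (e / 2) * \<bar>s\<bar>" using d(2)[OF s(2)] by blast
    have mem: "(1 / s) *\<^sub>R (u - id_blinfun) \<in> E" using E_subspace G_minus_one[OF u(1)] by (rule subspace_scale)
    have eq: "(1 / s) *\<^sub>R (u - id_blinfun) - W = (1 / s) *\<^sub>R (u - id_blinfun - s *\<^sub>R W)"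
      using s by (simp add: algebra_simps)
    have "dist ((1 / s) *\<^sub>R (u - id_blinfun)) W = (1 / s) * norm (u - id_blinfun - s *\<^sub>R W)"
      unfolding dist_norm eq norm_scaleR using s by simp
    also have "\<dots> \<le> (1 / s) * ((e / 2) * \<bar>s\<bar>)" using u(2) s by (intro mult_left_mono) auto
    also have "\<dots> = e / 2" using s by simp
    finally have "dist ((1 / s) *\<^sub>R (u - id_blinfun)) W \<le> e / 2" .
    then show ?thesis using e mem by (intro bexI[of _ "(1 / s) *\<^sub>R (u - id_blinfun)"]) auto
  qed
  then show "W \<in> E" using E_closed closed_approachable by blast
qed

text \<open>The sum of two directions is realised by the product of the approximating elements,
  whose cross term \<open>(u - 1) (v - 1)\<close> is of second order.\<close>

lemma tangent_subspace: "subspace tangent"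
proof (rule subspaceI)
  show "0 \<in> tangent"
    unfolding tangent_def using one by (auto intro!: exI[of _ "1::real"] bexI[of _ id_blinfun])
next
  fix W Z assume W: "W \<in> tangent" and Z: "Z \<in> tangent"
  show "W + Z \<in> tangent"
    unfolding tangent_def
  proof (intro CollectI allI impI)
    fix e :: real assume e: "e > 0"
    \<comment> \<open>\<open>c \<le> 1\<close> bounds \<open>u - 1\<close> and \<open>v - 1\<close>
      linearly in \<open>s\<close>, and \<open>c \<le> e / 4\<close> leaves \<open>e / 2\<close> for
      their product.\<close>
    define c where "c = min 1 (e / 4)"
    have c: "c > 0" "c \<le> 1" "c \<le> e / 4" using e by (auto simp: c_def)
    obtain d1 where d1: "d1 > 0" "\<And>s. \<bar>s\<bar> < d1 \<Longrightarrow> \<exists>u\<in>G. norm (u - id_blinfun - s *\<^sub>R W) \<le> c * \<bar>s\<bar>"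
      using tangentE[OF W c(1)] by blast
    obtain d2 where d2: "d2 > 0" "\<And>s. \<bar>s\<bar> < d2 \<Longrightarrow> \<exists>u\<in>G. norm (u - id_blinfun - s *\<^sub>R Z) \<le> c * \<bar>s\<bar>"
      using tangentE[OF Z c(1)] by blast
    define M where "M = (norm W + 1) * (norm Z + 1)"
    have M: "M > 0" by (simp add: M_def add_nonneg_pos)
    define d where "d = min (min d1 d2) (e / (2 * M))"
    have "\<exists>w\<in>G. norm (w - id_blinfun - s *\<^sub>R (W + Z)) \<le> e * \<bar>s\<bar>" if s: "\<bar>s\<bar> < d" for s
    proof -
      obtain u where u: "u \<in> G" "norm (u - id_blinfun - s *\<^sub>R W) \<le> c * \<bar>s\<bar>" using d1(2)[of s] s by (auto simp: d_def)
      obtain v where v: "v \<in> G" "norm (v - id_blinfun - s *\<^sub>R Z) \<le> c * \<bar>s\<bar>" using d2(2)[of s] s by (auto simp: d_def)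
      have small: "norm (x - id_blinfun) \<le> \<bar>s\<bar> * (norm X + 1)" if "norm (x - id_blinfun - s *\<^sub>R X) \<le> c * \<bar>s\<bar>"
        for x X :: "'a \<Rightarrow>\<^sub>L 'a"
      proof -
        have "norm (x - id_blinfun) \<le> norm (x - id_blinfun - s *\<^sub>R X) + norm (s *\<^sub>R X)"
          using norm_triangle_ineq[of "x - id_blinfun - s *\<^sub>R X" "s *\<^sub>R X"] by simp
        also have "\<dots> \<le> 1 * \<bar>s\<bar> + \<bar>s\<bar> * norm X"
          using that c(2) by (intro add_mono order_trans[OF that] mult_right_mono) auto
        finally show ?thesis by (simp add: algebra_simps)
      qed
      have "(u o\<^sub>L v) - id_blinfun - s *\<^sub>R (W + Z) = (u - id_blinfun - s *\<^sub>R W) + (v - id_blinfun - s *\<^sub>R Z)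
          + ((u - id_blinfun) o\<^sub>L (v - id_blinfun))"
        by (rule blinfun_eqI) (simp add: blinfun.bilinear_simps algebra_simps)
      then have "norm ((u o\<^sub>L v) - id_blinfun - s *\<^sub>R (W + Z)) \<le> c * \<bar>s\<bar> + c * \<bar>s\<bar>
          + norm ((u - id_blinfun) o\<^sub>L (v - id_blinfun))"
        using u(2) v(2) by (metis add_mono norm_triangle_le order_refl)
      also have "norm ((u - id_blinfun) o\<^sub>L (v - id_blinfun)) \<le> (\<bar>s\<bar> * (norm W + 1)) * (\<bar>s\<bar> * (norm Z + 1))"
        by (intro order_trans[OF norm_blinfun_compose] mult_mono small u v) auto
      also have "\<dots> = \<bar>s\<bar> * (\<bar>s\<bar> * M)" by (simp add: M_def mult_ac)
      also have "\<dots> \<le> \<bar>s\<bar> * (e / 2)"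
      proof -
        have "\<bar>s\<bar> \<le> e / (2 * M)" using s by (simp add: d_def)
        then have "\<bar>s\<bar> * M \<le> e / 2" using M by (simp add: field_simps)
        then show ?thesis by (intro mult_left_mono) auto
      qed
      also have "c * \<bar>s\<bar> + c * \<bar>s\<bar> + \<bar>s\<bar> * (e / 2) = (2 * c + e / 2) * \<bar>s\<bar>" by (simp add: algebra_simps)
      also have "\<dots> \<le> e * \<bar>s\<bar>" using c by (intro mult_right_mono) auto
      finally show ?thesis using mult[OF u(1) v(1)] by auto
    qed
    moreover have "d > 0" using d1(1) d2(1) e M by (simp add: d_def)
    ultimately show "\<exists>d>0. \<forall>s. \<bar>s\<bar> < d \<longrightarrow> (\<exists>u\<in>G. norm (u - id_blinfun - s *\<^sub>R (W + Z)) \<le> e * \<bar>s\<bar>)"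
      by blast
  qed
next
  fix c :: real and W assume W: "W \<in> tangent"
  show "c *\<^sub>R W \<in> tangent"
    unfolding tangent_def
  proof (intro CollectI allI impI)
    fix e :: real assume e: "e > 0"
    \<comment> \<open>Adding 1 keeps the divisor positive for \<open>c = 0\<close>.\<close>
    define b where "b = \<bar>c\<bar> + 1"
    have b: "b > 0" "\<bar>c\<bar> \<le> b" by (auto simp: b_def)
    obtain d where d: "d > 0" "\<And>s. \<bar>s\<bar> < d \<Longrightarrow> \<exists>u\<in>G. norm (u - id_blinfun - s *\<^sub>R W) \<le> (e / b) * \<bar>s\<bar>"
      using tangentE[OF W, of "e / b"] e b by auto
    have "\<exists>u\<in>G. norm (u - id_blinfun - s *\<^sub>R c *\<^sub>R W) \<le> e * \<bar>s\<bar>" if "\<bar>s\<bar> < d / b" for s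
    proof -
      have "\<bar>s * c\<bar> \<le> \<bar>s\<bar> * b" using b by (simp add: abs_mult mult_left_mono)
      also have "\<dots> < d" using that b by (simp add: field_simps)
      finally obtain u where u: "u \<in> G" "norm (u - id_blinfun - (s * c) *\<^sub>R W) \<le> (e / b) * \<bar>s * c\<bar>"
        using d(2) by blast
      have "(e / b) * \<bar>s * c\<bar> \<le> (e / b) * (\<bar>s\<bar> * b)"
        using b e by (intro mult_left_mono) (auto simp: abs_mult mult_left_mono)
      also have "\<dots> = e * \<bar>s\<bar>" using b by simp
      finally show ?thesis using u by (intro bexI[of _ u]) auto
    qed
    then show "\<exists>d>0. \<forall>s. \<bar>s\<bar> < d \<longrightarrow> (\<exists>u\<in>G. norm (u - id_blinfun - s *\<^sub>R c *\<^sub>R W) \<le> e * \<bar>s\<bar>)"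
      using d(1) b by (intro exI[of _ "d / b"]) auto
  qed
qed

end

section \<open>Charts\<close>

locale operator_group_basis = operator_group +
  fixes n :: nat and Y :: "nat \<Rightarrow> ('a \<Rightarrow>\<^sub>L 'a)" and p :: "nat \<Rightarrow> ('a \<Rightarrow>\<^sub>L 'a) \<Rightarrow> real"
  assumes basis: "biorthogonal tangent n Y p"
begin

lemmas Y = biorthogonalD(1)[OF basis] and p_linear = biorthogonalD(2)[OF basis]
  and p_Y = biorthogonalD(3)[OF basis] and p_expand = biorthogonalD(4)[OF basis]

definition vec :: "(nat \<Rightarrow> real) \<Rightarrow> ('a \<Rightarrow>\<^sub>L 'a)"
  where "vec y = (\<Sum>k<n. y k *\<^sub>R Y k)"

definition P :: "('a \<Rightarrow>\<^sub>L 'a) \<Rightarrow> ('a \<Rightarrow>\<^sub>L 'a)"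
  where "P A = vec (\<lambda>k. p k A)"

lemma vec_tangent: "vec y \<in> tangent"
  unfolding vec_def by (intro subspace_sum tangent_subspace subspace_scale Y) auto

lemma P_tangent: "P A \<in> tangent"
  unfolding P_def by (rule vec_tangent)

lemma P_id: "W \<in> tangent \<Longrightarrow> P W = W"
  unfolding P_def vec_def by (rule p_expand)

lemma p_vec: "k < n \<Longrightarrow> p k (vec y) = y k"
proof -
  assume k: "k < n"
  interpret bounded_linear "p k" by (rule p_linear[OF k])
  have "p k (vec y) = (\<Sum>j<n. if j = k then y j else 0)"
    unfolding vec_def sum scaleR by (rule sum.cong) (auto simp: p_Y k)
  then show ?thesis using k by simp
qed

lemma P_linear: "bounded_linear P"
  unfolding P_def[abs_def] vec_def
  by (intro bounded_linear_sum bounded_linear_compose[OF bounded_linear_scaleR_left] p_linear) simp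

lemma norm_P_le: "norm (P A) \<le> onorm P * norm A"
  by (rule onorm[OF P_linear])

lemma tangent_closed: "closed tangent"
proof -
  have "tangent = {A. P A = A}"
  proof (intro subset_antisym subsetI CollectI)
    show "A \<in> tangent" if "A \<in> {A. P A = A}" for A
      using that P_tangent[of A] by simp
  qed (rule P_id)
  then show ?thesis
    using closed_Collect_eq[OF linear_continuous_on[OF P_linear] continuous_on_id] by simp
qed

text \<open>If the projection to the tangent space contracted a sequence of differences \<open>g - h\<close> near the
  identity, the normalised elements \<open>h\<^sup>-\<^sup>1 g - 1\<close> would accumulate at a tangent vector in its kernel.\<close>

lemma local_injectivity:
  "\<exists>r>0. \<exists>C>0. \<forall>g\<in>G. \<forall>h\<in>G. norm (g - id_blinfun) \<le> r \<longrightarrow> norm (h - id_blinfun) \<le> r \<longrightarrow>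
    norm (g - h) \<le> C * norm (P (g - h))"
proof (rule ccontr)
  assume contra: "\<not> ?thesis"
  have "\<exists>g h. g \<in> G \<and> h \<in> G \<and> norm (g - id_blinfun) \<le> 1 / real (Suc k) \<and> norm (h - id_blinfun) \<le> 1 / real (Suc k) \<and>
      real (Suc k) * norm (P (g - h)) < norm (g - h)" for k
  proof (rule ccontr)
    assume "\<not> ?thesis"
    then have "\<forall>g\<in>G. \<forall>h\<in>G. norm (g - id_blinfun) \<le> 1 / real (Suc k) \<longrightarrow> norm (h - id_blinfun) \<le> 1 / real (Suc k) \<longrightarrow>
      norm (g - h) \<le> real (Suc k) * norm (P (g - h))" by (meson not_le)
    moreover have "1 / real (Suc k) > 0" "real (Suc k) > 0" by simp_all
    ultimately show False using contra by blast
  qed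
  then obtain g h where g: "\<And>k. g k \<in> G" and h: "\<And>k. h k \<in> G"
    and g1: "\<And>k. norm (g k - id_blinfun) \<le> 1 / real (Suc k)"
    and h1: "\<And>k. norm (h k - id_blinfun) \<le> 1 / real (Suc k)"
    and gh: "\<And>k. real (Suc k) * norm (P (g k - h k)) < norm (g k - h k)"
    by metis
  have zero: "(\<lambda>k. 1 / real (Suc k)) \<longlonglongrightarrow> 0"
    using LIMSEQ_inverse_real_of_nat by (simp add: inverse_eq_divide)
  have limit_one: "f \<longlonglongrightarrow> id_blinfun" if "\<And>k. norm (f k - id_blinfun) \<le> 1 / real (Suc k)"
    for f :: "nat \<Rightarrow> ('a \<Rightarrow>\<^sub>L 'a)"
    by (rule LIM_zero_cancel, rule Lim_null_comparison[OF _ zero]) (use that in simp)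
  define \<tau> where "\<tau> k = norm (g k - h k)" for k
  have \<tau>0: "\<tau> k > 0" for k
    using gh[of k] norm_ge_zero[of "P (g k - h k)"] unfolding \<tau>_def
    by (meson le_less_trans mult_nonneg_nonneg of_nat_0_le_iff)
  have "(\<lambda>k. norm (g k - h k)) \<longlonglongrightarrow> norm (id_blinfun - id_blinfun :: 'a \<Rightarrow>\<^sub>L 'a)"
    by (intro tendsto_norm tendsto_diff limit_one g1 h1)
  then have \<tau>lim: "\<tau> \<longlonglongrightarrow> 0" unfolding \<tau>_def[abs_def] by simp
  \<comment> \<open>Since \<open>h k (u k - 1) = g k - h k\<close> and \<open>h k\<close> is
    isometric, the difference becomes the deviation from 1 of a single element of \<open>G\<close>,
    with the same norm; this is the form required by \<open>tangent_sequence\<close>.\<close>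
  define u where "u k = \<sigma> (h k) o\<^sub>L g k" for k
  have u: "u k \<in> G" for k unfolding u_def by (intro mult inv g h)
  have hu: "h k o\<^sub>L (u k - id_blinfun) = g k - h k" for k
    by (rule blinfun_eqI) (simp add: u_def blinfun.bilinear_simps inv_apply h)
  define X where "X k = (1 / \<tau> k) *\<^sub>R (u k - id_blinfun)" for k
  have normX: "norm (X k) = 1" for k
  proof -
    have "norm (u k - id_blinfun) = \<tau> k" unfolding \<tau>_def hu[symmetric] by (rule norm_G_compose[OF h, symmetric])
    then show ?thesis using \<tau>0[of k] unfolding X_def norm_scaleR by simp
  qed
  have XE: "X k \<in> E" for k
    unfolding X_def by (rule subspace_scale[OF E_subspace G_minus_one[OF u]])
  have "compact (E \<inter> {A. norm A = 1})"
  proof (rule E_compact)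
    show "closed (E \<inter> {A. norm A = 1})"
      by (intro closed_Int E_closed closed_Collect_eq continuous_on_norm continuous_on_id continuous_on_const)
    show "bounded (E \<inter> {A. norm A = 1})" unfolding bounded_iff by (intro exI[of _ 1]) simp
  qed simp
  then have "seq_compact (E \<inter> {A. norm A = 1})" by (rule compact_imp_seq_compact)
  moreover have "\<forall>k. X k \<in> E \<inter> {A. norm A = 1}" using XE normX by simp
  ultimately obtain W \<rho> where W: "W \<in> E \<inter> {A. norm A = 1}" and \<rho>: "strict_mono \<rho>" and lim: "(X \<circ> \<rho>) \<longlonglongrightarrow> W"
    by (rule seq_compactE)
  have "W \<in> tangent"
  proof (rule tangent_sequence)
    show "u (\<rho> k) \<in> G" "\<tau> (\<rho> k) > 0" for k by (rule u, rule \<tau>0)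
    show "(\<lambda>k. \<tau> (\<rho> k)) \<longlonglongrightarrow> 0" using LIMSEQ_subseq_LIMSEQ[OF \<tau>lim \<rho>] by (simp add: o_def)
    show "(\<lambda>k. (1 / \<tau> (\<rho> k)) *\<^sub>R (u (\<rho> k) - id_blinfun)) \<longlonglongrightarrow> W"
      using lim unfolding X_def o_def .
  qed
  have "(\<lambda>k. h (\<rho> k)) \<longlonglongrightarrow> id_blinfun"
    using LIMSEQ_subseq_LIMSEQ[OF limit_one[OF h1] \<rho>] by (simp add: o_def)
  then have "(\<lambda>k. h (\<rho> k) o\<^sub>L X (\<rho> k)) \<longlonglongrightarrow> (id_blinfun o\<^sub>L W)"
    using lim unfolding o_def by (intro bounded_bilinear.tendsto[OF bounded_bilinear_blinfun_compose])
  moreover have "id_blinfun o\<^sub>L W = W" by (rule blinfun_eqI) simp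
  ultimately have "(\<lambda>k. P (h (\<rho> k) o\<^sub>L X (\<rho> k))) \<longlonglongrightarrow> P W"
    using bounded_linear.tendsto[OF P_linear] by metis
  moreover have "(\<lambda>k. P (h (\<rho> k) o\<^sub>L X (\<rho> k))) \<longlonglongrightarrow> 0"
  proof -
    have "norm (P (h k o\<^sub>L X k)) \<le> 1 / real (Suc k)" for k
    proof -
      have "h k o\<^sub>L X k = (1 / \<tau> k) *\<^sub>R (g k - h k)"
        unfolding X_def compose_scaleR_right hu ..
      then have "norm (P (h k o\<^sub>L X k)) = (1 / \<tau> k) * norm (P (g k - h k))"
        using linear_scale[OF bounded_linear.linear[OF P_linear]] \<tau>0[of k] by simp
      also have "\<dots> \<le> (1 / \<tau> k) * (\<tau> k / real (Suc k))"
        using gh[of k] \<tau>0[of k] unfolding \<tau>_def by (intro mult_left_mono) (auto simp: field_simps)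
      also have "\<dots> = 1 / real (Suc k)" using \<tau>0[of k] by simp
      finally show ?thesis .
    qed
    then have "(\<lambda>k. P (h k o\<^sub>L X k)) \<longlonglongrightarrow> 0"
      by (intro Lim_null_comparison[OF _ zero]) simp
    from LIMSEQ_subseq_LIMSEQ[OF this \<rho>] show ?thesis by (simp add: o_def)
  qed
  ultimately have "P W = 0" using LIMSEQ_unique by blast
  then show False using P_id[OF \<open>W \<in> tangent\<close>] W by simp
qed

end

text \<open>\<open>onorm P * r \<le> 1 / 2\<close> keeps \<open>W \<mapsto> P (g W)\<close> within
  half of the identity on the tangent space for \<open>g\<close> in the ball of radius
  \<open>r\<close>, hence invertible there; \<open>C\<close> becomes a Lipschitz constant for the
  inverse chart.\<close>

locale operator_group_chart = operator_group_basis +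
  fixes r C :: real
  assumes r: "r > 0" "onorm P * r \<le> 1 / 2" and C: "C > 0"
    and P_inj: "\<lbrakk>g \<in> G; h \<in> G; norm (g - id_blinfun) \<le> r; norm (h - id_blinfun) \<le> r\<rbrakk>
      \<Longrightarrow> norm (g - h) \<le> C * norm (P (g - h))"
begin

definition N :: "('a \<Rightarrow>\<^sub>L 'a) set"
  where "N = {g \<in> G. norm (g - id_blinfun) < r}"

definition \<phi> :: "('a \<Rightarrow>\<^sub>L 'a) \<Rightarrow> nat \<Rightarrow> real"
  where "\<phi> g k = (if k < n then p k (g - id_blinfun) else 0)"

definition \<Omega> :: "(nat \<Rightarrow> real) set"
  where "\<Omega> = \<phi> ` N"

definition \<psi> :: "(nat \<Rightarrow> real) \<Rightarrow> ('a \<Rightarrow>\<^sub>L 'a)"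
  where "\<psi> = inv_into N \<phi>"

lemma NG: "g \<in> N \<Longrightarrow> g \<in> G" and N_le: "g \<in> N \<Longrightarrow> norm (g - id_blinfun) \<le> r"
  by (auto simp: N_def)

lemma vec_\<phi>: "vec (\<phi> g) = P (g - id_blinfun)"
  unfolding vec_def P_def \<phi>_def by (rule sum.cong) auto

lemma P_diff: "P (A - A') = P A - P A'"
  by (rule linear_diff[OF bounded_linear.linear[OF P_linear]])

lemma P_scaleR: "P (c *\<^sub>R A) = c *\<^sub>R P A"
  by (rule linear_scale[OF bounded_linear.linear[OF P_linear]])

lemma vec_\<phi>_diff: "P (g - h) = vec (\<phi> g) - vec (\<phi> h)"
  unfolding vec_\<phi> P_diff by simp

lemma \<phi>_inj: "inj_on \<phi> N"
proof (rule inj_onI)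
  fix g h assume gh: "g \<in> N" "h \<in> N" "\<phi> g = \<phi> h"
  have "norm (g - h) \<le> C * norm (P (g - h))" using gh by (intro P_inj NG N_le)
  also have "P (g - h) = 0" unfolding vec_\<phi>_diff gh(3) by simp
  finally show "g = h" by simp
qed

lemma \<psi>_N: "x \<in> \<Omega> \<Longrightarrow> \<psi> x \<in> N" and \<phi>_\<psi>: "x \<in> \<Omega> \<Longrightarrow> \<phi> (\<psi> x) = x"
  unfolding \<Omega>_def \<psi>_def by (rule inv_into_into, assumption) (rule f_inv_into_f)

lemma \<psi>_\<phi>: "g \<in> N \<Longrightarrow> \<psi> (\<phi> g) = g"
  unfolding \<psi>_def by (rule inv_into_f_f[OF \<phi>_inj])

lemma \<psi>_G: "x \<in> \<Omega> \<Longrightarrow> \<psi> x \<in> G"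
  using \<psi>_N NG by blast

lemma \<Omega>_support: "x \<in> \<Omega> \<Longrightarrow> i \<ge> n \<Longrightarrow> x i = 0"
  by (auto simp: \<Omega>_def \<phi>_def)

lemma \<psi>_dist: "x \<in> \<Omega> \<Longrightarrow> y \<in> \<Omega> \<Longrightarrow> norm (\<psi> x - \<psi> y) \<le> C * norm (vec x - vec y)"
  using P_inj[of "\<psi> x" "\<psi> y"] \<psi>_N NG N_le vec_\<phi>_diff[of "\<psi> x" "\<psi> y"] by (simp add: \<phi>_\<psi>)

lemma P_near_id:
  assumes g: "norm (g - id_blinfun) \<le> r" and Z: "Z \<in> tangent"
  shows "norm (P (g o\<^sub>L Z) - Z) \<le> norm Z / 2"
proof -
  have "P (g o\<^sub>L Z) - Z = P ((g - id_blinfun) o\<^sub>L Z)"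
  proof -
    have "(g - id_blinfun) o\<^sub>L Z = (g o\<^sub>L Z) - Z"
      by (rule blinfun_eqI) (simp add: blinfun.bilinear_simps)
    then show ?thesis by (simp add: P_diff P_id[OF Z])
  qed
  also have "norm \<dots> \<le> onorm P * norm ((g - id_blinfun) o\<^sub>L Z)" by (rule norm_P_le)
  also have "\<dots> \<le> onorm P * (r * norm Z)"
    by (intro mult_left_mono order_trans[OF norm_blinfun_compose] mult_right_mono g onorm_pos_le P_linear) auto
  also have "\<dots> \<le> 1 / 2 * norm Z"
    unfolding mult.assoc[symmetric] by (intro mult_right_mono r) auto
  finally show ?thesis by simp
qed

text \<open>At a point of \<open>G\<close> near the identity where the distance from \<open>P (g - 1)\<close> to a given small
  tangent vector is minimal, this distance vanishes, as one could otherwise move \<open>g\<close> in the direction of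
  the difference.\<close>

lemma \<phi>_open:
  assumes g0: "g0 \<in> N"
  obtains \<eta> where "\<eta> > 0" and "\<And>Z. Z \<in> tangent \<Longrightarrow> norm (Z - P (g0 - id_blinfun)) < \<eta> \<Longrightarrow>
    \<exists>g\<in>N. P (g - id_blinfun) = Z"
proof -
  \<comment> \<open>At \<open>g0\<close> and at the minimiser \<open>g\<close> the distance to
    \<open>Z\<close> is below \<open>\<eta>\<close>, so
    \<open>norm (g - g0) < 2 * C * \<eta>\<close>. This is the room between \<open>g0\<close> and
    the sphere of radius \<open>r\<close>, so \<open>g\<close> is interior.\<close>
  define \<eta> where "\<eta> = (r - norm (g0 - id_blinfun)) / (2 * C)"
  have "\<eta> > 0" using g0 C by (simp add: \<eta>_def N_def)
  moreover have "\<exists>g\<in>N. P (g - id_blinfun) = Z" if Z: "Z \<in> tangent" and near: "norm (Z - P (g0 - id_blinfun)) < \<eta>" for Z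
  proof -
    define K where "K = G \<inter> cball id_blinfun r"
    have K: "g \<in> K \<longleftrightarrow> g \<in> G \<and> norm (g - id_blinfun) \<le> r" for g
      by (auto simp: K_def dist_norm norm_minus_commute)
    have "compact K" unfolding K_def by (intro compact_Int_closed compact_G closed_cball)
    moreover have "K \<noteq> {}" using g0 K NG N_le by blast
    moreover have "continuous_on K (\<lambda>g. norm (Z - P (g - id_blinfun)))"
      by (intro continuous_on_norm continuous_on_diff continuous_on_const
          continuous_on_compose2[OF linear_continuous_on[OF P_linear, of UNIV]] continuous_on_id) auto
    ultimately obtain g where g: "g \<in> K"
      and min: "\<And>h. h \<in> K \<Longrightarrow> norm (Z - P (g - id_blinfun)) \<le> norm (Z - P (h - id_blinfun))"
      using continuous_attains_inf[of K "\<lambda>g. norm (Z - P (g - id_blinfun))"] by blast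
    have gG: "g \<in> G" and gr: "norm (g - id_blinfun) \<le> r" using g K by auto
    define D where "D = Z - P (g - id_blinfun)"
    have D: "D \<in> tangent" unfolding D_def by (intro subspace_diff tangent_subspace Z P_tangent)
    have "g0 \<in> K" using g0 K NG N_le by blast
    then have D_le: "norm D < \<eta>" using min[of g0] near unfolding D_def by linarith
    have "norm (g - g0) \<le> C * norm (P (g - g0))"
      using P_inj[OF gG NG[OF g0] gr N_le[OF g0]] .
    also have "P (g - g0) = (Z - P (g0 - id_blinfun)) - D"
      unfolding D_def by (simp add: P_diff)
    also have "norm \<dots> \<le> norm (Z - P (g0 - id_blinfun)) + norm D" by (rule norm_triangle_ineq4)
    also have "\<dots> < 2 * \<eta>" using near D_le by simp
    finally have "norm (g - g0) < C * (2 * \<eta>)" using C by simp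
    also have "\<dots> = r - norm (g0 - id_blinfun)" using C by (simp add: \<eta>_def)
    finally have "norm (g - g0) + norm (g0 - id_blinfun) < r" by simp
    then have gN: "norm (g - id_blinfun) < r"
      using norm_triangle_ineq[of "g - g0" "g0 - id_blinfun"] by simp
    have "D = 0"
    proof (rule ccontr)
      assume "D \<noteq> 0"
      \<comment> \<open>A step of length \<open>s\<close> along \<open>D\<close> brings the distance
        down to at most \<open>(1 - s + s/2 + s/4) * norm D\<close>: the half comes from
        \<open>P_near_id\<close>, the quarter from the error of \<open>u\<close>, controlled by
        \<open>e\<close>.\<close>
      define e where "e = norm D / (4 * (onorm P + 1))"
      have oP: "onorm P \<ge> 0" by (rule onorm_pos_le[OF P_linear])
      have e: "e > 0" using \<open>D \<noteq> 0\<close> oP by (simp add: e_def add_nonneg_pos)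
      have oPe: "onorm P * e \<le> norm D / 4"
      proof -
        have "onorm P * e \<le> (onorm P + 1) * e" using e by (simp add: algebra_simps)
        also have "\<dots> = norm D / 4"
        proof -
          have quarter: "M * (c / (4 * M)) = c / 4" if "M > 0" for M c :: real using that by simp
          show ?thesis unfolding e_def by (rule quarter) (use oP in simp)
        qed
        finally show ?thesis .
      qed
      obtain d where d: "d > 0" "\<And>s. \<bar>s\<bar> < d \<Longrightarrow> \<exists>u\<in>G. norm (u - id_blinfun - s *\<^sub>R D) \<le> e * \<bar>s\<bar>"
        using tangentE[OF D e] by blast
      define b where "b = norm D + e"
      have b: "b > 0" using e by (simp add: b_def add_nonneg_pos)
      \<comment> \<open>\<open>s < d\<close> provides \<open>u\<close>, \<open>s \<le> 1\<close>
        keeps \<open>1 - s\<close> nonnegative, and the last bound leaves \<open>g u\<close> in the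
        ball, as \<open>norm (u - 1) \<le> s * b\<close>.\<close>
      define s where "s = min (min 1 (d / 2)) ((r - norm (g - id_blinfun)) / b)"
      have s: "s > 0" "s < d" "s \<le> 1" "s * b \<le> r - norm (g - id_blinfun)"
      proof -
        show "s > 0" using d(1) gN b by (simp add: s_def)
        have "s \<le> min 1 (d / 2)" unfolding s_def by (rule min.cobounded1)
        then show "s < d" "s \<le> 1" using d(1) by auto
        have "s \<le> (r - norm (g - id_blinfun)) / b" unfolding s_def by (rule min.cobounded2)
        then show "s * b \<le> r - norm (g - id_blinfun)" using b by (simp add: pos_le_divide_eq)
      qed
      obtain u where u: "u \<in> G" "norm (u - id_blinfun - s *\<^sub>R D) \<le> e * s"
        using d(2)[of s] s by auto
      have "norm (u - id_blinfun) \<le> norm (u - id_blinfun - s *\<^sub>R D) + norm (s *\<^sub>R D)"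
        using norm_triangle_ineq[of "u - id_blinfun - s *\<^sub>R D" "s *\<^sub>R D"] by simp
      also have "\<dots> \<le> s * b" using u(2) s(1) by (simp add: b_def algebra_simps)
      also have "\<dots> \<le> r - norm (g - id_blinfun)" by (rule s(4))
      finally have u1: "norm (u - id_blinfun) \<le> r - norm (g - id_blinfun)" .
      have gu: "(g o\<^sub>L u) - g = g o\<^sub>L (u - id_blinfun)"
        by (rule blinfun_eqI) (simp add: blinfun.bilinear_simps)
      have "norm ((g o\<^sub>L u) - id_blinfun) \<le> norm ((g o\<^sub>L u) - g) + norm (g - id_blinfun)"
        using norm_triangle_ineq[of "(g o\<^sub>L u) - g" "g - id_blinfun"] by simp
      then have guK: "g o\<^sub>L u \<in> K"
        unfolding K gu norm_G_compose[OF gG] using u1 mult[OF gG u(1)] by simp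
      have "Z - P ((g o\<^sub>L u) - id_blinfun) = D - P (g o\<^sub>L (u - id_blinfun))"
        unfolding D_def gu[symmetric] P_diff by simp
      also have "g o\<^sub>L (u - id_blinfun) = s *\<^sub>R (g o\<^sub>L D) + (g o\<^sub>L (u - id_blinfun - s *\<^sub>R D))"
        by (rule blinfun_eqI) (simp add: blinfun.bilinear_simps)
      also have "D - P \<dots> = (1 - s) *\<^sub>R D - s *\<^sub>R (P (g o\<^sub>L D) - D) - P (g o\<^sub>L (u - id_blinfun - s *\<^sub>R D))"
        by (simp add: linear_add[OF bounded_linear.linear[OF P_linear]] P_scaleR algebra_simps)
      finally have eq: "Z - P ((g o\<^sub>L u) - id_blinfun) = \<dots>" .
      have n1: "norm ((1 - s) *\<^sub>R D) \<le> (1 - s) * norm D" using s by simp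
      have n2: "norm (s *\<^sub>R (P (g o\<^sub>L D) - D)) \<le> s * (norm D / 2)"
        using P_near_id[OF gr D] s(1) by (simp add: mult_left_mono)
      have n3: "norm (P (g o\<^sub>L (u - id_blinfun - s *\<^sub>R D))) \<le> s * (norm D / 4)"
      proof -
        have "norm (P (g o\<^sub>L (u - id_blinfun - s *\<^sub>R D))) \<le> onorm P * norm (g o\<^sub>L (u - id_blinfun - s *\<^sub>R D))"
          by (rule norm_P_le)
        also have "\<dots> \<le> onorm P * (e * s)"
          unfolding norm_G_compose[OF gG] by (intro mult_left_mono u oP)
        also have "\<dots> = s * (onorm P * e)" by simp
        also have "\<dots> \<le> s * (norm D / 4)" using oPe s(1) by (intro mult_left_mono) auto
        finally show ?thesis .
      qed
      have "norm (Z - P ((g o\<^sub>L u) - id_blinfun)) \<le> (1 - s) * norm D + s * (norm D / 2) + s * (norm D / 4)"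
        unfolding eq by (intro order_trans[OF norm_triangle_ineq4] add_mono n1 n2 n3)
      also have "\<dots> = norm D - s * (norm D / 4)" by (simp add: algebra_simps)
      also have "\<dots> < norm D" using s(1) \<open>D \<noteq> 0\<close> by simp
      finally show False using min[OF guK] unfolding D_def by simp
    qed
    then show ?thesis using gN gG by (intro bexI[of _ g]) (auto simp: D_def N_def)
  qed
  ultimately show thesis by (rule that)
qed

end

context operator_group_chart
begin

lemma vec_continuous: "continuous_on S vec"
  unfolding vec_def[abs_def]
  by (intro continuous_on_sum continuous_on_scaleR continuous_on_const)
    (rule continuous_on_subset[OF continuous_on_product_coordinates], simp)

text \<open>This is \<open>\<phi>_open\<close> in coordinates: the functionals \<open>p k\<close>
  recover a sequence supported below \<open>n\<close> from its image under
  \<open>vec\<close>.\<close>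

lemma \<Omega>_nbhd:
  assumes x: "x \<in> \<Omega>"
  obtains d where "d > 0" and "\<And>y. (\<And>i. i \<ge> n \<Longrightarrow> y i = 0) \<Longrightarrow> norm (vec y - vec x) < d \<Longrightarrow> y \<in> \<Omega>"
proof -
  obtain d where d: "d > 0" "\<And>Z. Z \<in> tangent \<Longrightarrow> norm (Z - P (\<psi> x - id_blinfun)) < d \<Longrightarrow>
    \<exists>g\<in>N. P (g - id_blinfun) = Z"
    using \<phi>_open[OF \<psi>_N[OF x]] by blast
  have "y \<in> \<Omega>" if y: "\<And>i. i \<ge> n \<Longrightarrow> y i = 0" and near: "norm (vec y - vec x) < d" for y
  proof -
    have "P (\<psi> x - id_blinfun) = vec x" using vec_\<phi>[of "\<psi> x"] by (simp add: \<phi>_\<psi>[OF x])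
    then obtain g where g: "g \<in> N" "P (g - id_blinfun) = vec y"
      using d(2)[OF vec_tangent[of y]] near by auto
    have "\<phi> g = y"
    proof
      fix k
      show "\<phi> g k = y k"
      proof (cases "k < n")
        case True
        then show ?thesis using p_vec[OF True, of y] p_vec[OF True, of "\<phi> g"] g(2) by (simp add: vec_\<phi>)
      qed (simp add: y \<phi>_def)
    qed
    then show ?thesis using g(1) by (auto simp: \<Omega>_def)
  qed
  then show thesis using d(1) that by blast
qed

lemma \<Omega>_open: "openin (Euclidean_space n) \<Omega>"
  unfolding Euclidean_space_eq openin_subopen[of _ \<Omega>]
proof
  fix x assume x: "x \<in> \<Omega>"
  obtain d where d: "d > 0" "\<And>y. (\<And>i. i \<ge> n \<Longrightarrow> y i = 0) \<Longrightarrow> norm (vec y - vec x) < d \<Longrightarrow> y \<in> \<Omega>"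
    using \<Omega>_nbhd[OF x] by blast
  let ?T = "{y. norm (vec y - vec x) < d}"
  have "open ?T"
    by (intro open_Collect_less continuous_on_norm continuous_on_diff vec_continuous continuous_on_const)
  then have "openin (top_of_set {x. \<forall>i\<ge>n. x i = 0}) ({x. \<forall>i\<ge>n. x i = 0} \<inter> ?T)"
    by (rule openin_open_Int)
  moreover have "x \<in> {x. \<forall>i\<ge>n. x i = 0} \<inter> ?T" using x \<Omega>_support d(1) by simp
  moreover have "{x. \<forall>i\<ge>n. x i = 0} \<inter> ?T \<subseteq> \<Omega>" using d(2) by blast
  ultimately show "\<exists>T. openin (top_of_set {x. \<forall>i\<ge>n. x i = 0}) T \<and> x \<in> T \<and> T \<subseteq> \<Omega>" by blast
qed

lemma \<Omega>_line:
  assumes "x \<in> \<Omega>" "i < n"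
  obtains d where "d > 0" and "\<And>t. \<bar>t - x i\<bar> < d \<Longrightarrow> x(i := t) \<in> \<Omega>"
  using openin_Euclidean_line[OF \<Omega>_open assms] by blast

lemma \<psi>_continuous: "continuous_on \<Omega> \<psi>"
  unfolding continuous_on_iff
proof (intro ballI allI impI)
  fix x and e :: real assume x: "x \<in> \<Omega>" and e: "e > 0"
  have "e / C > 0" using e C by simp
  then obtain d where d: "d > 0" "\<And>y. y \<in> \<Omega> \<Longrightarrow> dist y x < d \<Longrightarrow> dist (vec y) (vec x) < e / C"
    using vec_continuous[of \<Omega>] x unfolding continuous_on_iff by metis
  have "dist (\<psi> y) (\<psi> x) < e" if "y \<in> \<Omega>" "dist y x < d" for y
  proof -
    have "C * norm (vec y - vec x) < C * (e / C)"
      using d(2)[OF that] C by (intro mult_strict_left_mono) (auto simp: dist_norm)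
    also have "\<dots> = e" using C by simp
    finally show ?thesis using \<psi>_dist[OF that(1) x] by (simp add: dist_norm)
  qed
  then show "\<exists>d>0. \<forall>y\<in>\<Omega>. dist y x < d \<longrightarrow> dist (\<psi> y) (\<psi> x) < e" using d(1) by blast
qed

section \<open>The coordinate frame translated to the identity, and derivatives of the inverse
  chart\<close>

definition Z :: "('a \<Rightarrow>\<^sub>L 'a) \<Rightarrow> nat \<Rightarrow> ('a \<Rightarrow>\<^sub>L 'a)"
  where "Z g i = (SOME W. W \<in> tangent \<and> P (g o\<^sub>L W) = Y i)"

text \<open>A fixed point of \<open>W \<mapsto> Y i - (P (g W) - W)\<close> solves the equation, and
  \<open>P_near_id\<close> makes this map a contraction with factor \<open>1/2\<close> on the
  complete tangent space.\<close>

lemma Z_exists: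
  assumes g: "norm (g - id_blinfun) \<le> r" and i: "i < n"
  shows "\<exists>W. W \<in> tangent \<and> P (g o\<^sub>L W) = Y i"
proof -
  define f where "f W = Y i - (P (g o\<^sub>L W) - W)" for W
  have "\<exists>!W\<in>tangent. f W = W"
  proof (rule Banach_fix[where c = "1/2"])
    show "complete tangent" using tangent_closed by (simp add: complete_eq_closed)
    show "tangent \<noteq> {}" using Y[OF i] by blast
    show "f ` tangent \<subseteq> tangent"
      unfolding f_def by (intro image_subsetI subspace_diff tangent_subspace P_tangent Y i)
    fix V W assume VW: "V \<in> tangent" "W \<in> tangent"
    have "f V - f W = P (g o\<^sub>L (W - V)) - (W - V)"
      by (simp add: f_def compose_diff_right P_diff algebra_simps)
    also have "norm \<dots> \<le> norm (W - V) / 2"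
      by (intro P_near_id g subspace_diff tangent_subspace VW)
    finally show "dist (f V) (f W) \<le> 1 / 2 * dist V W"
      by (simp add: dist_norm norm_minus_commute)
  qed simp_all
  then obtain W where "W \<in> tangent" "f W = W" by blast
  then show ?thesis by (intro exI[of _ W]) (simp add: f_def algebra_simps)
qed

lemma Z_tangent: "norm (g - id_blinfun) \<le> r \<Longrightarrow> i < n \<Longrightarrow> Z g i \<in> tangent"
  and P_Z: "norm (g - id_blinfun) \<le> r \<Longrightarrow> i < n \<Longrightarrow> P (g o\<^sub>L Z g i) = Y i"
  using someI_ex[OF Z_exists, folded Z_def] by blast+

text \<open>Quantitative injectivity of \<open>W \<mapsto> P (g W)\<close> on the tangent space; it
  yields uniqueness in the definition of \<open>Z\<close> and the dependence of \<open>Z\<close> on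
  \<open>g\<close>.\<close>

lemma tangent_norm_le:
  assumes g: "norm (g - id_blinfun) \<le> r" and W: "W \<in> tangent"
  shows "norm W \<le> 2 * norm (P (g o\<^sub>L W))"
  using P_near_id[OF g W] norm_triangle_ineq2[of W "P (g o\<^sub>L W)"]
  by (simp add: norm_minus_commute)

lemma P_diff_Z:
  assumes g: "norm (g - id_blinfun) \<le> r" and h: "norm (h - id_blinfun) \<le> r" and i: "i < n"
  shows "P (g o\<^sub>L (Z h i - Z g i)) = - P ((h - g) o\<^sub>L Z h i)"
proof -
  have "g o\<^sub>L (Z h i - Z g i) = ((h o\<^sub>L Z h i) - (g o\<^sub>L Z g i)) - ((h - g) o\<^sub>L Z h i)"
    by (rule blinfun_eqI) (simp add: blinfun.bilinear_simps)
  then show ?thesis by (simp add: P_diff P_Z g h i)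
qed

text \<open>Of the constant 4, one factor 2 comes from inverting \<open>W \<mapsto> P (g W)\<close>
  and the other from the bound \<open>2 * norm (Y i)\<close> on \<open>Z h i\<close>.\<close>

lemma Z_lipschitz:
  assumes g: "norm (g - id_blinfun) \<le> r" and h: "norm (h - id_blinfun) \<le> r" and i: "i < n"
  shows "norm (Z h i - Z g i) \<le> 4 * onorm P * norm (Y i) * norm (h - g)"
proof -
  have "norm (Z h i - Z g i) \<le> 2 * norm (P ((h - g) o\<^sub>L Z h i))"
    using tangent_norm_le[OF g subspace_diff[OF tangent_subspace Z_tangent[OF h i] Z_tangent[OF g i]]]
    unfolding P_diff_Z[OF g h i] by simp
  also have "\<dots> \<le> 2 * (onorm P * (norm (h - g) * (2 * norm (Y i))))"
  proof -
    have "norm (Z h i) \<le> 2 * norm (Y i)" using tangent_norm_le[OF h Z_tangent[OF h i]] by (simp add: P_Z h i)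
    then have "norm ((h - g) o\<^sub>L Z h i) \<le> norm (h - g) * (2 * norm (Y i))"
      by (intro order_trans[OF norm_blinfun_compose] mult_left_mono) simp_all
    then show ?thesis
      by (intro mult_left_mono order_trans[OF norm_P_le] onorm_pos_le P_linear) simp_all
  qed
  finally show ?thesis by (simp add: mult_ac)
qed

text \<open>Both sides are tangent and have the same image under the injective map
  \<open>W \<mapsto> P (g W)\<close>. The formula is exact, so dividing it by an increment
  differentiates \<open>Z\<close>.\<close>

lemma Z_expand:
  assumes g: "norm (g - id_blinfun) \<le> r" and h: "norm (h - id_blinfun) \<le> r" and i: "i < n"
  shows "Z h i - Z g i = - (\<Sum>a<n. p a ((h - g) o\<^sub>L Z h i) *\<^sub>R Z g a)"
proof -
  let ?S = "\<Sum>a<n. p a ((h - g) o\<^sub>L Z h i) *\<^sub>R Z g a"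
  have S: "?S \<in> tangent"
    by (intro subspace_sum tangent_subspace subspace_scale Z_tangent g) simp
  have "P (g o\<^sub>L ?S) = (\<Sum>a<n. p a ((h - g) o\<^sub>L Z h i) *\<^sub>R P (g o\<^sub>L Z g a))"
    unfolding compose_sum_right compose_scaleR_right linear_sum[OF bounded_linear.linear[OF P_linear]] P_scaleR ..
  also have "\<dots> = (\<Sum>a<n. p a ((h - g) o\<^sub>L Z h i) *\<^sub>R Y a)"
    by (rule sum.cong) (auto simp: P_Z[OF g])
  also have "\<dots> = P ((h - g) o\<^sub>L Z h i)" by (simp add: P_def vec_def)
  finally have "P (g o\<^sub>L ((Z h i - Z g i) + ?S)) = 0"
    unfolding compose_add_right linear_add[OF bounded_linear.linear[OF P_linear]] P_diff_Z[OF g h i] by simp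
  moreover have "(Z h i - Z g i) + ?S \<in> tangent"
    by (intro subspace_add subspace_diff tangent_subspace S Z_tangent g h i)
  ultimately have "(Z h i - Z g i) + ?S = 0"
    using tangent_norm_le[OF g] by fastforce
  then show ?thesis by (simp only: eq_neg_iff_add_eq_0)
qed

text \<open>Both \<open>\<psi> (x + s e\<^sub>i)\<close> and \<open>\<psi> x\<close> times an element of \<open>G\<close> close to \<open>1 + s Z\<close> have
  nearly the same projection, hence are close to each other.\<close>

lemma \<psi>_derivative:
  assumes x: "x \<in> \<Omega>" and i: "i < n"
  shows "((\<lambda>t. \<psi> (x(i := t))) has_vector_derivative (\<psi> x o\<^sub>L Z (\<psi> x) i)) (at (x i))"
proof -
  define g W where "g = \<psi> x" and "W = Z (\<psi> x) i"
  have gN: "g \<in> N" unfolding g_def by (rule \<psi>_N[OF x])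
  then have gG: "g \<in> G" and gr: "norm (g - id_blinfun) \<le> r" by (rule NG, rule N_le)
  have W: "W \<in> tangent" and PW: "P (g o\<^sub>L W) = Y i"
    using Z_tangent[OF gr i] P_Z[OF gr i] by (simp_all add: W_def g_def)
  have oP: "onorm P \<ge> 0" by (rule onorm_pos_le[OF P_linear])
  have "\<exists>d>0. \<forall>t. norm (t - x i) < d \<longrightarrow>
      norm (\<psi> (x(i := t)) - \<psi> (x(i := x i)) - (t - x i) *\<^sub>R (g o\<^sub>L W)) \<le> e * norm (t - x i)"
    if e: "e > 0" for e
  proof -
    \<comment> \<open>The total error is \<open>(C * onorm P + 1) * c\<close> times the increment:
      the first part for passing from \<open>g u\<close> to \<open>\<psi>\<close> at the shifted
      point, the second for replacing \<open>u\<close> by its linearisation.\<close>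
    define c where "c = e / (C * onorm P + 1)"
    have CP: "C * onorm P + 1 > 0" using C oP by (simp add: add_nonneg_pos)
    have c: "c > 0" using e CP by (simp add: c_def)
    obtain d1 where d1: "d1 > 0" "\<And>s. \<bar>s\<bar> < d1 \<Longrightarrow> \<exists>u\<in>G. norm (u - id_blinfun - s *\<^sub>R W) \<le> c * \<bar>s\<bar>"
      using tangentE[OF W c] by blast
    obtain d2 where d2: "d2 > 0" "\<And>t. \<bar>t - x i\<bar> < d2 \<Longrightarrow> x(i := t) \<in> \<Omega>" using \<Omega>_line[OF x i] by blast
    define b where "b = norm W + c"
    have b: "b > 0" using c by (simp add: b_def add_nonneg_pos)
    define d3 where "d3 = (r - norm (g - id_blinfun)) / b"
    have d3: "d3 > 0" using gN b by (simp add: d3_def N_def)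
    have "norm (\<psi> (x(i := t)) - g - (t - x i) *\<^sub>R (g o\<^sub>L W)) \<le> e * \<bar>t - x i\<bar>"
      if t: "\<bar>t - x i\<bar> < d1" "\<bar>t - x i\<bar> < d2" "\<bar>t - x i\<bar> < d3" for t
    proof -
      define s where "s = t - x i"
      obtain u where u: "u \<in> G" "norm (u - id_blinfun - s *\<^sub>R W) \<le> c * \<bar>s\<bar>"
        using d1(2)[of s] t(1) by (auto simp: s_def)
      define h where "h = \<psi> (x(i := t))"
      have y: "x(i := t) \<in> \<Omega>" by (rule d2(2)[OF t(2)])
      have hN: "h \<in> N" unfolding h_def by (rule \<psi>_N[OF y])
      have "norm (u - id_blinfun) \<le> norm (u - id_blinfun - s *\<^sub>R W) + norm (s *\<^sub>R W)"
        using norm_triangle_ineq[of "u - id_blinfun - s *\<^sub>R W" "s *\<^sub>R W"] by simp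
      also have "\<dots> \<le> \<bar>s\<bar> * b" using u(2) by (simp add: b_def algebra_simps)
      also have "\<dots> \<le> r - norm (g - id_blinfun)"
        using t(3) b unfolding s_def d3_def by (simp add: pos_less_divide_eq)
      finally have u1: "norm (u - id_blinfun) \<le> r - norm (g - id_blinfun)" .
      have gu: "(g o\<^sub>L u) - g = g o\<^sub>L (u - id_blinfun)"
        by (rule blinfun_eqI) (simp add: blinfun.bilinear_simps)
      have "norm ((g o\<^sub>L u) - id_blinfun) \<le> norm ((g o\<^sub>L u) - g) + norm (g - id_blinfun)"
        using norm_triangle_ineq[of "(g o\<^sub>L u) - g" "g - id_blinfun"] by simp
      then have gur: "norm ((g o\<^sub>L u) - id_blinfun) \<le> r"
        unfolding gu norm_G_compose[OF gG] using u1 by simp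
      define \<delta> where "\<delta> = g o\<^sub>L (u - id_blinfun - s *\<^sub>R W)"
      have \<delta>: "norm \<delta> \<le> c * \<bar>s\<bar>" unfolding \<delta>_def norm_G_compose[OF gG] by (rule u(2))
      have gu': "g o\<^sub>L u = g + s *\<^sub>R (g o\<^sub>L W) + \<delta>"
        unfolding \<delta>_def by (rule blinfun_eqI) (simp add: blinfun.bilinear_simps)
      have "vec (x(i := t)) = vec x + s *\<^sub>R Y i"
      proof -
        have "vec (x(i := t)) = (\<Sum>k<n. x k *\<^sub>R Y k + (if k = i then s *\<^sub>R Y k else 0))"
          unfolding vec_def by (rule sum.cong) (auto simp: s_def algebra_simps)
        then show ?thesis using i by (simp add: sum.distrib vec_def)
      qed
      \<comment> \<open>In the chart the point moves by \<open>s *\<^sub>R Y i\<close>, and so does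
        the projection of \<open>g + s g W\<close>; hence \<open>g u\<close> and \<open>h\<close>
        differ under \<open>P\<close> only by the error \<open>\<delta>\<close>.\<close>
      then have "P (h - g) = s *\<^sub>R Y i"
        unfolding vec_\<phi>_diff by (simp add: h_def g_def \<phi>_\<psi> x y)
      then have "P ((g o\<^sub>L u) - h) = P \<delta>"
      proof -
        assume h: "P (h - g) = s *\<^sub>R Y i"
        have "(g o\<^sub>L u) - h = (s *\<^sub>R (g o\<^sub>L W) + \<delta>) - (h - g)" unfolding gu' by simp
        then show ?thesis
          by (simp only: P_diff[of _ "h - g"] h linear_add[OF bounded_linear.linear[OF P_linear]] P_scaleR PW) simp
      qed
      then have "norm ((g o\<^sub>L u) - h) \<le> C * norm (P \<delta>)"
        using P_inj[OF mult[OF gG u(1)] NG[OF hN] gur N_le[OF hN]] by simp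
      also have "\<dots> \<le> C * (onorm P * (c * \<bar>s\<bar>))"
        using C oP \<delta> by (intro mult_left_mono order_trans[OF norm_P_le]) auto
      finally have 1: "norm (h - (g o\<^sub>L u)) \<le> C * (onorm P * (c * \<bar>s\<bar>))" by (simp add: norm_minus_commute)
      have eq: "h - g - s *\<^sub>R (g o\<^sub>L W) = (h - (g o\<^sub>L u)) + \<delta>" unfolding gu' by simp
      have "norm (h - g - s *\<^sub>R (g o\<^sub>L W)) \<le> C * (onorm P * (c * \<bar>s\<bar>)) + c * \<bar>s\<bar>"
        unfolding eq by (rule norm_triangle_mono[OF 1 \<delta>])
      also have "\<dots> = (C * onorm P + 1) * c * \<bar>s\<bar>" by (simp add: algebra_simps)
      also have "(C * onorm P + 1) * c = e" using CP by (simp add: c_def)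
      finally show ?thesis by (simp add: h_def s_def)
    qed
    then show ?thesis
      using d1(1) d2(1) d3 by (intro exI[of _ "min d1 (min d2 d3)"]) (auto simp: g_def)
  qed
  then show ?thesis
    unfolding has_vector_derivative_def has_derivative_at_alt g_def W_def
    by (simp add: bounded_linear_scaleR_left)
qed

text \<open>On \<open>\<Omega>\<close> these are the entries of the inverse of the matrix
  \<open>p a (\<psi> x o\<^sub>L Y k)\<close>.\<close>

definition z :: "nat \<Rightarrow> nat \<Rightarrow> (nat \<Rightarrow> real) \<Rightarrow> real"
  where "z k i x = p k (Z (\<psi> x) i)"

lemma Z_z: "x \<in> \<Omega> \<Longrightarrow> i < n \<Longrightarrow> Z (\<psi> x) i = (\<Sum>k<n. z k i x *\<^sub>R Y k)"
  unfolding z_def by (rule p_expand[symmetric]) (intro Z_tangent N_le \<psi>_N)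

lemma linear_\<psi>_derivative:
  assumes \<theta>: "bounded_linear (\<theta> :: ('a \<Rightarrow>\<^sub>L 'a) \<Rightarrow> real)" and x: "x \<in> \<Omega>" and i: "i < n"
  shows "((\<lambda>t. \<theta> (\<psi> (x(i := t)))) has_real_derivative (\<Sum>c<n. z c i x * \<theta> (\<psi> x o\<^sub>L Y c))) (at (x i))"
proof -
  have "\<theta> (\<psi> x o\<^sub>L Z (\<psi> x) i) = (\<Sum>c<n. z c i x * \<theta> (\<psi> x o\<^sub>L Y c))"
    unfolding Z_z[OF x i] compose_sum_right compose_scaleR_right
      linear_sum[OF bounded_linear.linear[OF \<theta>]] linear_scale[OF bounded_linear.linear[OF \<theta>]] by simp
  then show ?thesis
    using bounded_linear.has_vector_derivative[OF \<theta> \<psi>_derivative[OF x i]]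
    by (simp add: has_real_derivative_iff_has_vector_derivative)
qed

lemma Z_continuous: "i < n \<Longrightarrow> continuous_on N (\<lambda>g. Z g i)"
proof -
  assume i: "i < n"
  have "(4 * onorm P * norm (Y i))-lipschitz_on N (\<lambda>g. Z g i)"
  proof (rule lipschitz_onI)
    show "dist (Z h i) (Z g i) \<le> 4 * onorm P * norm (Y i) * dist h g" if "h \<in> N" "g \<in> N" for h g
      unfolding dist_norm by (rule Z_lipschitz[OF N_le N_le i]) (rule that)+
  qed (simp add: onorm_pos_le[OF P_linear])
  then show ?thesis by (rule lipschitz_on_continuous_on)
qed

lemma z_continuous: "k < n \<Longrightarrow> i < n \<Longrightarrow> continuous_on \<Omega> (z k i)"
  unfolding z_def[abs_def]
  by (rule continuous_on_compose2[OF linear_continuous_on[OF p_linear, of k UNIV]])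
    (auto intro!: continuous_on_compose2[OF Z_continuous \<psi>_continuous] \<psi>_N)

lemma compose_linear:
  "bounded_linear \<theta> \<Longrightarrow> bounded_linear (\<lambda>A. \<theta> (A o\<^sub>L A'))"
  for \<theta> :: "('a \<Rightarrow>\<^sub>L 'a) \<Rightarrow> real" and A' :: "'a \<Rightarrow>\<^sub>L 'a"
  by (rule bounded_linear_compose[OF _ bounded_bilinear.bounded_linear_left[OF bounded_bilinear_blinfun_compose]])

text \<open>Difference quotients of \<open>Z_expand\<close> with base point \<open>\<psi> x\<close>:
  the frame at \<open>\<psi> x\<close> stays fixed, \<open>Z\<close> at the moving point converges
  by continuity, and the increment of \<open>\<psi>\<close> contributes its derivative.\<close>

lemma z_derivative:
  assumes x: "x \<in> \<Omega>" and i: "i < n" and l: "l < n" and k: "k < n"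
  shows "((\<lambda>t. z k i (x(l := t))) has_real_derivative
    - (\<Sum>a<n. \<Sum>b<n. z b i x * (\<Sum>c<n. z c l x * p a ((\<psi> x o\<^sub>L Y c) o\<^sub>L Y b)) * z k a x)) (at (x l))"
proof -
  interpret pk: bounded_linear "p k" by (rule p_linear[OF k])
  have lim: "((\<lambda>t. z b i (x(l := t))) \<longlongrightarrow> z b i x) (at (x l))" if b: "b < n" for b
  proof -
    have "((\<lambda>t. \<psi> (x(l := t))) \<longlongrightarrow> \<psi> (x(l := x l))) (at (x l))"
      using has_vector_derivative_continuous[OF \<psi>_derivative[OF x l]]
      by (simp add: continuous_within)
    then have \<psi>lim: "((\<lambda>t. \<psi> (x(l := t))) \<longlongrightarrow> \<psi> x) (at (x l))" by simp
    obtain d where d: "d > 0" "\<And>t. \<bar>t - x l\<bar> < d \<Longrightarrow> x(l := t) \<in> \<Omega>" using \<Omega>_line[OF x l] by blast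
    have "\<forall>\<^sub>F t in at (x l). \<psi> (x(l := t)) \<in> N"
      unfolding eventually_at using d by (auto simp: dist_real_def intro!: \<psi>_N)
    then have "((\<lambda>t. Z (\<psi> (x(l := t))) i) \<longlongrightarrow> Z (\<psi> x) i) (at (x l))"
      by (rule continuous_on_tendsto_compose[OF Z_continuous[OF i] \<psi>lim \<psi>_N[OF x]])
    then show ?thesis unfolding z_def by (rule bounded_linear.tendsto[OF p_linear[OF b]])
  qed
  define \<theta> where "\<theta> a b A = p a (A o\<^sub>L Y b)" for a b and A :: "'a \<Rightarrow>\<^sub>L 'a"
  have \<theta>: "bounded_linear (\<theta> a b)" if "a < n" for a b
    unfolding \<theta>_def by (rule compose_linear[OF p_linear[OF that]])
  have quot: "((\<lambda>t. (\<theta> a b (\<psi> (x(l := t))) - \<theta> a b (\<psi> x)) / (t - x l))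
      \<longlongrightarrow> (\<Sum>c<n. z c l x * p a ((\<psi> x o\<^sub>L Y c) o\<^sub>L Y b))) (at (x l))" if a: "a < n" for a b
    using linear_\<psi>_derivative[OF \<theta>[OF a] x l, of b]
    by (simp add: has_field_derivative_iff \<theta>_def)
  have "((\<lambda>t. - (\<Sum>a<n. \<Sum>b<n. z b i (x(l := t)) * ((\<theta> a b (\<psi> (x(l := t))) - \<theta> a b (\<psi> x)) / (t - x l)) * z k a x))
      \<longlongrightarrow> - (\<Sum>a<n. \<Sum>b<n. z b i x * (\<Sum>c<n. z c l x * p a ((\<psi> x o\<^sub>L Y c) o\<^sub>L Y b)) * z k a x)) (at (x l))"
    by (intro tendsto_minus tendsto_sum tendsto_mult tendsto_const lim quot) auto
  moreover have "\<forall>\<^sub>F t in at (x l).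
      - (\<Sum>a<n. \<Sum>b<n. z b i (x(l := t)) * ((\<theta> a b (\<psi> (x(l := t))) - \<theta> a b (\<psi> x)) / (t - x l)) * z k a x)
      = (z k i (x(l := t)) - z k i (x(l := x l))) / (t - x l)"
  proof -
    obtain d where d: "d > 0" "\<And>t. \<bar>t - x l\<bar> < d \<Longrightarrow> x(l := t) \<in> \<Omega>" using \<Omega>_line[OF x l] by blast
    have "- (\<Sum>a<n. \<Sum>b<n. z b i (x(l := t)) * ((\<theta> a b (\<psi> (x(l := t))) - \<theta> a b (\<psi> x)) / (t - x l)) * z k a x)
      = (z k i (x(l := t)) - z k i (x(l := x l))) / (t - x l)" if "\<bar>t - x l\<bar> < d" for t
    proof -
      define y where "y = x(l := t)"
      have y: "y \<in> \<Omega>" unfolding y_def by (rule d(2)[OF that])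
      have "z k i y - z k i x = p k (Z (\<psi> y) i - Z (\<psi> x) i)" by (simp add: z_def pk.diff)
      also have "\<dots> = - (\<Sum>a<n. p a ((\<psi> y - \<psi> x) o\<^sub>L Z (\<psi> y) i) * z k a x)"
        unfolding Z_expand[OF N_le[OF \<psi>_N[OF x]] N_le[OF \<psi>_N[OF y]] i] linear_neg[OF bounded_linear.linear[OF p_linear[OF k]]] pk.sum pk.scaleR
        by (simp add: z_def)
      also have "\<dots> = - (\<Sum>a<n. \<Sum>b<n. z b i y * (\<theta> a b (\<psi> y) - \<theta> a b (\<psi> x)) * z k a x)"
      proof -
        have "p a ((\<psi> y - \<psi> x) o\<^sub>L Z (\<psi> y) i) = (\<Sum>b<n. z b i y * (\<theta> a b (\<psi> y) - \<theta> a b (\<psi> x)))"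
          if a: "a < n" for a
        proof -
          interpret pa: bounded_linear "p a" by (rule p_linear[OF a])
          show ?thesis
            unfolding Z_z[OF y i] compose_sum_right compose_scaleR_right pa.sum pa.scaleR \<theta>_def
              compose_diff_left pa.diff by simp
        qed
        then show ?thesis by (simp add: sum_distrib_right)
      qed
      finally have "z k i y - z k i x = \<dots>" .
      then show ?thesis
        unfolding y_def[symmetric] fun_upd_triv by (simp add: sum_divide_distrib)
    qed
    then show ?thesis unfolding eventually_at using d(1) by (auto simp: dist_real_def)
  qed
  ultimately show ?thesis
    unfolding has_field_derivative_iff by (rule Lim_transform_eventually)
qed

lemma continuous_map_\<Omega>:
  fixes f :: "(nat \<Rightarrow> real) \<Rightarrow> real"
  assumes "continuous_on \<Omega> f"
  shows "continuous_map (subtopology (Euclidean_space n) \<Omega>) euclideanreal f"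
proof -
  have "{x. \<forall>i\<ge>n. x i = 0} \<inter> \<Omega> = \<Omega>" using \<Omega>_support by blast
  then show ?thesis
    unfolding Euclidean_space_eq subtopology_subtopology using assms by simp
qed

text \<open>The functions \<open>\<theta> \<circ> \<psi>\<close> with \<open>\<theta>\<close> linear and the functions \<open>z\<close> have partial derivatives that are
  polynomials in functions of the same kind.\<close>

lemma Ck_on_chart:
  "(\<forall>\<theta> :: ('a \<Rightarrow>\<^sub>L 'a) \<Rightarrow> real. bounded_linear \<theta> \<longrightarrow> Ck_on n k \<Omega> (\<lambda>x. \<theta> (\<psi> x))) \<and>
    (\<forall>a<n. \<forall>i<n. Ck_on n k \<Omega> (z a i))"
proof (induction k)
  case 0
  then show ?case
    by (auto intro!: continuous_map_\<Omega> z_continuous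
        continuous_on_compose2[OF linear_continuous_on[where s = UNIV] \<psi>_continuous])
next
  case (Suc k)
  then have L: "Ck_on n k \<Omega> (\<lambda>x. \<theta> (\<psi> x))" if "bounded_linear \<theta>" for \<theta> :: "('a \<Rightarrow>\<^sub>L 'a) \<Rightarrow> real"
    using that by blast
  have z: "Ck_on n k \<Omega> (z a i)" if "a < n" "i < n" for a i using Suc that by blast
  show ?case
  proof (intro conjI allI impI)
    fix \<theta> :: "('a \<Rightarrow>\<^sub>L 'a) \<Rightarrow> real" assume \<theta>: "bounded_linear \<theta>"
    show "Ck_on n (Suc k) \<Omega> (\<lambda>x. \<theta> (\<psi> x))"
    proof (rule Ck_on_SucI)
      show "continuous_map (subtopology (Euclidean_space n) \<Omega>) euclideanreal (\<lambda>x. \<theta> (\<psi> x))"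
        by (rule Ck_on_continuous[OF L[OF \<theta>]])
      show "((\<lambda>t. \<theta> (\<psi> (x(i := t)))) has_real_derivative (\<Sum>c<n. z c i x * \<theta> (\<psi> x o\<^sub>L Y c))) (at (x i))"
        if "i < n" "x \<in> \<Omega>" for i x by (rule linear_\<psi>_derivative[OF \<theta> that(2,1)])
      show "Ck_on n k \<Omega> (\<lambda>x. \<Sum>c<n. z c i x * \<theta> (\<psi> x o\<^sub>L Y c))" if "i < n" for i
        by (intro Ck_on_sum Ck_on_mult z L[OF compose_linear[OF \<theta>]] that) simp
    qed
  next
    fix a i assume a: "a < n" and i: "i < n"
    show "Ck_on n (Suc k) \<Omega> (z a i)"
    proof (rule Ck_on_SucI)
      show "continuous_map (subtopology (Euclidean_space n) \<Omega>) euclideanreal (z a i)"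
        by (rule Ck_on_continuous[OF z[OF a i]])
      show "((\<lambda>t. z a i (x(l := t))) has_real_derivative
        - (\<Sum>e<n. \<Sum>b<n. z b i x * (\<Sum>c<n. z c l x * p e ((\<psi> x o\<^sub>L Y c) o\<^sub>L Y b)) * z a e x)) (at (x l))"
        if "l < n" "x \<in> \<Omega>" for l x by (rule z_derivative[OF that(2) i that(1) a])
      show "Ck_on n k \<Omega> (\<lambda>x. - (\<Sum>e<n. \<Sum>b<n. z b i x * (\<Sum>c<n. z c l x * p e ((\<psi> x o\<^sub>L Y c) o\<^sub>L Y b)) * z a e x))"
        if l: "l < n" for l
      proof -
        have "Ck_on n k \<Omega> (\<lambda>x. (- 1) * (\<Sum>e<n. \<Sum>b<n. z b i x * (\<Sum>c<n. z c l x * p e ((\<psi> x o\<^sub>L Y c) o\<^sub>L Y b)) * z a e x))"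
          by (intro Ck_on_mult[OF Ck_on_const] Ck_on_sum Ck_on_mult z
              L[OF compose_linear[OF compose_linear[OF p_linear]]] a i l) auto
        then show ?thesis by simp
      qed
    qed
  qed
qed

lemma Ck_on_linear: "bounded_linear \<theta> \<Longrightarrow> Ck_on n k \<Omega> (\<lambda>x. \<theta> (\<psi> x))"
  for \<theta> :: "('a \<Rightarrow>\<^sub>L 'a) \<Rightarrow> real"
  using Ck_on_chart[of k] by blast

end

section \<open>The atlas of left translates\<close>

context operator_group_chart
begin

definition U :: "('a \<Rightarrow>\<^sub>L 'a) \<Rightarrow> ('a \<Rightarrow>\<^sub>L 'a) set"
  where "U a = {h \<in> G. \<sigma> a o\<^sub>L h \<in> N}"

definition \<Phi> :: "('a \<Rightarrow>\<^sub>L 'a) \<Rightarrow> ('a \<Rightarrow>\<^sub>L 'a) \<Rightarrow> nat \<Rightarrow> real"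
  where "\<Phi> a h = \<phi> (\<sigma> a o\<^sub>L h)"

definition atlas :: "('a \<Rightarrow>\<^sub>L 'a) chart set"
  where "atlas = (\<lambda>a. (U a, \<Phi> a)) ` G"

lemma inv_compose:
  fixes A :: "'a \<Rightarrow>\<^sub>L 'a"
  assumes "a \<in> G"
  shows "\<sigma> a o\<^sub>L (a o\<^sub>L A) = A" "a o\<^sub>L (\<sigma> a o\<^sub>L A) = A"
  by (rule blinfun_eqI, simp add: inv_apply assms)+

lemma translate_\<psi>:
  assumes "a \<in> G" "x \<in> \<Omega>"
  shows "a o\<^sub>L \<psi> x \<in> U a" "\<Phi> a (a o\<^sub>L \<psi> x) = x"
  using assms by (simp_all add: U_def \<Phi>_def inv_compose mult \<psi>_G \<psi>_N \<phi>_\<psi>)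

lemma \<Phi>_\<Omega>: "h \<in> U a \<Longrightarrow> \<Phi> a h \<in> \<Omega>"
  by (auto simp: U_def \<Phi>_def \<Omega>_def)

lemma translate_\<psi>_\<Phi>: "a \<in> G \<Longrightarrow> h \<in> U a \<Longrightarrow> a o\<^sub>L \<psi> (\<Phi> a h) = h"
  by (simp add: U_def \<Phi>_def \<psi>_\<phi> inv_compose)

lemma \<Phi>_image: "a \<in> G \<Longrightarrow> \<Phi> a ` U a = \<Omega>"
proof (intro subset_antisym image_subsetI subsetI)
  show "x \<in> \<Phi> a ` U a" if "a \<in> G" "x \<in> \<Omega>" for x
    using translate_\<psi>[OF that] by (metis image_eqI)
qed (rule \<Phi>_\<Omega>)

lemma \<Phi>_inj: "a \<in> G \<Longrightarrow> inj_on (\<Phi> a) (U a)"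
  by (rule inj_on_inverseI[where g = "\<lambda>x. a o\<^sub>L \<psi> x"]) (rule translate_\<psi>_\<Phi>)

lemma \<Phi>_inv_into: "a \<in> G \<Longrightarrow> x \<in> \<Omega> \<Longrightarrow> inv_into (U a) (\<Phi> a) x = a o\<^sub>L \<psi> x"
  by (intro inv_into_f_eq \<Phi>_inj translate_\<psi>)

lemma \<Phi>_component: "j < n \<Longrightarrow> \<Phi> b h j = p j (\<sigma> b o\<^sub>L h) - p j id_blinfun"
  using linear_diff[OF bounded_linear.linear[OF p_linear]] by (simp add: \<Phi>_def \<phi>_def)

lemma \<Phi>_support: "i \<ge> n \<Longrightarrow> \<Phi> a h i = 0"
  by (simp add: \<Phi>_def \<phi>_def)

lemma compose_left_linear: "bounded_linear ((o\<^sub>L) A)" for A :: "'a \<Rightarrow>\<^sub>L 'a"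
  by (rule bounded_bilinear.bounded_linear_right[OF bounded_bilinear_blinfun_compose])

lemma U_open: "openin (top_of_set G) (U a)" if a: "a \<in> G" for a
proof -
  have "U a = G \<inter> {h. norm ((\<sigma> a o\<^sub>L h) - id_blinfun) < r}"
    using a mult inv(1) by (auto simp: U_def N_def)
  moreover have "open {h. norm ((\<sigma> a o\<^sub>L h) - id_blinfun) < r}"
    by (intro open_Collect_less continuous_on_norm continuous_on_diff continuous_on_const
        linear_continuous_on compose_left_linear)
  ultimately show ?thesis by (simp add: openin_open_Int)
qed

lemma \<Phi>_chart:
  assumes a: "a \<in> G"
  shows "is_chart n (top_of_set G) (U a, \<Phi> a)"
proof -
  have "U a \<subseteq> G" by (auto simp: U_def)
  then have UG: "subtopology (top_of_set G) (U a) = top_of_set (U a)"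
    by (simp add: subtopology_subtopology Int_absorb1)
  have E: "subtopology (Euclidean_space n) \<Omega> = top_of_set \<Omega>"
  proof -
    have "{x. \<forall>i\<ge>n. x i = 0} \<inter> \<Omega> = \<Omega>" using \<Omega>_support by blast
    then show ?thesis by (simp add: Euclidean_space_eq subtopology_subtopology)
  qed
  have "continuous_on (U a) (\<Phi> a)"
  proof (rule continuous_on_coordinatewise_then_product)
    fix i
    have "continuous_on (U a) (\<lambda>h. p i (\<sigma> a o\<^sub>L h) - p i id_blinfun)" if "i < n"
      by (intro continuous_on_diff continuous_on_const linear_continuous_on
          bounded_linear_compose[OF p_linear[OF that] compose_left_linear])
    then show "continuous_on (U a) (\<lambda>h. \<Phi> a h i)"
      by (cases "i < n") (simp_all add: \<Phi>_component \<Phi>_support cong: continuous_on_cong)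
  qed
  moreover have "continuous_on \<Omega> (\<lambda>x. a o\<^sub>L \<psi> x)"
    by (rule continuous_on_compose2[OF linear_continuous_on[OF compose_left_linear, of UNIV] \<psi>_continuous]) simp
  ultimately have "homeomorphic_maps (top_of_set (U a)) (top_of_set \<Omega>) (\<Phi> a) (\<lambda>x. a o\<^sub>L \<psi> x)"
    unfolding homeomorphic_maps_def
    using \<Phi>_\<Omega> translate_\<psi>[OF a] translate_\<psi>_\<Phi>[OF a]
    by (simp add: continuous_map_in_subtopology image_subset_iff_funcset[symmetric] image_subset_iff)
  then have "homeomorphic_map (top_of_set (U a)) (top_of_set \<Omega>) (\<Phi> a)"
    unfolding homeomorphic_map_maps by blast
  then show ?thesis
    unfolding is_chart_def fst_conv snd_conv \<Phi>_image[OF a] UG E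
    by (intro conjI U_open a \<Omega>_open)
qed

text \<open>Left translation and inversion are linear, so that in charts they are linear functions of \<open>\<psi>\<close>.\<close>

lemma smooth_in_charts_linear:
  assumes F: "bounded_linear F" and f: "\<And>h. h \<in> G \<Longrightarrow> f h = F h"
  shows "smooth_in_charts n atlas n atlas f"
  unfolding smooth_in_charts_def atlas_def smooth_on_def ball_simps fst_conv snd_conv
proof (intro ballI allI impI)
  fix a b k j assume a: "a \<in> G" and b: "b \<in> G" and j: "j < n"
  define \<theta> where "\<theta> A = p j (\<sigma> b o\<^sub>L F (a o\<^sub>L A))" for A
  have "bounded_linear \<theta>"
    unfolding \<theta>_def
    by (rule bounded_linear_compose[OF p_linear[OF j]
          bounded_linear_compose[OF compose_left_linear bounded_linear_compose[OF F compose_left_linear]]])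
  \<comment> \<open>Regularity is shown on all of \<open>\<Omega>\<close>, since
    \<open>\<Phi> b\<close> is affine and defined everywhere; the restriction to the overlap comes
    last.\<close>
  then have "Ck_on n k \<Omega> (\<lambda>x. \<theta> (\<psi> x) + (- p j id_blinfun))"
    by (intro Ck_on_add Ck_on_linear Ck_on_const)
  then have "Ck_on n k \<Omega> (\<lambda>x. \<Phi> b (f (inv_into (U a) (\<Phi> a) x)) j)"
  proof (rule Ck_on_cong[OF \<Omega>_open, rotated])
    fix x assume x: "x \<in> \<Omega>"
    then have "a o\<^sub>L \<psi> x \<in> G" by (intro mult a \<psi>_G)
    then show "\<theta> (\<psi> x) + (- p j id_blinfun) = \<Phi> b (f (inv_into (U a) (\<Phi> a) x)) j"
      by (simp add: \<Phi>_inv_into a x f \<Phi>_component j \<theta>_def)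
  qed
  then show "Ck_on n k (\<Phi> a ` {x \<in> U a. f x \<in> U b}) (\<lambda>x. \<Phi> b (f (inv_into (U a) (\<Phi> a) x)) j)"
    by (rule Ck_on_subset) (use \<Phi>_\<Omega> in blast)
qed

lemma group_G: "Group.group \<lparr>carrier = G, mult = (o\<^sub>L), one = id_blinfun\<rparr>"
proof (rule groupI)
  let ?G = "\<lparr>carrier = G, mult = (o\<^sub>L), one = id_blinfun\<rparr>"
  show "\<exists>y\<in>carrier ?G. y \<otimes>\<^bsub>?G\<^esub> x = \<one>\<^bsub>?G\<^esub>" if "x \<in> carrier ?G" for x
    using that inv by (intro bexI[of _ "\<sigma> x"]) auto
qed (auto simp: mult one intro: blinfun_eqI)

lemma inv_G: "h \<in> G \<Longrightarrow> inv\<^bsub>\<lparr>carrier = G, mult = (o\<^sub>L), one = id_blinfun\<rparr>\<^esub> h = \<sigma> h"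
  by (rule group.inv_equality[OF group_G]) (simp_all add: inv)

lemma \<psi>_expand:
  assumes x: "x \<in> \<Omega>"
  shows "\<psi> x = id_blinfun + (\<Sum>k<m. (q k (\<psi> x) - q k id_blinfun) *\<^sub>R B k)"
proof -
  have "(\<Sum>k<m. (q k (\<psi> x) - q k id_blinfun) *\<^sub>R B k) = (\<Sum>k<m. q k (\<psi> x - id_blinfun) *\<^sub>R B k)"
    using linear_diff[OF bounded_linear.linear[OF q_linear]] by (intro sum.cong) auto
  then show ?thesis by (simp add: span[OF \<psi>_G[OF x]])
qed

text \<open>In charts multiplication is bilinear in \<open>\<psi>\<close> at the two halves of the coordinates; expanding the
  first factor in the basis \<open>B\<close> turns it into a sum of products.\<close>

lemma smooth_in_charts_mult:
  "smooth_in_charts (n + n) (prod_atlas n atlas atlas) n atlas (\<lambda>(x, y). x o\<^sub>L y)"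
  unfolding smooth_in_charts_def
proof (intro ballI)
  fix c d assume "c \<in> prod_atlas n atlas atlas" and "d \<in> atlas"
  then obtain a a' b where a: "a \<in> G" and a': "a' \<in> G" and b: "b \<in> G" and d: "d = (U b, \<Phi> b)"
    and c: "c = (U a \<times> U a', \<lambda>(x, y) i. if i < n then \<Phi> a x i else \<Phi> a' y (i - n))"
    by (auto simp: prod_atlas_def atlas_def)
  define \<kappa> where "\<kappa> = (\<lambda>(x, y) i. if i < n then \<Phi> a x i else \<Phi> a' y (i - n))"
  \<comment> \<open>These are the two halves of the product coordinates, and
    \<open>\<Omega>2\<close> is the copy of \<open>\<Omega> \<times> \<Omega>\<close> in dimension
    \<open>n + n\<close>.\<close>
  define \<pi>1 \<pi>2 where "\<pi>1 z j = (if j < n then z j else 0)" and "\<pi>2 z j = (if j < n then z (j + n) else 0)"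
    for z :: "nat \<Rightarrow> real" and j
  define \<Omega>2 where "\<Omega>2 = {z. (\<forall>i\<ge>n + n. z i = 0) \<and> \<pi>1 z \<in> \<Omega> \<and> \<pi>2 z \<in> \<Omega>}"
  have \<pi>1: "\<pi>1 (\<kappa> (x, y)) = \<Phi> a x" and \<pi>2: "\<pi>2 (\<kappa> (x, y)) = \<Phi> a' y" for x y
    by (auto simp: \<pi>1_def \<pi>2_def \<kappa>_def \<Phi>_support fun_eq_iff)
  have \<kappa>_\<pi>: "\<kappa> (a o\<^sub>L \<psi> (\<pi>1 z), a' o\<^sub>L \<psi> (\<pi>2 z)) = z" if "z \<in> \<Omega>2" for z
    using that translate_\<psi>(2)[OF a, of "\<pi>1 z"] translate_\<psi>(2)[OF a', of "\<pi>2 z"]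
    by (auto simp: \<Omega>2_def \<kappa>_def fun_eq_iff) (auto simp: \<pi>1_def \<pi>2_def)
  have \<kappa>_\<Omega>2: "\<kappa> (x, y) \<in> \<Omega>2" if "x \<in> U a" "y \<in> U a'" for x y
    using that \<Phi>_\<Omega> by (auto simp: \<Omega>2_def \<pi>1 \<pi>2) (simp add: \<kappa>_def \<Phi>_support)
  have \<kappa>_inj: "inj_on \<kappa> (U a \<times> U a')"
  proof (rule inj_on_inverseI[where g = "\<lambda>z. (a o\<^sub>L \<psi> (\<pi>1 z), a' o\<^sub>L \<psi> (\<pi>2 z))"])
    show "(a o\<^sub>L \<psi> (\<pi>1 (\<kappa> w)), a' o\<^sub>L \<psi> (\<pi>2 (\<kappa> w))) = w" if "w \<in> U a \<times> U a'" for w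
      using that by (cases w) (simp add: \<pi>1 \<pi>2 translate_\<psi>_\<Phi> a a')
  qed
  have \<kappa>_inv: "inv_into (U a \<times> U a') \<kappa> z = (a o\<^sub>L \<psi> (\<pi>1 z), a' o\<^sub>L \<psi> (\<pi>2 z))" if z: "z \<in> \<Omega>2" for z
    by (rule inv_into_f_eq[OF \<kappa>_inj _ \<kappa>_\<pi>[OF z]]) (use z in \<open>auto simp: \<Omega>2_def intro: translate_\<psi> a a'\<close>)
  have top: "{z \<in> topspace (Euclidean_space (n + n)). \<pi>1 z \<in> \<Omega>} \<inter> {z \<in> topspace (Euclidean_space (n + n)). \<pi>2 z \<in> \<Omega>} = \<Omega>2"
    by (auto simp: \<Omega>2_def topspace_Euclidean_space)
  have "continuous_map (Euclidean_space (n + n)) (Euclidean_space n) \<pi>1"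
    "continuous_map (Euclidean_space (n + n)) (Euclidean_space n) \<pi>2"
    using continuous_map_reindex[of UNIV n "\<lambda>j. j" UNIV "n + n"]
      continuous_map_reindex[of UNIV n "\<lambda>j. j + n" UNIV "n + n"]
    by (simp_all add: \<pi>1_def[abs_def] \<pi>2_def[abs_def])
  then have \<Omega>2_open: "openin (Euclidean_space (n + n)) \<Omega>2"
    unfolding top[symmetric] by (intro openin_Int openin_continuous_map_preimage[OF _ \<Omega>_open])
  have C1: "Ck_on (n + n) k \<Omega>2 (\<lambda>z. f (\<pi>1 z))" if "Ck_on n k \<Omega> f" for f k
    unfolding \<pi>1_def[abs_def]
    by (rule Ck_on_reindex[OF that, where e = "\<lambda>j. j"]) (auto simp: \<Omega>2_def \<pi>1_def[abs_def])
  have C2: "Ck_on (n + n) k \<Omega>2 (\<lambda>z. f (\<pi>2 z))" if "Ck_on n k \<Omega> f" for f k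
    unfolding \<pi>2_def[abs_def]
    by (rule Ck_on_reindex[OF that, where e = "\<lambda>j. j + n"]) (auto simp: \<Omega>2_def \<pi>2_def[abs_def])
  have "smooth_on (n + n) n (\<kappa> ` {w \<in> U a \<times> U a'. (case w of (x, y) \<Rightarrow> x o\<^sub>L y) \<in> U b})
      (\<lambda>z. \<Phi> b (case inv_into (U a \<times> U a') \<kappa> z of (x, y) \<Rightarrow> x o\<^sub>L y))"
    unfolding smooth_on_def
  proof (intro allI impI)
    fix k j assume j: "j < n"
    interpret pj: bounded_linear "p j" by (rule p_linear[OF j])
    define \<theta> where "\<theta> D A = p j (\<sigma> b o\<^sub>L (a o\<^sub>L (D o\<^sub>L (a' o\<^sub>L A))))" for D A :: "'a \<Rightarrow>\<^sub>L 'a"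
    have \<theta>: "bounded_linear (\<theta> D)" for D
      unfolding \<theta>_def
      by (intro bounded_linear_compose[OF pj.bounded_linear_axioms] bounded_linear_compose[OF compose_left_linear]
          compose_left_linear)
    have "Ck_on (n + n) k \<Omega>2 (\<lambda>z. (\<theta> id_blinfun (\<psi> (\<pi>2 z))
        + (\<Sum>l<m. (q l (\<psi> (\<pi>1 z)) + (- q l id_blinfun)) * \<theta> (B l) (\<psi> (\<pi>2 z)))) + (- p j id_blinfun))"
      by (intro Ck_on_add[OF _ Ck_on_const] Ck_on_add[OF _ Ck_on_sum] Ck_on_mult
          C1[where f = "\<lambda>x. q _ (\<psi> x)"] C2[where f = "\<lambda>x. \<theta> _ (\<psi> x)"] Ck_on_linear \<theta> q_linear) auto
    then have "Ck_on (n + n) k \<Omega>2 (\<lambda>z. \<Phi> b (case inv_into (U a \<times> U a') \<kappa> z of (x, y) \<Rightarrow> x o\<^sub>L y) j)"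
    proof (rule Ck_on_cong[OF \<Omega>2_open, rotated])
      fix z assume z: "z \<in> \<Omega>2"
      then have z1: "\<pi>1 z \<in> \<Omega>" by (simp add: \<Omega>2_def)
      define V where "V = \<psi> (\<pi>2 z)"
      define S where "S = (\<Sum>l<m. (q l (\<psi> (\<pi>1 z)) - q l id_blinfun) *\<^sub>R B l)"
      have \<psi>1: "\<psi> (\<pi>1 z) = id_blinfun + S" unfolding S_def by (rule \<psi>_expand[OF z1])
      have lin: "bounded_linear (\<lambda>D. \<theta> D V)"
        unfolding \<theta>_def
        by (intro bounded_linear_compose[OF pj.bounded_linear_axioms] bounded_linear_compose[OF compose_left_linear]
            bounded_bilinear.bounded_linear_left[OF bounded_bilinear_blinfun_compose])
      have "\<Phi> b (case inv_into (U a \<times> U a') \<kappa> z of (x, y) \<Rightarrow> x o\<^sub>L y) j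
          = p j (\<sigma> b o\<^sub>L ((a o\<^sub>L \<psi> (\<pi>1 z)) o\<^sub>L (a' o\<^sub>L V))) - p j id_blinfun"
        by (simp add: \<kappa>_inv z \<Phi>_component j V_def)
      also have "\<sigma> b o\<^sub>L ((a o\<^sub>L \<psi> (\<pi>1 z)) o\<^sub>L (a' o\<^sub>L V)) = \<sigma> b o\<^sub>L (a o\<^sub>L (\<psi> (\<pi>1 z) o\<^sub>L (a' o\<^sub>L V)))"
        by (rule blinfun_eqI) simp
      also have "p j (\<sigma> b o\<^sub>L (a o\<^sub>L (\<psi> (\<pi>1 z) o\<^sub>L (a' o\<^sub>L V)))) = \<theta> (id_blinfun + S) V"
        unfolding \<theta>_def \<psi>1 ..
      also have "\<dots> = \<theta> id_blinfun V + (\<Sum>l<m. (q l (\<psi> (\<pi>1 z)) - q l id_blinfun) * \<theta> (B l) V)"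
        unfolding linear_add[OF bounded_linear.linear[OF lin]] S_def linear_sum[OF bounded_linear.linear[OF lin]]
          linear_scale[OF bounded_linear.linear[OF lin]] by simp
      finally show "(\<theta> id_blinfun (\<psi> (\<pi>2 z))
        + (\<Sum>l<m. (q l (\<psi> (\<pi>1 z)) + (- q l id_blinfun)) * \<theta> (B l) (\<psi> (\<pi>2 z)))) + (- p j id_blinfun)
        = \<Phi> b (case inv_into (U a \<times> U a') \<kappa> z of (x, y) \<Rightarrow> x o\<^sub>L y) j"
        by (simp add: V_def)
    qed
    then show "Ck_on (n + n) k (\<kappa> ` {w \<in> U a \<times> U a'. (case w of (x, y) \<Rightarrow> x o\<^sub>L y) \<in> U b})
      (\<lambda>z. \<Phi> b (case inv_into (U a \<times> U a') \<kappa> z of (x, y) \<Rightarrow> x o\<^sub>L y) j)"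
      by (rule Ck_on_subset) (use \<kappa>_\<Omega>2 in auto)
  qed
  then show "smooth_on (n + n) n (snd c ` {x \<in> fst c. (case x of (x, y) \<Rightarrow> x o\<^sub>L y) \<in> fst d})
      (\<lambda>z. snd d (case inv_into (fst c) (snd c) z of (x, y) \<Rightarrow> x o\<^sub>L y))"
    unfolding c d fst_conv snd_conv \<kappa>_def .
qed

text \<open>The full operator space need not be second countable, but the coordinates
  \<open>q k (g - 1)\<close> embed \<open>G\<close> homeomorphically into the space of real
  sequences.\<close>

lemma second_countable_G: "second_countable (top_of_set G)"
proof -
  define f where "f g k = (if k < m then q k (g - id_blinfun) else 0)" for g k
  define h where "h x = id_blinfun + (\<Sum>k<m. x k *\<^sub>R B k)" for x :: "nat \<Rightarrow> real"
  have hf: "h (f g) = g" if "g \<in> G" for g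
    using span[OF that] by (simp add: h_def f_def)
  have "continuous_on G (\<lambda>g. q k (g - id_blinfun))" if "k < m" for k
    by (rule continuous_on_compose2[OF linear_continuous_on[OF q_linear[OF that], of UNIV]]) (auto intro: continuous_intros)
  then have "continuous_on G f"
  proof (intro continuous_on_coordinatewise_then_product)
    show "continuous_on G (\<lambda>g. f g i)" if "\<And>k. k < m \<Longrightarrow> continuous_on G (\<lambda>g. q k (g - id_blinfun))" for i
      unfolding f_def using that by (cases "i < m") simp_all
  qed
  moreover have "continuous_on (f ` G) h"
    unfolding h_def[abs_def]
    by (intro continuous_on_add continuous_on_sum continuous_on_scaleR continuous_on_const)
      (rule continuous_on_subset[OF continuous_on_product_coordinates], simp)
  ultimately have "homeomorphic_maps (top_of_set G) (top_of_set (f ` G)) f h"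
    unfolding homeomorphic_maps_def
    by (auto simp: continuous_map_in_subtopology hf)
  then have "top_of_set G homeomorphic_space top_of_set (f ` G)"
    unfolding homeomorphic_space_def by blast
  moreover have "second_countable (euclidean :: (nat \<Rightarrow> real) topology)"
  proof -
    obtain \<B> :: "(nat \<Rightarrow> real) set set" where \<B>: "countable \<B>" "topological_basis \<B>"
      using ex_countable_basis by blast
    show ?thesis
      unfolding second_countable_def open_openin[symmetric]
    proof (intro exI[of _ \<B>] conjI ballI allI impI)
      fix S :: "(nat \<Rightarrow> real) set" and x
      assume "open S \<and> x \<in> S"
      then obtain V where "V \<in> \<B>" "x \<in> V" "V \<subseteq> S"
        using topological_basisE[OF \<B>(2), of S x] by metis
      then show "\<exists>V\<in>\<B>. x \<in> V \<and> V \<subseteq> S" by blast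
    qed (use \<B> topological_basis_open in auto)
  qed
  then have "second_countable (top_of_set (f ` G))" by (rule second_countable_subtopology)
  ultimately show ?thesis using homeomorphic_space_second_countability by blast
qed

theorem compact_lie_group_chart:
  "compact_lie_group \<lparr>carrier = G, mult = (o\<^sub>L), one = id_blinfun\<rparr> (top_of_set G)"
proof -
  let ?G = "\<lparr>carrier = G, mult = (o\<^sub>L), one = id_blinfun\<rparr>"
  have "G \<subseteq> (\<Union>a\<in>G. U a)"
  proof
    fix a assume a: "a \<in> G"
    then have "a \<in> U a" using r(1) by (simp add: U_def N_def inv one)
    with a show "a \<in> (\<Union>a\<in>G. U a)" by blast
  qed
  then have "smooth_atlas n (top_of_set G) atlas"
    unfolding smooth_atlas_def
    using \<Phi>_chart smooth_in_charts_linear[OF bounded_linear_ident, of id]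
    by (auto simp: atlas_def U_def)
  moreover have "smooth_map (n + n) (prod_topology (top_of_set G) (top_of_set G)) (prod_atlas n atlas atlas)
      n (top_of_set G) atlas (\<lambda>(x, y). x \<otimes>\<^bsub>?G\<^esub> y)"
  proof -
    have "continuous_on (G \<times> G) (\<lambda>(x, y). x o\<^sub>L y)"
      unfolding case_prod_beta
      by (intro bounded_bilinear.continuous_on[OF bounded_bilinear_blinfun_compose] continuous_intros)
    then have "continuous_map (prod_topology (top_of_set G) (top_of_set G)) (top_of_set G) (\<lambda>(x, y). x o\<^sub>L y)"
      by (auto simp: prod_topology_subtopology subtopology_subtopology continuous_map_in_subtopology mult
          Sigma_Int_distrib1[symmetric] Times_Int_Times)
    then show ?thesis unfolding smooth_map_def using smooth_in_charts_mult by simp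
  qed
  moreover have "smooth_map n (top_of_set G) atlas n (top_of_set G) atlas (\<lambda>x. inv\<^bsub>?G\<^esub> x)"
  proof -
    have "continuous_map (top_of_set G) (top_of_set G) \<sigma>"
      using linear_continuous_on[OF inv_linear] inv(1) by (auto simp: continuous_map_in_subtopology)
    then have "continuous_map (top_of_set G) (top_of_set G) (\<lambda>x. inv\<^bsub>?G\<^esub> x)"
      by (rule continuous_map_eq) (simp add: inv_G)
    then show ?thesis
      unfolding smooth_map_def using smooth_in_charts_linear[OF inv_linear, of "\<lambda>x. inv\<^bsub>?G\<^esub> x"] inv_G by simp
  qed
  moreover have "Hausdorff_space (top_of_set G)"
    by (intro Hausdorff_space_subtopology Hausdorff_space_euclidean)
  moreover have "compact_space (top_of_set G)"
    using compact_G by (simp add: compact_space_subtopology)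
  ultimately show ?thesis
    unfolding compact_lie_group_def lie_group_def
    using group_G second_countable_G by auto
qed

end

context operator_group
begin

theorem compact_lie_group:
  "compact_lie_group \<lparr>carrier = G, mult = (o\<^sub>L), one = id_blinfun\<rparr> (top_of_set G)"
proof -
  have "\<exists>n Y p. biorthogonal tangent n Y p"
  proof (rule biorthogonal_basis[of "q ` {..<m}"])
    fix v assume v: "v \<in> tangent" and 0: "\<And>f. f \<in> q ` {..<m} \<Longrightarrow> f v = 0"
    have "v = proj v" using v tangent_subset by (auto simp: E_def)
    also have "proj v = 0" unfolding proj_def by (rule sum.neutral) (simp add: 0)
    finally show "v = 0" .
  qed (use tangent_subspace q_linear in auto)
  then obtain n Y p where basis: "biorthogonal tangent n Y p" by blast
  interpret operator_group_basis G \<sigma> m B q n Y p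
    by unfold_locales (rule basis)
  obtain r0 C where r0: "r0 > 0" and C: "C > 0"
    and inj: "\<And>g h. g \<in> G \<Longrightarrow> h \<in> G \<Longrightarrow> norm (g - id_blinfun) \<le> r0 \<Longrightarrow> norm (h - id_blinfun) \<le> r0 \<Longrightarrow>
      norm (g - h) \<le> C * norm (P (g - h))"
    using local_injectivity by blast
  have oP: "onorm P \<ge> 0" by (rule onorm_pos_le[OF P_linear])
  \<comment> \<open>Shrinking \<open>r0\<close> preserves the injectivity estimate; the added 1
    covers \<open>onorm P = 0\<close>.\<close>
  define r where "r = min r0 (1 / (2 * (onorm P + 1)))"
  have r: "r > 0" "r \<le> r0" using r0 oP by (auto simp: r_def)
  have "onorm P * r \<le> (onorm P + 1) * (1 / (2 * (onorm P + 1)))"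
    unfolding r_def using oP r0 by (intro mult_mono min.cobounded2) (auto simp: min_def)
  also have "\<dots> = 1 / 2" using oP by (simp add: add_nonneg_eq_0_iff)
  finally have r2: "onorm P * r \<le> 1 / 2" .
  interpret operator_group_chart G \<sigma> m B q n Y p r C
  proof
    show "norm (g - h) \<le> C * norm (P (g - h))"
      if "g \<in> G" "h \<in> G" "norm (g - id_blinfun) \<le> r" "norm (h - id_blinfun) \<le> r" for g h
      using that r(2) by (intro inj) auto
  qed (use r(1) r2 C in auto)
  show ?thesis by (rule compact_lie_group_chart)
qed

end

section \<open>Property (FH) and compactness\<close>

context schatten_subgroup
begin

text \<open>Differences of elements of \<open>G\<close> vanish on the orthogonal complement of the
  finite set \<open>C\<close>. For them
  \<open>norm x \<le> schatten_norm p x \<le> norm x * K\<close>, so \<open>G\<close> carries the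
  norm topology and is norm closed, and \<open>operator_group\<close> applies.\<close>

theorem compact_lie_group_of_finite_support:
  assumes C: "finite C"
    and orth: "\<And>c d. c \<in> C \<Longrightarrow> d \<in> C \<Longrightarrow> inner c d = (if c = d then 1 else (0::real))"
    and trivial: "\<And>g v. g \<in> G \<Longrightarrow> (\<And>c. c \<in> C \<Longrightarrow> inner c v = 0) \<Longrightarrow> blinfun_apply g v = v"
    and support: "\<And>g v. g \<in> G \<Longrightarrow> blinfun_apply g v - v \<in> span C"
  shows "compact_lie_group \<lparr>carrier = G, mult = (o\<^sub>L), one = id_blinfun\<rparr>
    (subtopology (schatten_unitary_topology p) G)"
proof -
  define K where "K = real (card C) powr (1 / p)"
  have K: "K \<ge> 0" by (simp add: K_def)
  have fin_rank: "x \<in> schatten_class p" "schatten_norm p x \<le> norm x * K"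
    if "complex_linear x" "\<And>v. (\<And>c. c \<in> C \<Longrightarrow> inner c v = 0) \<Longrightarrow> x v = 0" for x
    using schatten_finite_rank[OF _ that(1) C orth that(2), of p] p by (auto simp: K_def)
  \<comment> \<open>A norm limit \<open>u\<close> still fixes the complement of \<open>C\<close>, so
    \<open>u - f k\<close> has finite rank and norm convergence gives Schatten convergence, to which
    the assumed closedness applies.\<close>
  have closed_G: "closed G"
    unfolding closed_sequential_limits
  proof (intro allI impI; elim conjE)
    fix f u assume f: "\<forall>k. f k \<in> G" and lim: "f \<longlonglongrightarrow> u"
    have fG: "f k \<in> G" for k using f by blast
    have app: "(\<lambda>k. f k v) \<longlonglongrightarrow> u v" for v by (intro tendsto_intros lim)
    have lin: "complex_linear u"
      unfolding complex_linear_def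
    proof (intro allI)
      fix c v
      have bl: "bounded_linear (scaleC c)"
        by (rule bounded_linear_intro[where K = "cmod c"]) (simp_all add: scaleC_simps norm_scaleC mult.commute)
      have "f k (scaleC c v) = scaleC c (f k v)" for k
        using G_complex_linear[OF fG] by (simp add: complex_linear_def)
      then have "(\<lambda>k. f k (scaleC c v)) \<longlonglongrightarrow> scaleC c (u v)"
        using bounded_linear.tendsto[OF bl app] by simp
      then show "u (scaleC c v) = scaleC c (u v)" by (rule LIMSEQ_unique[OF app])
    qed
    have adj: "(\<lambda>k. real_adjoint (f k)) \<longlonglongrightarrow> real_adjoint u"
      by (rule bounded_linear.tendsto[OF bounded_linear_real_adjoint lim])
    have f_adj: "real_adjoint (f k) o\<^sub>L f k = id_blinfun" "f k o\<^sub>L real_adjoint (f k) = id_blinfun" for k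
      using G_unitary[OF fG] by (auto simp: unitary_op_eq)
    have "id_blinfun = real_adjoint u o\<^sub>L u"
      using bounded_bilinear.tendsto[OF bounded_bilinear_blinfun_compose adj lim]
      unfolding f_adj by (rule LIMSEQ_unique[OF tendsto_const])
    moreover have "id_blinfun = u o\<^sub>L real_adjoint u"
      using bounded_bilinear.tendsto[OF bounded_bilinear_blinfun_compose lim adj]
      unfolding f_adj by (rule LIMSEQ_unique[OF tendsto_const])
    ultimately have "unitary_op u" using lin unfolding unitary_op_eq by metis
    moreover have fix_u: "u v = v" if "\<And>c. c \<in> C \<Longrightarrow> inner c v = 0" for v
    proof -
      have "(\<lambda>k. f k v) \<longlonglongrightarrow> v" using trivial[OF fG that] by simp
      then show ?thesis by (rule LIMSEQ_unique[OF app])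
    qed
    ultimately have u: "u \<in> carrier (schatten_unitary_group p)"
      using fin_rank(1)[of "u - id_blinfun"] lin
      by (simp add: schatten_unitary_group_def complex_linear_simps blinfun.bilinear_simps)
    show "u \<in> G"
    proof (rule ccontr)
      assume "u \<notin> G"
      then obtain e where e: "e > 0"
        "{v \<in> carrier (schatten_unitary_group p). schatten_norm p (u - v) < e} \<subseteq> carrier (schatten_unitary_group p) - G"
        using closed u unfolding closedin_def schatten_unitary_topology_def topspace_metric_topology
          openin_metric_topology by blast
      have "\<not> schatten_norm p (u - f k) < e" for k using e(2) fG[of k] G_subset by blast
      moreover have "schatten_norm p (u - f k) \<le> norm (f k - u) * K" for k
        using fin_rank(2)[of "u - f k"] lin G_complex_linear[OF fG[of k]] trivial[OF fG] fix_u
        by (simp add: complex_linear_simps blinfun.bilinear_simps norm_minus_commute)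
      ultimately have "e \<le> norm (f k - u) * K" for k by (meson not_less order_trans)
      moreover have "(\<lambda>k. norm (f k - u) * K) \<longlonglongrightarrow> norm (u - u) * K"
        by (intro tendsto_intros lim)
      then have "(\<lambda>k. norm (f k - u) * K) \<longlonglongrightarrow> 0" by simp
      ultimately have "e \<le> 0" by (intro tendsto_lowerbound[OF _ _ sequentially_bot]) auto
      then show False using e(1) by simp
    qed
  qed
  have top: "subtopology (schatten_unitary_topology p) G = top_of_set G"
    unfolding G_topology topology_eq openin_metric_topology openin_euclidean_subtopology_iff
  proof (intro allI iffI; elim conjE; intro conjI ballI)
    fix S u assume "S \<subseteq> G" and S: "\<forall>x\<in>S. \<exists>r>0. {y \<in> G. schatten_norm p (x - y) < r} \<subseteq> S" and u: "u \<in> S"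
    then obtain r where r: "r > 0" "{y \<in> G. schatten_norm p (u - y) < r} \<subseteq> S" by blast
    have uG: "u \<in> G" using u \<open>S \<subseteq> G\<close> by blast
    have "v \<in> S" if v: "v \<in> G" "dist v u < r / (K + 1)" for v
    proof -
      have "schatten_norm p (u - v) \<le> norm (u - v) * K"
        using fin_rank(2)[of "u - v"] G_complex_linear uG v(1) trivial
        by (simp add: complex_linear_simps blinfun.bilinear_simps)
      also have "\<dots> \<le> norm (u - v) * (K + 1)" by (intro mult_left_mono) auto
      also have "\<dots> < r" using v(2) K by (simp add: dist_norm norm_minus_commute pos_less_divide_eq)
      finally show ?thesis using r(2) v(1) by blast
    qed
    then show "\<exists>e>0. \<forall>v\<in>G. dist v u < e \<longrightarrow> v \<in> S"
      using r(1) K by (intro exI[of _ "r / (K + 1)"]) auto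
  next
    fix S u assume "S \<subseteq> G" and S: "\<forall>x\<in>S. \<exists>e>0. \<forall>y\<in>G. dist y x < e \<longrightarrow> y \<in> S" and u: "u \<in> S"
    then obtain e where e: "e > 0" "\<And>v. v \<in> G \<Longrightarrow> dist v u < e \<Longrightarrow> v \<in> S" by blast
    have uG: "u \<in> G" using u \<open>S \<subseteq> G\<close> by blast
    have "norm (u - v) \<le> schatten_norm p (u - v)" if "v \<in> G" for v
    proof -
      note D = G_diff[OF uG that]
      have "complex_linear (u - v)" using D by (simp add: schatten_class_def)
      from norm_le_hilbert_schmidt[OF this hilbert_schmidt_le_schatten(1)[OF p D]]
        hilbert_schmidt_le_schatten(2)[OF p D]
      show ?thesis by (rule order_trans)
    qed
    then have "{v \<in> G. schatten_norm p (u - v) < e} \<subseteq> S"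
      using e(2) by (force simp: dist_norm norm_minus_commute)
    then show "\<exists>r>0. {v \<in> G. schatten_norm p (u - v) < r} \<subseteq> S" using e(1) by blast
  qed
  \<comment> \<open>Operators living on the span of \<open>C\<close>; the matrix entries
    \<open>inner c (A d)\<close> separate them.\<close>
  define E where "E = {A :: ell2 \<Rightarrow>\<^sub>L ell2. (\<forall>v. (\<forall>c\<in>C. inner c v = 0) \<longrightarrow> A v = 0) \<and> (\<forall>v. A v \<in> span C)}"
  define Q where "Q = (\<lambda>(c, d). \<lambda>A :: ell2 \<Rightarrow>\<^sub>L ell2. inner c (A d)) ` (C \<times> C)"
  have "\<exists>m B q. biorthogonal E m B q"
  proof (rule biorthogonal_basis[of Q])
    show "finite Q" unfolding Q_def using C by simp
    show "subspace E"
      by (auto simp: E_def subspace_def blinfun.bilinear_simps intro: span_zero span_add span_scale)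
    show "bounded_linear q" if "q \<in> Q" for q
    proof -
      obtain c d where "q = (\<lambda>A. inner c (blinfun_apply A d))" using \<open>q \<in> Q\<close> by (auto simp: Q_def)
      then show ?thesis
        by (simp only:) (rule bounded_linear_compose[OF bounded_linear_inner_right blinfun.bounded_linear_left])
    qed
    fix A assume A: "A \<in> E" and 0: "\<And>q. q \<in> Q \<Longrightarrow> q A = 0"
    have AC: "A d = 0" if d: "d \<in> C" for d
    proof -
      have "inner c (A d) = 0" if "c \<in> C" for c
      proof (rule 0)
        show "(\<lambda>A. inner c (blinfun_apply A d)) \<in> Q"
          unfolding Q_def using that d by (intro image_eqI[of _ _ "(c, d)"]) auto
      qed
      then have "orthogonal (A d) c" if "c \<in> C" for c
        using that by (simp add: orthogonal_def inner_commute[of "A d"])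
      moreover have "A d \<in> span C" using A unfolding E_def by blast
      ultimately have "orthogonal (A d) (A d)" by (rule orthogonal_to_span[rotated])
      then show ?thesis by (simp add: orthogonal_self)
    qed
    show "A = 0"
    proof (rule blinfun_eqI)
      fix v
      define w where "w = (\<Sum>c\<in>C. inner c v *\<^sub>R c)"
      have "inner c (v - w) = 0" if "c \<in> C" for c
      proof -
        have "inner c w = (\<Sum>d\<in>C. if d = c then inner d v else 0)"
          unfolding w_def inner_sum_right by (rule sum.cong) (auto simp: orth that)
        then show ?thesis using C that by (simp add: inner_diff_right)
      qed
      then have "A (v - w) = 0" using A unfolding E_def by blast
      moreover have "A w = 0" by (simp add: w_def blinfun.sum_right blinfun.scaleR_right AC)
      ultimately show "A v = blinfun_apply 0 v" by (simp add: blinfun.bilinear_simps)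
    qed
  qed
  then obtain m B q where basis: "biorthogonal E m B q" by blast
  have GE: "g - id_blinfun \<in> E" if "g \<in> G" for g
    using trivial[OF that] support[OF that] by (auto simp: E_def blinfun.bilinear_simps)
  interpret operator_group G real_adjoint m B q
  proof (rule operator_group.intro)
    show "real_adjoint g \<in> G" "real_adjoint g o\<^sub>L g = id_blinfun" "g o\<^sub>L real_adjoint g = id_blinfun"
      "norm g \<le> 1" if "g \<in> G" for g
      using G_adjoint G_unitary[OF that] norm_unitary_op_le that by (auto simp: unitary_op_eq)
    show "(\<Sum>k<m. q k (g - id_blinfun) *\<^sub>R B k) = g - id_blinfun" if "g \<in> G" for g
      by (rule biorthogonalD(4)[OF basis GE[OF that]])
    show "bounded_linear (q k)" if "k < m" for k by (rule biorthogonalD(2)[OF basis that])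
  qed (rule closed_G G_one G_mult bounded_linear_real_adjoint; assumption?)+
  show ?thesis unfolding top by (rule compact_lie_group)
qed

end

theorem corollary4p20:
  fixes p :: real and G :: "(ell2 \<Rightarrow>\<^sub>L ell2) set"
  assumes "1 \<le> p" and "p \<le> 2"
    and "subgroup G (schatten_unitary_group p)"
    and "closedin (schatten_unitary_topology p) G"
    and "property_FH ((schatten_unitary_group p)\<lparr>carrier := G\<rparr>)
      (subtopology (schatten_unitary_topology p) G)"
  shows "compact_lie_group ((schatten_unitary_group p)\<lparr>carrier := G\<rparr>)
      (subtopology (schatten_unitary_topology p) G)"
proof -
  interpret schatten_subgroup p G
    by (rule schatten_subgroup.intro[OF assms(1-4)])
  show ?thesis
  proof (rule finite_dimensional_support[OF assms(5)])
    fix C assume C: "finite C"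
      "\<And>c d. c \<in> C \<Longrightarrow> d \<in> C \<Longrightarrow> inner c d = (if c = d then 1 else (0::real))"
      "\<And>g v. g \<in> G \<Longrightarrow> (\<And>c. c \<in> C \<Longrightarrow> inner c v = 0) \<Longrightarrow> blinfun_apply g v = v"
      "\<And>g v. g \<in> G \<Longrightarrow> blinfun_apply g v - v \<in> span C"
    show ?thesis
      using compact_lie_group_of_finite_support[OF C] by (simp add: schatten_unitary_group_def)
  qed
qed

end
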